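(* Let $p,q>0$, $a\in\mathbb{R}$ and $\lambda\ge-a^2/2$. If $h\in\mathcal H^+\bigl(\mathfrak L_a^{\mathrm{Sol}(p,q)},\lambda\bigr)$, then there are non-negative functions $h_1\in\mathcal H^+\bigl(\mathfrak L_a^{\mathbb H(p)},\lambda\bigr)$ and $h_2\in\mathcal H^+\bigl(\mathfrak L_{-a}^{\mathbb H(q)},\lambda\bigr)$ such that for all $(x,y,z)\in\mathrm{Sol}(p,q)$, $$h(x,y,z)=h_1(x,z)+h_2(y,-z).$$
   Context: $\mathrm{Sol}(p,q)$ is $\mathbb{R}^3$ with coordinates $(x,y,z)$ and metric $e^{-2pz}dx^2+e^{2qz}dy^2+dz^2$. For $r>0$, $\mathbb H(r)$ is $\mathbb{R}^2$ with metric $e^{-2rz}dx^2+dz^2$ (hyperbolic plane of curvature $-r^2$ in logarithmic coordinates). The Laplacians with vertical drift are $$\mathfrak L_a^{\mathrm{Sol}(p,q)}=\frac12\Bigl(e^{2pz}\frac{\partial^2}{\partial x^2}+e^{-2qz}\frac{\partial^2}{\partial y^2}+\frac{\partial^2}{\partial z^2}\Bigr)+a\frac{\partial}{\partial z}$$ on $\mathrm{Sol}(p,q)$ and, for $b\in\mathbb{R}$, $r>0$, $$\mathfrak L_b^{\mathbb H(r)}=\frac12\Bigl(e^{2rz}\frac{\partial^2}{\partial x^2}+\frac{\partial^2}{\partial z^2}\Bigr)+b\frac{\partial}{\partial z}$$ on $\mathbb H(r)$. For any such operator $\mathfrak L$, $\mathcal H^+(\mathfrak L,\lambda)$ is the cone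 of all non-negative $C^2$-functions $h$ on the respective space with $\mathfrak L h=\lambda h$ (the zero function is included). *)

theory Defs
  imports "HOL-Analysis.Analysis"
begin

text \<open>
  A function is of class $C^2$ if it is twice continuously Frechet differentiable; the first and
  second derivatives take values in spaces of bounded linear maps with the operator norm.
\<close>

definition C2 :: "('a::real_normed_vector \<Rightarrow> real) \<Rightarrow> bool" where
  "C2 f \<longleftrightarrow>
    (\<exists>(f' :: 'a \<Rightarrow> 'a \<Rightarrow>\<^sub>L real) (f'' :: 'a \<Rightarrow> 'a \<Rightarrow>\<^sub>L 'a \<Rightarrow>\<^sub>L real).
       (\<forall>u. (f has_derivative blinfun_apply (f' u)) (at u)) \<and>
       (\<forall>u. (f' has_derivative blinfun_apply (f'' u)) (at u)) \<and>
       continuous_on UNIV f'')"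

text \<open>
  The spaces $\mathrm{Sol}(p,q)$ and $\mathbb{H}(r)$ are represented by their global coordinates
  $(x,y,z)$ and $(x,z)$.  Since \<open>deriv\<close> is unspecified where a derivative fails to exist, these operators are only
  meaningful at $C^2$ functions, to which \<open>H_plus\<close> below restricts them.
\<close>

definition L_Sol :: "real \<Rightarrow> real \<Rightarrow> real \<Rightarrow> (real \<times> real \<times> real \<Rightarrow> real) \<Rightarrow> real \<times> real \<times> real \<Rightarrow> real"
  where
  "L_Sol p q a h = (\<lambda>(x, y, z).
     1 / 2 * (exp (2 * p * z) * (deriv ^^ 2) (\<lambda>t. h (t, y, z)) x
              + exp (- 2 * q * z) * (deriv ^^ 2) (\<lambda>t. h (x, t, z)) y
              + (deriv ^^ 2) (\<lambda>t. h (x, y, t)) z)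
     + a * deriv (\<lambda>t. h (x, y, t)) z)"

definition L_Hyp :: "real \<Rightarrow> real \<Rightarrow> (real \<times> real \<Rightarrow> real) \<Rightarrow> real \<times> real \<Rightarrow> real"
  where
  "L_Hyp r b h = (\<lambda>(x, z).
     1 / 2 * (exp (2 * r * z) * (deriv ^^ 2) (\<lambda>t. h (t, z)) x
              + (deriv ^^ 2) (\<lambda>t. h (x, t)) z)
     + b * deriv (\<lambda>t. h (x, t)) z)"

definition H_plus ::
  "(('a::real_normed_vector \<Rightarrow> real) \<Rightarrow> 'a \<Rightarrow> real) \<Rightarrow> real \<Rightarrow> ('a \<Rightarrow> real) set" where
  "H_plus L lam = {h. C2 h \<and> (\<forall>u. 0 \<le> h u) \<and> (\<forall>u. L h u = lam * h u)}"

end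

theory Submission
  imports Defs
begin

text \<open>
  Conjugation with \<open>exp (a * z)\<close> turns \<open>h\<close> into a nonnegative solution \<open>u\<close> of
  $e^{2pz}u_{xx}+e^{-2qz}u_{yy}+u_{zz}=m\,u$ with $m=2\lambda+a^2\ge 0$. The theorem rests on one
  fact, \<open>mixed_difference_vanishes\<close>: all mixed differences
  $u(x+s,y+t,z)-u(x,y+t,z)-u(x+s,y,z)+u(x,y,z)$ are zero, so that $u$ is the sum of a function of
  $(x,z)$ and a function of $(y,z)$.

  The reason is geometric. A translation by $s$ in the direction $x$ moves points at height $z$ by a
  distance which tends to $0$ as $z\to+\infty$, a translation by $t$ in the direction $y$ does so as
  $z\to-\infty$. A positive eigenfunction hardly changes under small displacements, relative to
  its own size, so the mixed difference is negligible against the eigenfunction at both ends. It solves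
  the same linear equation, and a maximum principle for the quotient (\<open>max_principle_quotient\<close>)
  makes it vanish.

  This argument is carried out for the convolution $U$ of $u$ in $x$ and $y$ with
  $\cosh^{-3}(kx)\cosh^{-3}(ky)$. The operator commutes with translations in $x$ and $y$, so $U$
  is again an eigenfunction. The derivatives of the kernel are bounded by multiples of the kernel,
  so $|U_x|,|U_{xx}|,|U_y|,|U_{yy}|\le K\,U$ on the whole space. For $z\ge 0$ the term
  $e^{-2qz}U_{yy}$ is then a bounded multiple of $U$. With $y$ fixed, the rest of the operator is
  conformal to the flat Laplacian in the coordinates $x$ and $t=e^{pz}/p$, and $\sqrt t\,U$ satisfies
  $|\Delta w|\le C w/t^2$ there. Such functions almost have the mean value property, and a comparison of
  means over two nearly equal discs shows that $U(x+s,y,z)/U(x,y,z)\to 1$ as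
  $z\to\infty$ (\<open>horizontal_ratio_limit\<close>). The other end follows by symmetry. Finally $k\to\infty$
  removes the smoothing (\<open>vanishing_of_all_means\<close>).

  That the convolution converges is a growth estimate for $u$ (\<open>sech_kernel_integrable\<close>). A
  compactly supported truncation $f$ of $\cosh^{-3}(kx)$ satisfies $f''\ge\Lambda f$ away
  from the origin with $\Lambda$ of the order of $k^2$. The function $A(z)=\int u f g$ then
  satisfies $A''\le -17A+B$ on $[-1,1]$, where $B$ only involves a fixed bump in place of $f$; a
  nonnegative function cannot do this unless $A(0)$ is bounded by a multiple of $B$
  (\<open>interval_sturm_bound\<close>). So the bound does not depend on the truncation.

  It remains to make both summands nonnegative. They are determined up to a function $\kappa(z)$ with
  $\kappa''=m\kappa$ which may be moved from one to the other. The solutions $\kappa_n$ whose values at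
  $z=\pm n$ are the infima over $x$ of the first summand give two nonnegative functions on the
  strip $|z|\le n$ by a maximum principle (\<open>nonneg_on_strip\<close>), and a subsequence of them
  converges (\<open>vertical_sandwich\<close>).
\<close>

section \<open>One-dimensional differential inequalities\<close>

text \<open>
  If $A'+DA$ were too negative at \<open>z0\<close>, it would stay so: \<open>exp (- D * z) * (A1 z + D * A z)\<close>
  decreases, and this drives \<open>A\<close> below zero within unit length. Together with the mirror image
  and Gronwall's lemma this is Harnack's inequality in the vertical direction.
\<close>

lemma log_derivative_lower:
  fixes A A1 A2 :: "real \<Rightarrow> real"
  assumes D: "D > 0"
    and d1: "\<And>z. z \<in> {z0..z0+1} \<Longrightarrow> (A has_real_derivative A1 z) (at z)"
    and d2: "\<And>z. z \<in> {z0..z0+1} \<Longrightarrow> (A1 has_real_derivative A2 z) (at z)"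
    and pos: "\<And>z. z \<in> {z0..z0+1} \<Longrightarrow> 0 \<le> A z"
    and le: "\<And>z. z \<in> {z0..z0+1} \<Longrightarrow> A2 z \<le> D\<^sup>2 * A z"
  shows "- (D + 1) * A z0 \<le> A1 z0"
proof (rule ccontr)
  assume neg: "\<not> - (D + 1) * A z0 \<le> A1 z0"
  define c where "c = - (A1 z0 + D * A z0)"
  have c: "c > A z0" using neg by (simp add: c_def algebra_simps)
  have A0: "A z0 \<ge> 0" using pos by simp
  define G where "G = (\<lambda>z. exp (- D * z) * (A1 z + D * A z))"
  have G: "G z \<le> G z0" if z: "z \<in> {z0..z0+1}" for z
  proof (rule DERIV_nonpos_imp_nonincreasing[of z0 z G])
    show "z0 \<le> z" using z by simp
  next
    fix t assume t: "z0 \<le> t" "t \<le> z"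
    then have t': "t \<in> {z0..z0+1}" using z by auto
    have "(G has_real_derivative
        exp (- D * t) * (- D) * (A1 t + D * A t) + exp (- D * t) * (A2 t + D * A1 t)) (at t)"
      unfolding G_def using d1[OF t'] d2[OF t']
      by (auto intro!: derivative_eq_intros simp: algebra_simps)
    moreover have "exp (- D * t) * (- D) * (A1 t + D * A t) + exp (- D * t) * (A2 t + D * A1 t)
        = exp (- D * t) * (A2 t - D\<^sup>2 * A t)"
      by (simp add: algebra_simps power2_eq_square)
    moreover have "\<dots> \<le> 0"
      using le[OF t'] by (simp add: mult_nonneg_nonpos)
    ultimately show "\<exists>y. (G has_real_derivative y) (at t) \<and> y \<le> 0" by metis
  qed
  define H where "H = (\<lambda>z. exp (D * z) * A z + c * exp (D * z0) * z)"
  have "H (z0 + 1) \<le> H z0"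
  proof (rule DERIV_nonpos_imp_nonincreasing[of z0 "z0+1" H])
    fix t assume t: "z0 \<le> t" "t \<le> z0 + 1"
    then have t': "t \<in> {z0..z0+1}" by auto
    have der: "(H has_real_derivative exp (D * t) * (A1 t + D * A t) + c * exp (D * z0)) (at t)"
      unfolding H_def using d1[OF t']
      by (auto intro!: derivative_eq_intros simp: algebra_simps)
    have "exp (D * t) * (A1 t + D * A t) = exp (2 * D * t) * G t"
      by (simp add: G_def exp_add[symmetric] flip: mult.assoc)
    also have "\<dots> \<le> exp (2 * D * t) * G z0"
      using G[OF t'] by simp
    also have "\<dots> = - (c * exp (2 * D * t - D * z0))"
      by (simp add: G_def c_def exp_diff exp_minus field_simps)
    also have "\<dots> \<le> - (c * exp (D * z0))"
    proof -
      have "D * z0 \<le> D * t" using t D by simp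
      then have "exp (D * z0) \<le> exp (2 * D * t - D * z0)" by simp
      moreover have "c > 0" using c A0 by simp
      ultimately show ?thesis by simp
    qed
    finally have "exp (D * t) * (A1 t + D * A t) + c * exp (D * z0) \<le> 0" by simp
    then show "\<exists>y. (H has_real_derivative y) (at t) \<and> y \<le> 0" using der by blast
  qed simp
  then have "exp (D * (z0 + 1)) * A (z0 + 1) \<le> exp (D * z0) * (A z0 - c)"
    by (simp add: H_def algebra_simps)
  moreover have "\<dots> < 0" using c by (simp add: mult_pos_neg)
  moreover have "0 \<le> exp (D * (z0 + 1)) * A (z0 + 1)" using pos by simp
  ultimately show False by linarith
qed

lemma log_derivative_upper:
  fixes A A1 A2 :: "real \<Rightarrow> real"
  assumes D: "D > 0"
    and d1: "\<And>z. z \<in> {z0-1..z0} \<Longrightarrow> (A has_real_derivative A1 z) (at z)"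
    and d2: "\<And>z. z \<in> {z0-1..z0} \<Longrightarrow> (A1 has_real_derivative A2 z) (at z)"
    and pos: "\<And>z. z \<in> {z0-1..z0} \<Longrightarrow> 0 \<le> A z"
    and le: "\<And>z. z \<in> {z0-1..z0} \<Longrightarrow> A2 z \<le> D\<^sup>2 * A z"
  shows "A1 z0 \<le> (D + 1) * A z0"
proof -
  have "- (D + 1) * A (- (- z0)) \<le> - A1 (- (- z0))"
  proof (rule log_derivative_lower[where A = "\<lambda>z. A (- z)" and ?A1.0 = "\<lambda>z. - A1 (- z)"
        and ?A2.0 = "\<lambda>z. A2 (- z)"])
    fix z assume "z \<in> {- z0..- z0 + 1}"
    then have z: "- z \<in> {z0-1..z0}" by auto
    show "((\<lambda>z. A (- z)) has_real_derivative - A1 (- z)) (at z)"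
      using DERIV_chain2[OF d1[OF z] DERIV_minus[OF DERIV_ident]] by simp
    show "((\<lambda>z. - A1 (- z)) has_real_derivative A2 (- z)) (at z)"
      using DERIV_minus[OF DERIV_chain2[OF d2[OF z] DERIV_minus[OF DERIV_ident]]] by simp
    show "0 \<le> A (- z)" "A2 (- z) \<le> D\<^sup>2 * A (- z)" using pos[OF z] le[OF z] by auto
  qed (rule D)
  then show ?thesis by (simp add: algebra_simps)
qed

lemma gronwall_upper:
  fixes A A1 :: "real \<Rightarrow> real"
  assumes "a \<le> b"
    and d: "\<And>z. z \<in> {a..b} \<Longrightarrow> (A has_real_derivative A1 z) (at z)"
    and le: "\<And>z. z \<in> {a..b} \<Longrightarrow> A1 z \<le> E * A z"
  shows "A b \<le> exp (E * (b - a)) * A a"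
proof -
  have "exp (- E * b) * A b \<le> exp (- E * a) * A a"
  proof (rule DERIV_nonpos_imp_nonincreasing[of a b "\<lambda>z. exp (- E * z) * A z"])
    fix z assume "a \<le> z" "z \<le> b"
    then have z: "z \<in> {a..b}" by simp
    have "((\<lambda>z. exp (- E * z) * A z) has_real_derivative exp (- E * z) * (A1 z - E * A z)) (at z)"
      using d[OF z] by (auto intro!: derivative_eq_intros simp: algebra_simps)
    moreover have "exp (- E * z) * (A1 z - E * A z) \<le> 0"
      using le[OF z] by (simp add: mult_nonneg_nonpos)
    ultimately show "\<exists>y. ((\<lambda>z. exp (- E * z) * A z) has_real_derivative y) (at z) \<and> y \<le> 0"
      by blast
  qed (rule assms(1))
  then have "exp (E * b) * (exp (- E * b) * A b) \<le> exp (E * b) * (exp (- E * a) * A a)"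
    by simp
  then show ?thesis
    by (simp add: exp_add[symmetric] algebra_simps flip: mult.assoc)
qed

lemma gronwall_lower:
  fixes A A1 :: "real \<Rightarrow> real"
  assumes "a \<le> b"
    and d: "\<And>z. z \<in> {a..b} \<Longrightarrow> (A has_real_derivative A1 z) (at z)"
    and ge: "\<And>z. z \<in> {a..b} \<Longrightarrow> - E * A z \<le> A1 z"
  shows "A a \<le> exp (E * (b - a)) * A b"
proof -
  have "- A b \<le> exp (- E * (b - a)) * - A a"
  proof (rule gronwall_upper[where ?A1.0 = "\<lambda>z. - A1 z"])
    fix z assume z: "z \<in> {a..b}"
    show "((\<lambda>z. - A z) has_real_derivative - A1 z) (at z)" using d[OF z] by (rule DERIV_minus)
    show "- A1 z \<le> - E * - A z" using ge[OF z] by simp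
  qed (rule assms(1))
  then have "exp (E * (b - a)) * (exp (- E * (b - a)) * A a) \<le> exp (E * (b - a)) * A b" by simp
  then show ?thesis by (simp add: exp_add[symmetric] flip: mult.assoc)
qed

lemma second_derivative_local_max:
  fixes f f1 :: "real \<Rightarrow> real"
  assumes e: "e > 0"
    and d1: "\<And>t. \<bar>t - x\<bar> < e \<Longrightarrow> (f has_real_derivative f1 t) (at t)"
    and d2: "(f1 has_real_derivative d) (at x)"
    and mx: "\<And>t. \<bar>t - x\<bar> < e \<Longrightarrow> f t \<le> f x"
  shows "d \<le> 0"
proof (rule ccontr)
  assume "\<not> d \<le> 0"
  then have "d > 0" by simp
  have f1x: "f1 x = 0"
    by (rule DERIV_local_max[OF d1[of x] e]) (use e mx in \<open>auto simp: abs_minus_commute\<close>)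
  obtain e' where e': "e' > 0" "\<And>h. h > 0 \<Longrightarrow> h < e' \<Longrightarrow> f1 x < f1 (x + h)"
    using DERIV_pos_inc_right[OF d2 \<open>d > 0\<close>] by auto
  define h where "h = min e e' / 2"
  have h: "h > 0" "h < e" "h < e'" using e e' by (auto simp: h_def)
  have "f x < f (x + h)"
  proof (rule DERIV_pos_imp_increasing_open[of x "x + h" f])
    show "x < x + h" using h by simp
    fix t assume t: "x < t" "t < x + h"
    have "(f has_real_derivative f1 t) (at t)" using d1[of t] t h by auto
    moreover have "f1 t > 0" using e'(2)[of "t - x"] t h f1x by auto
    ultimately show "\<exists>y. (f has_real_derivative y) (at t) \<and> y > 0" by blast
  next
    have "\<forall>t\<in>{x..x+h}. (f has_real_derivative f1 t) (at t)" using d1 h by auto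
    then show "continuous_on {x..x + h} f"
      by (meson DERIV_isCont continuous_at_imp_continuous_on)
  qed
  moreover have "f (x + h) \<le> f x" using mx[of "x + h"] h by auto
  ultimately show False by simp
qed

text \<open>
  On an interval of length 2 a nonnegative function cannot satisfy $A''\le-17A$, because it
  oscillates too fast; an inhomogeneous term \<open>b\<close> can only be compensated by values of size
  \<open>b\<close>. The test function $\theta=(1-z^2)^2$ vanishes to second order at the end points and satisfies
  $\theta''\ge-16\theta$, which is where the number 17 comes from.
\<close>

lemma interval_sturm_bound:
  fixes A A1 A2 :: "real \<Rightarrow> real"
  assumes D: "D > 0"
    and d1: "\<And>z. \<bar>z\<bar> \<le> 2 \<Longrightarrow> (A has_real_derivative A1 z) (at z)"
    and d2: "\<And>z. \<bar>z\<bar> \<le> 2 \<Longrightarrow> (A1 has_real_derivative A2 z) (at z)"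
    and c2: "continuous_on {-1..1} A2"
    and pos: "\<And>z. \<bar>z\<bar> \<le> 2 \<Longrightarrow> 0 \<le> A z"
    and le: "\<And>z. \<bar>z\<bar> \<le> 2 \<Longrightarrow> A2 z \<le> D\<^sup>2 * A z"
    and strong: "\<And>z. \<bar>z\<bar> \<le> 1 \<Longrightarrow> A2 z \<le> - 17 * A z + b"
  shows "A 0 \<le> exp (D + 1) * b"
proof -
  define \<theta> where "\<theta> = (\<lambda>z::real. (1 - z\<^sup>2)\<^sup>2)"
  define \<theta>1 where "\<theta>1 = (\<lambda>z::real. - 4 * z * (1 - z\<^sup>2))"
  define \<theta>2 where "\<theta>2 = (\<lambda>z::real. 12 * z\<^sup>2 - 4)"
  have dc1: "(\<theta> has_real_derivative \<theta>1 z) (at z)" for z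
    unfolding \<theta>_def \<theta>1_def by (auto intro!: derivative_eq_intros)
  have dc2: "(\<theta>1 has_real_derivative \<theta>2 z) (at z)" for z
    unfolding \<theta>1_def \<theta>2_def
    by (auto intro!: derivative_eq_intros simp: algebra_simps power2_eq_square)
  have cA: "continuous_on {-1..1} A"
    by (rule continuous_at_imp_continuous_on) (auto intro!: DERIV_isCont[OF d1])
  have c\<theta>: "continuous_on {-1..1} \<theta>" "continuous_on {-1..1} \<theta>2"
    unfolding \<theta>_def \<theta>2_def by (auto intro!: continuous_intros)
  have "((\<lambda>z. A2 z * \<theta> z - A z * \<theta>2 z) has_integral
      (A1 1 * \<theta> 1 - A 1 * \<theta>1 1) - (A1 (-1) * \<theta> (-1) - A (-1) * \<theta>1 (-1))) {-1..1}"
  proof (rule fundamental_theorem_of_calculus)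
    fix z :: real assume "z \<in> {-1..1}"
    then have z: "\<bar>z\<bar> \<le> 2" by auto
    have "((\<lambda>z. A1 z * \<theta> z - A z * \<theta>1 z) has_real_derivative A2 z * \<theta> z - A z * \<theta>2 z) (at z)"
      using d1[OF z] d2[OF z] dc1[of z] dc2[of z]
      by (auto intro!: derivative_eq_intros simp: algebra_simps)
    then show "((\<lambda>z. A1 z * \<theta> z - A z * \<theta>1 z) has_vector_derivative A2 z * \<theta> z - A z * \<theta>2 z)
        (at z within {-1..1})"
      by (simp add: has_real_derivative_iff_has_vector_derivative has_vector_derivative_at_within)
  qed simp
  then have I0: "((\<lambda>z. A2 z * \<theta> z - A z * \<theta>2 z) has_integral 0) {-1..1}"
    by (simp add: \<theta>_def \<theta>1_def)
  have cint: "(\<lambda>z. (b - A z) * \<theta> z) integrable_on {-1..1}"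
    by (intro integrable_continuous_interval continuous_intros cA c\<theta>)
  have "0 \<le> integral {-1..1} (\<lambda>z. (b - A z) * \<theta> z)"
  proof (rule has_integral_le[OF I0 integrable_integral[OF cint]])
    fix z :: real assume "z \<in> {-1..1}"
    then have z: "\<bar>z\<bar> \<le> 1" "\<bar>z\<bar> \<le> 2" by auto
    have chi0: "\<theta> z \<ge> 0" by (simp add: \<theta>_def)
    have key: "- 16 * \<theta> z \<le> \<theta>2 z"
    proof -
      have "\<theta>2 z + 16 * \<theta> z = (4 * z\<^sup>2 - 5/2)\<^sup>2 + 23/4"
        by (simp add: \<theta>_def \<theta>2_def power2_eq_square algebra_simps)
      moreover have "0 \<le> (4 * z\<^sup>2 - 5/2)\<^sup>2" by (rule zero_le_power2)
      ultimately show ?thesis by linarith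
    qed
    have "A2 z * \<theta> z \<le> (- 17 * A z + b) * \<theta> z"
      using strong[OF z(1)] chi0 by (rule mult_right_mono)
    moreover have "A z * (- 16 * \<theta> z) \<le> A z * \<theta>2 z"
      using key pos[OF z(2)] by (rule mult_left_mono)
    ultimately show "A2 z * \<theta> z - A z * \<theta>2 z \<le> (b - A z) * \<theta> z"
      by (simp add: algebra_simps)
  qed
  also have "\<dots> \<le> integral {-1..1} (\<lambda>z. (b - exp (- (D + 1)) * A 0) * \<theta> z)"
  proof (rule integral_le[OF cint])
    show "(\<lambda>z. (b - exp (- (D + 1)) * A 0) * \<theta> z) integrable_on {-1..1}"
      by (intro integrable_continuous_interval continuous_intros c\<theta>)
    fix z :: real assume "z \<in> {-1..1}"
    then have z: "\<bar>z\<bar> \<le> 1" by auto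
    have chi0: "\<theta> z \<ge> 0" by (simp add: \<theta>_def)
    have lo: "- (D + 1) * A t \<le> A1 t" if "\<bar>t\<bar> \<le> 1" for t
      by (rule log_derivative_lower[OF D, where ?A2.0 = A2]) (use that d1 d2 pos le in auto)
    have up: "A1 t \<le> (D + 1) * A t" if "\<bar>t\<bar> \<le> 1" for t
      by (rule log_derivative_upper[OF D, where ?A2.0 = A2]) (use that d1 d2 pos le in auto)
    have "A 0 \<le> exp (D + 1) * A z"
    proof -
      have "A 0 \<le> exp ((D + 1) * \<bar>z\<bar>) * A z"
      proof (cases "z \<ge> 0")
        case True
        then show ?thesis
          using gronwall_lower[of 0 z A A1 "D + 1"] d1 lo z by auto
      next
        case False
        then show ?thesis
          using gronwall_upper[of z 0 A A1 "D + 1"] d1 up z by auto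
      qed
      also have "\<dots> \<le> exp (D + 1) * A z"
        using z D pos[of z] by (intro mult_right_mono) (auto simp: mult_left_le)
      finally show ?thesis .
    qed
    then have "exp (- (D + 1)) * A 0 \<le> exp (- (D + 1)) * (exp (D + 1) * A z)" by simp
    then have "exp (- (D + 1)) * A 0 \<le> A z"
      by (simp add: exp_add[symmetric] flip: mult.assoc)
    then show "(b - A z) * \<theta> z \<le> (b - exp (- (D + 1)) * A 0) * \<theta> z"
      using chi0 by (intro mult_right_mono) auto
  qed
  also have "\<dots> = (b - exp (- (D + 1)) * A 0) * (16/15)"
  proof -
    define F where "F = (\<lambda>z::real. z - 2 * z^3 / 3 + z^5 / 5)"
    have "(\<theta> has_integral (F 1 - F (-1))) {-1..1::real}"
    proof (rule fundamental_theorem_of_calculus)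
      fix z :: real assume "z \<in> {-1..1}"
      have "(F has_real_derivative \<theta> z) (at z)"
        unfolding F_def \<theta>_def by (auto intro!: derivative_eq_intros
            simp: algebra_simps power2_eq_square power4_eq_xxxx)
      then show "(F has_vector_derivative \<theta> z) (at z within {-1..1})"
        by (simp add: has_real_derivative_iff_has_vector_derivative has_vector_derivative_at_within)
    qed simp
    then have "(\<theta> has_integral (16/15)) {-1..1::real}" by (simp add: F_def)
    then show ?thesis
      using has_integral_mult_right[of \<theta> "16/15" "{-1..1}"] by (simp add: integral_unique)
  qed
  finally have "exp (- (D + 1)) * A 0 \<le> b" by simp
  then have "exp (D + 1) * (exp (- (D + 1)) * A 0) \<le> exp (D + 1) * b" by simp
  then show ?thesis by (simp add: exp_add[symmetric] flip: mult.assoc)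
qed

section \<open>Eigenfunctions in exponential coordinates and a maximum principle\<close>

abbreviation cont3 :: "(real \<Rightarrow> real \<Rightarrow> real \<Rightarrow> real) \<Rightarrow> bool" where
  "cont3 F \<equiv> continuous_on UNIV (\<lambda>(x, y, z). F x y z)"

lemma cont3D:
  assumes "cont3 F" "continuous_on S a" "continuous_on S b" "continuous_on S c"
  shows "continuous_on S (\<lambda>t. F (a t) (b t) (c t))"
  using continuous_on_compose2[OF assms(1) continuous_on_Pair[OF assms(2)
        continuous_on_Pair[OF assms(3,4)]]] by simp

lemma cont3I:
  "continuous_on UNIV (\<lambda>v. F (fst v) (fst (snd v)) (snd (snd v))) \<Longrightarrow> cont3 F"
  by (simp add: case_prod_beta)

text \<open>
  The conjugated eigenvalue equation. The partial derivatives are parameters of the locale, because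
  limits, differences and convolutions of solutions come with explicit formulas for them.
\<close>

locale eigenfunction =
  fixes p q m :: real and u ux uxx uy uyy uz uzz :: "real \<Rightarrow> real \<Rightarrow> real \<Rightarrow> real"
  assumes dx: "((\<lambda>t. u t y z) has_real_derivative ux x y z) (at x)"
    and dxx: "((\<lambda>t. ux t y z) has_real_derivative uxx x y z) (at x)"
    and dy: "((\<lambda>t. u x t z) has_real_derivative uy x y z) (at y)"
    and dyy: "((\<lambda>t. uy x t z) has_real_derivative uyy x y z) (at y)"
    and dz: "((\<lambda>t. u x y t) has_real_derivative uz x y z) (at z)"
    and dzz: "((\<lambda>t. uz x y t) has_real_derivative uzz x y z) (at z)"
    and cont: "cont3 u" "cont3 ux" "cont3 uxx" "cont3 uy" "cont3 uyy" "cont3 uz" "cont3 uzz"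
    and pde: "exp (2 * p * z) * uxx x y z + exp (- 2 * q * z) * uyy x y z + uzz x y z = m * u x y z"

text \<open>
  Reflection in the vertical direction exchanges the roles of \<open>x\<close> and \<open>y\<close>, so only one of the two
  ends of the space has to be studied.
\<close>

lemma eigenfunction_swap:
  assumes "eigenfunction p q m u ux uxx uy uyy uz uzz"
  shows "eigenfunction q p m (\<lambda>x y z. u y x (- z)) (\<lambda>x y z. uy y x (- z)) (\<lambda>x y z. uyy y x (- z))
    (\<lambda>x y z. ux y x (- z)) (\<lambda>x y z. uxx y x (- z)) (\<lambda>x y z. - uz y x (- z)) (\<lambda>x y z. uzz y x (- z))"
proof -
  interpret eigenfunction p q m u ux uxx uy uyy uz uzz by fact
  show ?thesis
  proof
    fix x y z
    show "((\<lambda>t. u y x (- t)) has_real_derivative - uz y x (- z)) (at z)"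
      using DERIV_chain2[OF dz DERIV_minus[OF DERIV_ident]] by simp
    show "((\<lambda>t. - uz y x (- t)) has_real_derivative uzz y x (- z)) (at z)"
      using DERIV_minus[OF DERIV_chain2[OF dzz DERIV_minus[OF DERIV_ident]]] by simp
    show "exp (2 * q * z) * uyy y x (- z) + exp (- 2 * p * z) * uxx y x (- z) + uzz y x (- z)
        = m * u y x (- z)"
      using pde[of "- z" y x] by simp
  qed (rule dx dxx dy dyy | rule cont3I, rule cont3D, rule cont, (intro continuous_intros)+
      | rule cont3I, intro continuous_intros, rule cont3D, rule cont, (intro continuous_intros)+)+
qed

lemma eigenfunction_shift:
  assumes "eigenfunction p q m u ux uxx uy uyy uz uzz"
  shows "eigenfunction p q m (\<lambda>x y z. u (x + s) (y + t) z) (\<lambda>x y z. ux (x + s) (y + t) z)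
    (\<lambda>x y z. uxx (x + s) (y + t) z) (\<lambda>x y z. uy (x + s) (y + t) z) (\<lambda>x y z. uyy (x + s) (y + t) z)
    (\<lambda>x y z. uz (x + s) (y + t) z) (\<lambda>x y z. uzz (x + s) (y + t) z)"
proof -
  interpret eigenfunction p q m u ux uxx uy uyy uz uzz by fact
  have sh: "((\<lambda>x. x + c) has_real_derivative 1) (at x)" for c x :: real
    by (auto intro!: derivative_eq_intros)
  show ?thesis
  proof
    fix x y z
    show "((\<lambda>x. u (x + s) (y + t) z) has_real_derivative ux (x + s) (y + t) z) (at x)"
      using DERIV_chain2[OF dx sh] by simp
    show "((\<lambda>x. ux (x + s) (y + t) z) has_real_derivative uxx (x + s) (y + t) z) (at x)"
      using DERIV_chain2[OF dxx sh] by simp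
    show "((\<lambda>y. u (x + s) (y + t) z) has_real_derivative uy (x + s) (y + t) z) (at y)"
      using DERIV_chain2[OF dy sh] by simp
    show "((\<lambda>y. uy (x + s) (y + t) z) has_real_derivative uyy (x + s) (y + t) z) (at y)"
      using DERIV_chain2[OF dyy sh] by simp
  qed (rule dz dzz pde | rule cont3I, rule cont3D, rule cont, (intro continuous_intros)+)+
qed

lemma eigenfunction_diff:
  assumes "eigenfunction p q m u ux uxx uy uyy uz uzz" "eigenfunction p q m v vx vxx vy vyy vz vzz"
  shows "eigenfunction p q m (\<lambda>x y z. u x y z - v x y z) (\<lambda>x y z. ux x y z - vx x y z)
    (\<lambda>x y z. uxx x y z - vxx x y z) (\<lambda>x y z. uy x y z - vy x y z) (\<lambda>x y z. uyy x y z - vyy x y z)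
    (\<lambda>x y z. uz x y z - vz x y z) (\<lambda>x y z. uzz x y z - vzz x y z)"
proof -
  interpret u: eigenfunction p q m u ux uxx uy uyy uz uzz by fact
  interpret v: eigenfunction p q m v vx vxx vy vyy vz vzz by fact
  show ?thesis
  proof
    fix x y z
    show "exp (2 * p * z) * (uxx x y z - vxx x y z) + exp (- 2 * q * z) * (uyy x y z - vyy x y z)
       + (uzz x y z - vzz x y z) = m * (u x y z - v x y z)"
      using u.pde[of z x y] v.pde[of z x y] by (simp add: algebra_simps)
  qed (rule DERIV_diff, (rule u.dx u.dxx u.dy u.dyy u.dz u.dzz, rule v.dx v.dxx v.dy v.dyy v.dz v.dzz)
     | rule cont3I, intro continuous_intros, rule cont3D, rule u.cont, (intro continuous_intros)+,
       rule cont3D, rule v.cont, (intro continuous_intros)+)+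
qed

lemma eigenfunction_add_vertical:
  assumes "eigenfunction p q m u ux uxx uy uyy uz uzz" and "m \<ge> 0"
  shows "eigenfunction p q m (\<lambda>x y z. u x y z + exp (sqrt m * z)) ux uxx uy uyy
    (\<lambda>x y z. uz x y z + sqrt m * exp (sqrt m * z)) (\<lambda>x y z. uzz x y z + m * exp (sqrt m * z))"
proof -
  interpret u: eigenfunction p q m u ux uxx uy uyy uz uzz by fact
  have e: "((\<lambda>z. exp (sqrt m * z)) has_real_derivative sqrt m * exp (sqrt m * z)) (at z)" for z
    by (auto intro!: derivative_eq_intros)
  have e2: "((\<lambda>z. sqrt m * exp (sqrt m * z)) has_real_derivative m * exp (sqrt m * z)) (at z)" for z
    using assms(2) by (auto intro!: derivative_eq_intros)
  show ?thesis
  proof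
    fix x y z
    show "((\<lambda>t. u t y z + exp (sqrt m * z)) has_real_derivative ux x y z) (at x)"
      using DERIV_add[OF u.dx DERIV_const] by simp
    show "((\<lambda>t. u x t z + exp (sqrt m * z)) has_real_derivative uy x y z) (at y)"
      using DERIV_add[OF u.dy DERIV_const] by simp
    show "exp (2 * p * z) * uxx x y z + exp (- 2 * q * z) * uyy x y z
       + (uzz x y z + m * exp (sqrt m * z)) = m * (u x y z + exp (sqrt m * z))"
      using u.pde[of z x y] by (simp add: algebra_simps)
    show "((\<lambda>t. u x y t + exp (sqrt m * t)) has_real_derivative uz x y z + sqrt m * exp (sqrt m * z)) (at z)"
      by (rule DERIV_add[OF u.dz e])
    show "((\<lambda>t. uz x y t + sqrt m * exp (sqrt m * t)) has_real_derivative uzz x y z + m * exp (sqrt m *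
        z)) (at z)"
      by (rule DERIV_add[OF u.dzz e2])
  qed (rule u.dxx u.dyy u.cont | rule cont3I, intro continuous_intros, rule cont3D, rule u.cont, (intro
      continuous_intros)+)+
qed

lemma japanese_bracket_derivs:
  fixes t :: real
  shows "((\<lambda>t. sqrt (1 + t\<^sup>2)) has_real_derivative t / sqrt (1 + t\<^sup>2)) (at t)"
    and "((\<lambda>t. t / sqrt (1 + t\<^sup>2)) has_real_derivative 1 / sqrt (1 + t\<^sup>2) ^ 3) (at t)"
    and "\<bar>t / sqrt (1 + t\<^sup>2)\<bar> \<le> 1" "0 \<le> 1 / sqrt (1 + t\<^sup>2) ^ 3" "1 / sqrt (1 + t\<^sup>2) ^ 3 \<le> 1"
    and "\<bar>t\<bar> \<le> sqrt (1 + t\<^sup>2)"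
proof -
  have pos: "1 + t\<^sup>2 > 0" by (simp add: add_pos_nonneg)
  then have sp: "sqrt (1 + t\<^sup>2) > 0" by simp
  show d: "((\<lambda>t. sqrt (1 + t\<^sup>2)) has_real_derivative t / sqrt (1 + t\<^sup>2)) (at t)"
    using pos by (auto intro!: derivative_eq_intros simp: divide_simps)
  have "((\<lambda>t. t / sqrt (1 + t\<^sup>2)) has_real_derivative
      (1 * sqrt (1 + t\<^sup>2) - t * (t / sqrt (1 + t\<^sup>2))) / (sqrt (1 + t\<^sup>2) * sqrt (1 + t\<^sup>2))) (at t)"
    using sp by (intro DERIV_divide[OF DERIV_ident d]) simp
  moreover have "(1 * sqrt (1 + t\<^sup>2) - t * (t / sqrt (1 + t\<^sup>2))) / (sqrt (1 + t\<^sup>2) * sqrt (1 + t\<^sup>2))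
      = 1 / sqrt (1 + t\<^sup>2) ^ 3"
  proof -
    have "sqrt (1 + t\<^sup>2) * sqrt (1 + t\<^sup>2) = 1 + t * t" using pos by (simp add: power2_eq_square)
    then show ?thesis using sp
      by (simp add: field_simps power3_eq_cube)
  qed
  ultimately show "((\<lambda>t. t / sqrt (1 + t\<^sup>2)) has_real_derivative 1 / sqrt (1 + t\<^sup>2) ^ 3) (at t)"
    by simp
  show le: "\<bar>t\<bar> \<le> sqrt (1 + t\<^sup>2)" by (rule real_le_rsqrt) simp
  then show "\<bar>t / sqrt (1 + t\<^sup>2)\<bar> \<le> 1" using sp by (simp add: divide_simps)
  show "0 \<le> 1 / sqrt (1 + t\<^sup>2) ^ 3" by simp
  have "1 \<le> sqrt (1 + t\<^sup>2)" by simp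
  then have "1 \<le> sqrt (1 + t\<^sup>2) ^ 3" by (rule one_le_power)
  then show "1 / sqrt (1 + t\<^sup>2) ^ 3 \<le> 1" using sp by (simp del: one_le_power)
qed

text \<open>
  If the quotient $N/W$ is negligible as $z\to\pm\infty$, then it is nowhere positive, although it
  need not tend to zero in the directions $x$ and $y$. The quotient satisfies an elliptic equation
  without a term of order zero, whose drift is controlled on slabs. The perturbation
  $\eta e^{-\ell z}$ makes it a strict subsolution, and subtracting a small multiple of
  $\sqrt{1+x^2}+\sqrt{1+y^2}$, whose derivatives are bounded, forces a maximum to exist.
\<close>

lemma max_principle_quotient:
  assumes "eigenfunction p q m N Nx Nxx Ny Nyy Nz Nzz" "eigenfunction p q m W Wx Wxx Wy Wyy Wz Wzz"
    and p: "p > 0" and q: "q > 0"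
    and W: "\<And>x y z. W x y z > 0"
    and K: "K \<ge> 0" "\<And>x y z. \<bar>Wx x y z\<bar> \<le> K * W x y z" "\<And>x y z. \<bar>Wy x y z\<bar> \<le> K * W x y z"
    and drift: "\<And>n::nat. \<exists>D. \<forall>x y z. \<bar>z\<bar> \<le> real n \<longrightarrow> Wz x y z \<le> D * W x y z"
    and bdd: "\<And>x y z. N x y z \<le> B * W x y z"
    and decay: "\<And>e. e > 0 \<Longrightarrow> \<exists>n::nat. \<forall>x y z. \<bar>z\<bar> \<ge> real n \<longrightarrow> N x y z \<le> e * W x y z"
  shows "N x0 y0 z0 \<le> 0"
proof (rule ccontr)
  interpret N: eigenfunction p q m N Nx Nxx Ny Nyy Nz Nzz by fact
  interpret W: eigenfunction p q m W Wx Wxx Wy Wyy Wz Wzz by fact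
  assume "\<not> N x0 y0 z0 \<le> 0"
  then have N0: "N x0 y0 z0 > 0" by simp
  define S where "S = N x0 y0 z0 / W x0 y0 z0"
  have S: "S > 0" using N0 W by (simp add: S_def)
  obtain n1 :: nat where n1: "\<And>x y z. \<bar>z\<bar> \<ge> real n1 \<Longrightarrow> N x y z \<le> S / 2 * W x y z"
    using decay[of "S / 2"] S by auto
  obtain n :: nat where n: "real n > \<bar>z0\<bar>" "n \<ge> n1"
    by (metis reals_Archimedean2 max.strict_coboundedI1 max_def nat_le_linear of_nat_less_iff
        order_less_le_trans of_nat_le_iff)
  have nb: "N x y z \<le> S / 2 * W x y z" if "\<bar>z\<bar> \<ge> real n" for x y z
    using n1[of z x y] n that by auto
  obtain D' where D': "\<And>x y z. \<bar>z\<bar> \<le> real n \<Longrightarrow> Wz x y z \<le> D' * W x y z" using drift[of n] by auto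
  define D where "D = max D' 0"
  have D: "D \<ge> 0" "\<And>x y z. \<bar>z\<bar> \<le> real n \<Longrightarrow> Wz x y z \<le> D * W x y z"
    using D' W by (auto simp: D_def intro: order_trans[OF D'] mult_right_mono less_imp_le)
  \<comment> \<open>With this exponent the second derivative of exp (- (l * z)) outweighs the drift on the slab.\<close>
  define l where "l = 2 * D + 1"
  have l: "l > 0" using D by (simp add: l_def)
  define \<eta> where "\<eta> = S / 4 * exp (- (l * n))"
  have \<eta>: "\<eta> > 0" using S by (simp add: \<eta>_def)
  define C where "C = (exp (2 * p * n) + exp (2 * q * n)) * (1 + 2 * K)"
  have C: "C > 0" using K(1) by (auto simp: C_def intro!: mult_pos_pos add_pos_pos add_pos_nonneg)
  define \<gamma> where "\<gamma> = \<eta> * l * exp (- (l * n))"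
  have \<gamma>: "\<gamma> > 0" using \<eta> l by (simp add: \<gamma>_def)
  define j where "j = (\<lambda>t::real. sqrt (1 + t\<^sup>2))"
  define j1 where "j1 = (\<lambda>t::real. t / sqrt (1 + t\<^sup>2))"
  define j2 where "j2 = (\<lambda>t::real. 1 / sqrt (1 + t\<^sup>2) ^ 3)"
  have jd: "(j has_real_derivative j1 t) (at t)" "(j1 has_real_derivative j2 t) (at t)" for t
    unfolding j_def j1_def j2_def using japanese_bracket_derivs[of t] by simp_all
  have jb: "\<bar>j1 t\<bar> \<le> 1" "0 \<le> j2 t" "j2 t \<le> 1" "\<bar>t\<bar> \<le> j t" "0 \<le> j t" for t
    unfolding j_def j1_def j2_def using japanese_bracket_derivs[of t] by simp_all
  define e where "e = min (\<gamma> / (2 * C)) (S / (8 * (j x0 + j y0 + 1)))"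
  have jj: "j x0 + j y0 + 1 > 0" using jb by (simp add: add_nonneg_pos)
  have e: "e > 0" using \<gamma> C S jj by (simp add: e_def)
  have eC: "e * C < \<gamma>"
  proof -
    have "e * C \<le> \<gamma> / (2 * C) * C" using C by (intro mult_right_mono) (auto simp: e_def)
    also have "\<dots> = \<gamma> / 2" using C by simp
    finally show ?thesis using \<gamma> by simp
  qed
  have eS: "e * (j x0 + j y0) \<le> S / 8"
  proof -
    have "e * (j x0 + j y0) \<le> e * (j x0 + j y0 + 1)" using e by simp
    also have "\<dots> \<le> S / (8 * (j x0 + j y0 + 1)) * (j x0 + j y0 + 1)"
      using jj by (intro mult_right_mono) (auto simp: e_def)
    also have "\<dots> = S / 8" using jj by (simp add: field_simps)
    finally show ?thesis .
  qed
  define Q where "Q = (\<lambda>x y z. N x y z / W x y z + \<eta> * exp (- (l * z)) - e * (j x + j y))"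
  have Q0: "Q x0 y0 z0 > 3 / 4 * S"
  proof -
    have "0 < \<eta> * exp (- (l * z0))" using \<eta> by simp
    then show ?thesis using eS S unfolding Q_def S_def[symmetric] by simp
  qed
  have \<eta>z: "\<eta> * exp (- (l * z)) \<le> S / 4" if "\<bar>z\<bar> \<le> real n" for z
  proof -
    have "\<eta> * exp (- (l * z)) = S / 4 * exp (- (l * (n + z)))"
      by (simp add: \<eta>_def exp_add[symmetric] algebra_simps)
    also have "\<dots> \<le> S / 4 * 1"
      using S l that by (intro mult_left_mono) auto
    finally show ?thesis by simp
  qed
  have NW: "N x y z / W x y z \<le> c \<longleftrightarrow> N x y z \<le> c * W x y z" for x y z c
    using W by (simp add: pos_divide_le_eq)
  define X where "X = max (max (\<bar>x0\<bar>) (\<bar>y0\<bar>)) ((\<bar>B\<bar> + S / 4) / e)"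
  have X: "\<bar>x0\<bar> \<le> X" "\<bar>y0\<bar> \<le> X" "\<bar>B\<bar> + S / 4 \<le> e * X"
  proof -
    have "(\<bar>B\<bar> + S / 4) / e \<le> X" by (simp add: X_def)
    then show "\<bar>B\<bar> + S / 4 \<le> e * X" using e by (simp add: pos_divide_le_eq mult.commute)
  qed (auto simp: X_def)
  define box where "box = cbox (- X, - X, - real n) (X, X, real n)"
  have box: "(x, y, z) \<in> box \<longleftrightarrow> \<bar>x\<bar> \<le> X \<and> \<bar>y\<bar> \<le> X \<and> \<bar>z\<bar> \<le> n" for x y z
    unfolding box_def by (auto simp: cbox_Pair_iff)
  have contQ: "continuous_on box (\<lambda>(x, y, z). Q x y z)"
  proof -
    have "continuous_on box (\<lambda>v. Q (fst v) (fst (snd v)) (snd (snd v)))"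
      unfolding Q_def j_def
      by (intro continuous_intros cont3D[OF N.cont(1)] cont3D[OF W.cont(1)])
         (use W in \<open>auto simp: less_imp_neq[THEN not_sym]\<close>)
    then show ?thesis by (simp add: case_prod_beta)
  qed
  have "(x0, y0, z0) \<in> box" using X n by (simp add: box)
  then obtain v where v: "v \<in> box" "\<forall>v'\<in>box. (\<lambda>(x, y, z). Q x y z) v' \<le> (\<lambda>(x, y, z). Q x y z) v"
    using continuous_attains_sup[OF _ _ contQ] compact_cbox[of "(- X, - X, - real n)" "(X, X, real n)"]
    unfolding box_def by blast
  obtain x y z where xyz: "v = (x, y, z)" by (cases v)
  define M where "M = Q x y z"
  have inb: "\<bar>x\<bar> \<le> X" "\<bar>y\<bar> \<le> X" "\<bar>z\<bar> \<le> n" using v(1) by (auto simp: xyz box)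
  have mx: "Q x' y' z' \<le> M" if "\<bar>x'\<bar> \<le> X" "\<bar>y'\<bar> \<le> X" "\<bar>z'\<bar> \<le> real n" for x' y' z'
    using bspec[OF v(2), of "(x', y', z')"] that by (simp add: xyz box M_def)
  have M: "M > 3 / 4 * S" using mx[of x0 y0 z0] X n Q0 by simp
  have int: "\<bar>x\<bar> < X \<and> \<bar>y\<bar> < X \<and> \<bar>z\<bar> < n"
  proof -
    have "\<bar>z\<bar> \<noteq> n"
    proof
      assume "\<bar>z\<bar> = n"
      then have "N x y z / W x y z \<le> S / 2" using nb[of z x y] by (subst NW) simp
      moreover have "0 \<le> e * (j x + j y)" using e jb by simp
      ultimately have "M \<le> 3 / 4 * S" using \<eta>z[OF inb(3)] unfolding M_def Q_def by linarith
      then show False using M by simp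
    qed
    moreover have "\<not> (\<bar>x\<bar> = X \<or> \<bar>y\<bar> = X)"
    proof
      assume "\<bar>x\<bar> = X \<or> \<bar>y\<bar> = X"
      then have "X \<le> j x + j y" using jb(4)[of x] jb(4)[of y] jb(5)[of x] jb(5)[of y] by auto
      then have "e * X \<le> e * (j x + j y)" using e by simp
      moreover have "N x y z / W x y z \<le> B" using bdd by (subst NW) simp
      ultimately have "M \<le> 0" using \<eta>z[OF inb(3)] X(3) unfolding M_def Q_def by linarith
      then show False using M S by simp
    qed
    ultimately show ?thesis using inb by auto
  qed
  define d where "d = min (min (X - \<bar>x\<bar>) (X - \<bar>y\<bar>)) (n - \<bar>z\<bar>)"
  have d: "d > 0" using int by (simp add: d_def)
  define b where "b = (\<lambda>x y z. M - \<eta> * exp (- (l * z)) + e * (j x + j y))"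
  \<comment> \<open>The function R attains its maximum 0 at the maximum of Q; this avoids differentiating the quotient.\<close>
  define R where "R = (\<lambda>x y z. N x y z - W x y z * b x y z)"
  have Rle: "R x' y' z' \<le> 0" if "\<bar>x'\<bar> \<le> X" "\<bar>y'\<bar> \<le> X" "\<bar>z'\<bar> \<le> real n" for x' y' z'
  proof -
    have "N x' y' z' / W x' y' z' \<le> b x' y' z'"
      using mx[OF that] by (simp add: Q_def b_def)
    then show ?thesis using NW by (simp add: R_def mult.commute)
  qed
  have R0: "R x y z = 0"
  proof -
    have "N x y z / W x y z = b x y z" by (simp add: M_def Q_def b_def)
    then show ?thesis using W[of x y z] by (simp add: R_def field_simps)
  qed
  have Nb: "N x y z = W x y z * b x y z" using R0 by (simp add: R_def)
  have Rxx: "Nxx x y z - (Wxx x y z * b x y z + 2 * Wx x y z * (e * j1 x) + W x y z * (e * j2 x)) \<le> 0"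
  proof (rule second_derivative_local_max[OF d, where f = "\<lambda>t. R t y z"
        and ?f1.0 = "\<lambda>t. Nx t y z - (Wx t y z * b t y z + W t y z * (e * j1 t))"])
    fix t
    have bx: "((\<lambda>t. b t y z) has_real_derivative e * j1 t) (at t)" for t
      unfolding b_def by (auto intro!: derivative_eq_intros jd)
    show "((\<lambda>t. R t y z) has_real_derivative Nx t y z - (Wx t y z * b t y z + W t y z * (e * j1 t))) (at t)"
      unfolding R_def by (auto intro!: derivative_eq_intros N.dx W.dx bx)
    show "((\<lambda>t. Nx t y z - (Wx t y z * b t y z + W t y z * (e * j1 t))) has_real_derivative
       Nxx x y z - (Wxx x y z * b x y z + 2 * Wx x y z * (e * j1 x) + W x y z * (e * j2 x))) (at x)"
      by (auto intro!: derivative_eq_intros N.dxx W.dx W.dxx bx jd simp: algebra_simps)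
    assume "\<bar>t - x\<bar> < d"
    then have "\<bar>t\<bar> \<le> X" by (auto simp: d_def)
    then show "R t y z \<le> R x y z" using Rle inb by (simp add: R0)
  qed
  have Ryy: "Nyy x y z - (Wyy x y z * b x y z + 2 * Wy x y z * (e * j1 y) + W x y z * (e * j2 y)) \<le> 0"
  proof (rule second_derivative_local_max[OF d, where f = "\<lambda>t. R x t z"
        and ?f1.0 = "\<lambda>t. Ny x t z - (Wy x t z * b x t z + W x t z * (e * j1 t))"])
    fix t
    have bx: "((\<lambda>t. b x t z) has_real_derivative e * j1 t) (at t)" for t
      unfolding b_def by (auto intro!: derivative_eq_intros jd)
    show "((\<lambda>t. R x t z) has_real_derivative Ny x t z - (Wy x t z * b x t z + W x t z * (e * j1 t))) (at t)"
      unfolding R_def by (auto intro!: derivative_eq_intros N.dy W.dy bx)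
    show "((\<lambda>t. Ny x t z - (Wy x t z * b x t z + W x t z * (e * j1 t))) has_real_derivative
       Nyy x y z - (Wyy x y z * b x y z + 2 * Wy x y z * (e * j1 y) + W x y z * (e * j2 y))) (at y)"
      by (auto intro!: derivative_eq_intros N.dyy W.dy W.dyy bx jd simp: algebra_simps)
    assume "\<bar>t - y\<bar> < d"
    then have "\<bar>t\<bar> \<le> X" by (auto simp: d_def)
    then show "R x t z \<le> R x y z" using Rle inb by (simp add: R0)
  qed
  define E where "E = \<eta> * exp (- (l * z))"
  have Rzz: "Nzz x y z - (Wzz x y z * b x y z + 2 * Wz x y z * (l * E) - W x y z * (l\<^sup>2 * E)) \<le> 0"
  proof (rule second_derivative_local_max[OF d, where f = "\<lambda>t. R x y t"
        and ?f1.0 = "\<lambda>t. Nz x y t - (Wz x y t * b x y t + W x y t * (l * (\<eta> * exp (- (l * t)))))"])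
    fix t
    have bx: "((\<lambda>t. b x y t) has_real_derivative l * (\<eta> * exp (- (l * t)))) (at t)" for t
      unfolding b_def by (auto intro!: derivative_eq_intros)
    show "((\<lambda>t. R x y t) has_real_derivative Nz x y t - (Wz x y t * b x y t + W x y t * (l * (\<eta> * exp (-
        (l * t)))))) (at t)"
      unfolding R_def by (auto intro!: derivative_eq_intros N.dz W.dz bx)
    show "((\<lambda>t. Nz x y t - (Wz x y t * b x y t + W x y t * (l * (\<eta> * exp (- (l * t)))))) has_real_derivative
       Nzz x y z - (Wzz x y z * b x y z + 2 * Wz x y z * (l * E) - W x y z * (l\<^sup>2 * E))) (at z)"
      by (auto intro!: derivative_eq_intros N.dzz W.dz W.dzz bx simp: algebra_simps E_def power2_eq_square)
    assume "\<bar>t - z\<bar> < d"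
    then have "\<bar>t\<bar> \<le> n" by (auto simp: d_def)
    then show "R x y t \<le> R x y z" using Rle inb by (simp add: R0)
  qed
  let ?w = "W x y z"
  define X1 where "X1 = exp (2 * p * z)"
  define Y1 where "Y1 = exp (- 2 * q * z)"
  have XY: "0 < X1" "X1 \<le> exp (2 * p * n)" "0 < Y1" "Y1 \<le> exp (2 * q * n)"
  proof -
    show "X1 \<le> exp (2 * p * n)" using inb p by (simp add: X1_def)
    have "- (q * z) \<le> q * n" using inb q by (metis abs_le_D2 minus_mult_right mult_le_cancel_left_pos)
    then show "Y1 \<le> exp (2 * q * n)" by (simp add: Y1_def)
  qed (auto simp: X1_def Y1_def)
  have "0 \<ge> X1 * (Nxx x y z - (Wxx x y z * b x y z + 2 * Wx x y z * (e * j1 x) + ?w * (e * j2 x)))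
     + Y1 * (Nyy x y z - (Wyy x y z * b x y z + 2 * Wy x y z * (e * j1 y) + ?w * (e * j2 y)))
     + (Nzz x y z - (Wzz x y z * b x y z + 2 * Wz x y z * (l * E) - ?w * (l\<^sup>2 * E)))"
    using Rxx Ryy Rzz XY by (intro add_nonpos_nonpos mult_nonneg_nonpos) auto
  also have "X1 * (Nxx x y z - (Wxx x y z * b x y z + 2 * Wx x y z * (e * j1 x) + ?w * (e * j2 x)))
     + Y1 * (Nyy x y z - (Wyy x y z * b x y z + 2 * Wy x y z * (e * j1 y) + ?w * (e * j2 y)))
     + (Nzz x y z - (Wzz x y z * b x y z + 2 * Wz x y z * (l * E) - ?w * (l\<^sup>2 * E)))
     = (X1 * Nxx x y z + Y1 * Nyy x y z + Nzz x y z)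
       - (X1 * Wxx x y z + Y1 * Wyy x y z + Wzz x y z) * b x y z
       - e * (X1 * (2 * (Wx x y z * j1 x) + ?w * j2 x) + Y1 * (2 * (Wy x y z * j1 y) + ?w * j2 y))
       + l * E * (l * ?w - 2 * Wz x y z)"
    by (simp add: algebra_simps power2_eq_square)
  also have "\<dots> = l * E * (l * ?w - 2 * Wz x y z)
       - e * (X1 * (2 * (Wx x y z * j1 x) + ?w * j2 x) + Y1 * (2 * (Wy x y z * j1 y) + ?w * j2 y))"
    using N.pde[of z x y] W.pde[of z x y] by (simp add: X1_def Y1_def Nb)
  finally have fin: "l * E * (l * ?w - 2 * Wz x y z)
     \<le> e * (X1 * (2 * (Wx x y z * j1 x) + ?w * j2 x) + Y1 * (2 * (Wy x y z * j1 y) + ?w * j2 y))"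
    by simp
  have w: "?w > 0" by (rule W)
  have bnd: "2 * (a * j1 t) + ?w * j2 t \<le> (1 + 2 * K) * ?w" if "\<bar>a\<bar> \<le> K * ?w" for a t
  proof -
    have "a * j1 t \<le> \<bar>a\<bar> * \<bar>j1 t\<bar>" by (metis abs_ge_self abs_mult)
    also have "\<dots> \<le> K * ?w * 1" using that jb by (intro mult_mono) auto
    finally have "a * j1 t \<le> K * ?w" by simp
    moreover have "?w * j2 t \<le> ?w * 1" using jb w by (intro mult_left_mono) auto
    ultimately show ?thesis by (simp add: algebra_simps)
  qed
  have "X1 * (2 * (Wx x y z * j1 x) + ?w * j2 x) + Y1 * (2 * (Wy x y z * j1 y) + ?w * j2 y)
     \<le> X1 * ((1 + 2 * K) * ?w) + Y1 * ((1 + 2 * K) * ?w)"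
    using XY K bnd by (intro add_mono mult_left_mono) auto
  also have "\<dots> = (X1 + Y1) * ((1 + 2 * K) * ?w)" by (simp add: algebra_simps)
  also have "\<dots> \<le> (exp (2 * p * n) + exp (2 * q * n)) * ((1 + 2 * K) * ?w)"
    using XY K w by (intro mult_right_mono add_mono) auto
  also have "\<dots> = C * ?w" by (simp add: C_def)
  finally have "e * (X1 * (2 * (Wx x y z * j1 x) + ?w * j2 x) + Y1 * (2 * (Wy x y z * j1 y) + ?w * j2 y))
      \<le> e * (C * ?w)" using e by (intro mult_left_mono) auto
  also have "\<dots> < \<gamma> * ?w" using eC w by (simp add: mult.assoc[symmetric])
  also have "\<gamma> * ?w \<le> l * E * (l * ?w - 2 * Wz x y z)"
  proof -
    have "exp (- (l * n)) \<le> exp (- (l * z))" using l inb by simp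
    then have "\<gamma> \<le> l * E" using \<eta> l by (simp add: \<gamma>_def E_def mult_le_cancel_left_pos mult.commute[of \<eta>]
        mult.assoc)
    then have "\<gamma> * ?w \<le> l * E * ?w" using w by simp
    also have "\<dots> \<le> l * E * (l * ?w - 2 * Wz x y z)"
    proof (rule mult_left_mono)
      show "?w \<le> l * ?w - 2 * Wz x y z" using D(2)[OF inb(3), of x y] by (simp add: l_def algebra_simps)
      show "0 \<le> l * E" using l \<eta> by (simp add: E_def)
    qed
    finally show ?thesis .
  qed
  finally show False using fin by simp
qed

section \<open>Averages of nearly harmonic functions in the plane\<close>

lemma pos_part_power_deriv:
  "((\<lambda>t::real. max 0 t ^ Suc (Suc n)) has_real_derivative real (Suc (Suc n)) * max 0 t ^ Suc n) (at t)"
proof -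
  consider "t > 0" | "t < 0" | "t = 0" by linarith
  then show ?thesis
  proof cases
    case 1
    have "((\<lambda>t. t ^ Suc (Suc n)) has_real_derivative real (Suc (Suc n)) * t ^ Suc n) (at t)"
      using DERIV_pow[of "Suc (Suc n)" t] by simp
    then have "((\<lambda>t. max 0 t ^ Suc (Suc n)) has_real_derivative real (Suc (Suc n)) * t ^ Suc n) (at t)"
      by (rule has_field_derivative_transform_within_open[of _ _ _ "{0<..}"]) (use 1 in auto)
    then show ?thesis using 1 by simp
  next
    case 2
    have "((\<lambda>t. 0) has_real_derivative 0) (at t)" by simp
    then have "((\<lambda>t. max 0 t ^ Suc (Suc n)) has_real_derivative 0) (at t)"
      by (rule has_field_derivative_transform_within_open[of _ _ _ "{..<0}"]) (use 2 in auto)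
    then show ?thesis using 2 by simp
  next
    case 3
    have "((\<lambda>h::real. max 0 h ^ Suc n) \<longlongrightarrow> max 0 0 ^ Suc n) (at 0)"
      by (intro tendsto_intros)
    moreover have "(max 0 (0 + h) ^ Suc (Suc n) - max 0 0 ^ Suc (Suc n)) / h = max 0 h ^ Suc n"
      if "h \<noteq> 0" for h :: real
      using that by (cases "h > 0") auto
    ultimately have "((\<lambda>h::real. (max 0 (0 + h) ^ Suc (Suc n) - max 0 0 ^ Suc (Suc n)) / h) \<longlongrightarrow> 0) (at 0)"
      by (subst tendsto_cong[where g = "\<lambda>h. max 0 h ^ Suc n"])
         (auto simp: eventually_at_filter)
    then show ?thesis using 3 by (simp add: DERIV_def)
  qed
qed

lemma integral_divergence_fst:
  fixes f F :: "real \<Rightarrow> real \<Rightarrow> real"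
  assumes d: "\<And>a b. \<bar>a\<bar> \<le> 1 \<Longrightarrow> \<bar>b\<bar> \<le> 1 \<Longrightarrow> ((\<lambda>a. F a b) has_real_derivative f a b) (at a)"
    and bd: "\<And>b. \<bar>b\<bar> \<le> 1 \<Longrightarrow> F 1 b = 0" "\<And>b. \<bar>b\<bar> \<le> 1 \<Longrightarrow> F (-1) b = 0"
    and c: "continuous_on (cbox (-1, -1) (1, 1)) (\<lambda>(a, b). f a b)"
  shows "integral (cbox (-1, -1) (1, 1)) (\<lambda>(a, b). f a b) = 0"
proof -
  have "integral (cbox (-1, -1) (1, 1)) (\<lambda>(a, b). f a b)
      = integral (cbox (-1) 1) (\<lambda>a. integral (cbox (-1) 1) (\<lambda>b. f a b))"
    using integral_prod_continuous[OF c] by simp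
  also have "\<dots> = integral (cbox (-1) 1) (\<lambda>b. integral (cbox (-1) 1) (\<lambda>a. f a b))"
    by (rule integral_swap_continuous[OF c])
  also have "\<dots> = integral (cbox (-1) 1) (\<lambda>b::real. 0)"
  proof (rule integral_cong)
    fix b :: real assume "b \<in> cbox (-1) 1"
    then have b: "\<bar>b\<bar> \<le> 1" by auto
    have "((\<lambda>a. f a b) has_integral F 1 b - F (-1) b) {-1..1}"
    proof (rule fundamental_theorem_of_calculus)
      fix a :: real assume "a \<in> {-1..1}"
      then have "\<bar>a\<bar> \<le> 1" by auto
      then show "((\<lambda>a. F a b) has_vector_derivative f a b) (at a within {-1..1})"
        using d[OF _ b] by (simp add: has_real_derivative_iff_has_vector_derivative
            has_vector_derivative_at_within)
    qed simp
    then show "integral (cbox (-1) 1) (\<lambda>a. f a b) = 0" using bd b by (simp add: integral_unique)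
  qed
  finally show ?thesis by simp
qed

lemma integral_divergence_snd:
  fixes f F :: "real \<Rightarrow> real \<Rightarrow> real"
  assumes d: "\<And>a b. \<bar>a\<bar> \<le> 1 \<Longrightarrow> \<bar>b\<bar> \<le> 1 \<Longrightarrow> ((\<lambda>b. F a b) has_real_derivative f a b) (at b)"
    and bd: "\<And>a. \<bar>a\<bar> \<le> 1 \<Longrightarrow> F a 1 = 0" "\<And>a. \<bar>a\<bar> \<le> 1 \<Longrightarrow> F a (-1) = 0"
    and c: "continuous_on (cbox (-1, -1) (1, 1)) (\<lambda>(a, b). f a b)"
  shows "integral (cbox (-1, -1) (1, 1)) (\<lambda>(a, b). f a b) = 0"
proof -
  have "integral (cbox (-1, -1) (1, 1)) (\<lambda>(a, b). f a b)
      = integral (cbox (-1) 1) (\<lambda>a. integral (cbox (-1) 1) (\<lambda>b. f a b))"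
    using integral_prod_continuous[OF c] by simp
  also have "\<dots> = integral (cbox (-1) 1) (\<lambda>b::real. 0)"
  proof (rule integral_cong)
    fix a :: real assume "a \<in> cbox (-1) 1"
    then have a: "\<bar>a\<bar> \<le> 1" by auto
    have "((\<lambda>b. f a b) has_integral F a 1 - F a (-1)) {-1..1}"
    proof (rule fundamental_theorem_of_calculus)
      fix b :: real assume "b \<in> {-1..1}"
      then have "\<bar>b\<bar> \<le> 1" by auto
      then show "((\<lambda>b. F a b) has_vector_derivative f a b) (at b within {-1..1})"
        using d[OF a] by (simp add: has_real_derivative_iff_has_vector_derivative
            has_vector_derivative_at_within)
    qed simp
    then show "integral (cbox (-1) 1) (\<lambda>b. f a b) = 0" using bd a by (simp add: integral_unique)
  qed
  finally show ?thesis by simp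
qed

text \<open>
  The profile $\rho=(1-|v|^2)_+$ has the property $v\,\rho(v)=-\nabla(\rho(v)^2/4)$. The radial
  derivative of a weighted mean with this weight is therefore a weighted mean of the Laplacian, by
  one integration by parts.
\<close>

definition bump :: "real \<times> real \<Rightarrow> real" where
  "bump v = max 0 (1 - (fst v)\<^sup>2 - (snd v)\<^sup>2)"

definition disc_mean :: "(real \<Rightarrow> real \<Rightarrow> real) \<Rightarrow> real \<Rightarrow> real \<Rightarrow> real \<Rightarrow> real" where
  "disc_mean w x t r = integral (cbox (-1, -1) (1, 1)) (\<lambda>v. w (x + r * fst v) (t + r * snd v) * bump v)"

lemma bump_cont [continuous_intros]: "continuous_on S bump"
  unfolding bump_def by (intro continuous_intros)

lemma bump_bounds: "0 \<le> bump v" "bump v \<le> 1"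
  by (auto simp: bump_def intro!: order_trans[of _ 0 1])

lemma abs_le_1_cbox: "(v :: real \<times> real) \<in> cbox (-1, -1) (1, 1) \<longleftrightarrow> \<bar>fst v\<bar> \<le> 1 \<and> \<bar>snd v\<bar> \<le> (1::real)"
  by (cases v) (auto simp: cbox_Pair_eq)

text \<open>
  The domain is a strip in \<open>t\<close>, because the coordinates in which the eigenvalue equation takes this form are
  singular at \<open>t = 0\<close>.
\<close>

locale near_harmonic =
  fixes w wx wxx wt wtt :: "real \<Rightarrow> real \<Rightarrow> real" and t0 R C :: real
  assumes R: "R > 0" and C: "C \<ge> 0"
    and dx: "\<And>x t. \<bar>t - t0\<bar> \<le> R \<Longrightarrow> ((\<lambda>x. w x t) has_real_derivative wx x t) (at x)"
    and dxx: "\<And>x t. \<bar>t - t0\<bar> \<le> R \<Longrightarrow> ((\<lambda>x. wx x t) has_real_derivative wxx x t) (at x)"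
    and dt: "\<And>x t. \<bar>t - t0\<bar> \<le> R \<Longrightarrow> ((\<lambda>t. w x t) has_real_derivative wt x t) (at t)"
    and dtt: "\<And>x t. \<bar>t - t0\<bar> \<le> R \<Longrightarrow> ((\<lambda>t. wt x t) has_real_derivative wtt x t) (at t)"
    and cont: "continuous_on (UNIV \<times> {t0-R..t0+R}) (\<lambda>(x, t). w x t)"
      "continuous_on (UNIV \<times> {t0-R..t0+R}) (\<lambda>(x, t). wx x t)"
      "continuous_on (UNIV \<times> {t0-R..t0+R}) (\<lambda>(x, t). wxx x t)"
      "continuous_on (UNIV \<times> {t0-R..t0+R}) (\<lambda>(x, t). wt x t)"
      "continuous_on (UNIV \<times> {t0-R..t0+R}) (\<lambda>(x, t). wtt x t)"
    and nonneg: "\<And>x t. \<bar>t - t0\<bar> \<le> R \<Longrightarrow> 0 \<le> w x t"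
    and laplace: "\<And>x t. \<bar>t - t0\<bar> \<le> R \<Longrightarrow> \<bar>wxx x t + wtt x t\<bar> \<le> C * w x t"
begin

lemma contD:
  assumes "continuous_on (UNIV \<times> {t0-R..t0+R}) (\<lambda>(x, t). F x t)" "continuous_on S f" "continuous_on S g"
    "\<And>v. v \<in> S \<Longrightarrow> \<bar>g v - t0\<bar> \<le> R"
  shows "continuous_on S (\<lambda>v. F (f v) (g v))"
proof -
  have "(\<lambda>v. (f v, g v)) ` S \<subseteq> UNIV \<times> {t0-R..t0+R}" using assms(4) by (force simp: abs_le_iff)
  then show ?thesis
    using continuous_on_compose2[OF assms(1) continuous_on_Pair[OF assms(2,3)]] by simp
qed

lemma ray_derivative:
  assumes "r \<in> {0..R}" "\<bar>a\<bar> \<le> 1" "\<bar>b\<bar> \<le> 1"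
  shows "((\<lambda>r. w (x + r * a) (t0 + r * b)) has_real_derivative
     wx (x + r * a) (t0 + r * b) * a + wt (x + r * a) (t0 + r * b) * b) (at r within {0..R})"
proof -
  let ?Y = "{t0-R..t0+R}"
  have in_Y: "t0 + r * b \<in> ?Y" if "r \<in> {0..R}" for r
  proof -
    have "\<bar>r * b\<bar> \<le> R * 1" unfolding abs_mult using that assms by (intro mult_mono) auto
    then show ?thesis by (auto simp: abs_le_iff)
  qed
  have "((\<lambda>(x, y). w x y) has_derivative
     (\<lambda>(tx, ty). (\<lambda>h. h * wx (x + r * a) (t0 + r * b)) tx
        + blinfun_scaleR_left (wt (x + r * a) (t0 + r * b)) ty)) (at (x + r * a, t0 + r * b) within UNIV
            \<times> ?Y)"
  proof (rule has_derivative_partialsI)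
    show "((\<lambda>x. w x (t0 + r * b)) has_derivative (\<lambda>h. h * wx (x + r * a) (t0 + r * b))) (at (x + r * a))"
      using dx[of "t0 + r * b" "x + r * a"] in_Y[OF assms(1)]
      by (simp add: has_field_derivative_def mult_commute_abs abs_le_iff)
    show "((\<lambda>y. w x y) has_derivative blinfun_apply (blinfun_scaleR_left (wt x y))) (at y within ?Y)"
      if "y \<in> ?Y" for x y
      using has_derivative_at_withinI[OF dt[of y x, unfolded has_field_derivative_def]] that
      by (simp add: mult_commute_abs abs_le_iff algebra_simps)
    have "continuous_on (UNIV \<times> ?Y) (\<lambda>v. blinfun_scaleR_left (wt (fst v) (snd v)))"
    proof (rule bounded_linear.continuous_on[OF bounded_linear_blinfun_scaleR_left])
      show "continuous_on (UNIV \<times> ?Y) (\<lambda>v. wt (fst v) (snd v))"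
        using cont(4) by (simp add: case_prod_beta')
    qed
    then show "continuous (at (x + r * a, t0 + r * b) within UNIV \<times> ?Y) (\<lambda>(x, y). blinfun_scaleR_left
        (wt x y))"
      using in_Y[OF assms(1)] by (auto simp: continuous_on_eq_continuous_within case_prod_beta')
  qed (use in_Y[OF assms(1)] in auto)
  then have D: "((\<lambda>v. w (fst v) (snd v)) has_derivative
     (\<lambda>v. fst v * wx (x + r * a) (t0 + r * b) + snd v * wt (x + r * a) (t0 + r * b)))
      (at (x + r * a, t0 + r * b) within UNIV \<times> ?Y)"
    unfolding case_prod_beta' by simp
  have g: "((\<lambda>r. (x + r * a, t0 + r * b)) has_derivative (\<lambda>h. (h * a, h * b))) (at r within {0..R})"
    by (auto intro!: derivative_eq_intros)
  have "((\<lambda>r. w (fst (x + r * a, t0 + r * b)) (snd (x + r * a, t0 + r * b))) has_derivative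
     (\<lambda>h. fst (h * a, h * b) * wx (x + r * a) (t0 + r * b)
        + snd (h * a, h * b) * wt (x + r * a) (t0 + r * b))) (at r within {0..R})"
  proof (rule has_derivative_in_compose[OF g has_derivative_subset[OF D]])
    show "(\<lambda>r. (x + r * a, t0 + r * b)) ` {0..R} \<subseteq> UNIV \<times> ?Y"
      using in_Y by blast
  qed
  moreover have "(\<lambda>h. fst (h * a, h * b) * wx (x + r * a) (t0 + r * b)
        + snd (h * a, h * b) * wt (x + r * a) (t0 + r * b))
     = (*) (wx (x + r * a) (t0 + r * b) * a + wt (x + r * a) (t0 + r * b) * b)"
    by (auto simp: fun_eq_iff distrib_left distrib_right mult_ac)
  ultimately show ?thesis
    by (simp add: has_field_derivative_def)
qed

lemma disc_mean_derivative:
  assumes r: "r \<in> {0..R}"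
  shows "(disc_mean w x t0 has_real_derivative
     r * integral (cbox (-1, -1) (1, 1)) (\<lambda>v. (wxx (x + r * fst v) (t0 + r * snd v)
        + wtt (x + r * fst v) (t0 + r * snd v)) * ((bump v)\<^sup>2 / 4))) (at r within {0..R})"
proof -
  let ?I = "cbox (-1, -1) (1, 1) :: (real \<times> real) set"
  have in_Y: "\<bar>t0 + r * b - t0\<bar> \<le> R" if "r \<in> {0..R}" "\<bar>b\<bar> \<le> 1" for r b
  proof -
    have "\<bar>r * b\<bar> \<le> R * 1" unfolding abs_mult using that R by (intro mult_mono) auto
    then show ?thesis by simp
  qed
  have c: "continuous_on ?I (\<lambda>v. F (x + r * fst v) (t0 + r * snd v))"
    if "continuous_on (UNIV \<times> {t0-R..t0+R}) (\<lambda>(x, t). F x t)" for F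
    by (rule contD[OF that]) (intro continuous_intros | use in_Y r in \<open>simp add: abs_le_1_cbox\<close>)+
  have c2: "continuous_on ({0..R} \<times> ?I) (\<lambda>u. F (x + fst u * fst (snd u)) (t0 + fst u * snd (snd u)))"
    if "continuous_on (UNIV \<times> {t0-R..t0+R}) (\<lambda>(x, t). F x t)" for F
    by (rule contD[OF that]) (intro continuous_intros | use in_Y in \<open>auto simp: abs_le_1_cbox\<close>)+
  let ?gx = "\<lambda>v. wx (x + r * fst v) (t0 + r * snd v)"
  let ?gt = "\<lambda>v. wt (x + r * fst v) (t0 + r * snd v)"
  let ?gxx = "\<lambda>v. wxx (x + r * fst v) (t0 + r * snd v)"
  let ?gtt = "\<lambda>v. wtt (x + r * fst v) (t0 + r * snd v)"
  have L: "((\<lambda>r. integral ?I (\<lambda>v. w (x + r * fst v) (t0 + r * snd v) * bump v)) has_real_derivative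
      integral ?I (\<lambda>v. (?gx v * fst v + ?gt v * snd v) * bump v)) (at r within {0..R})"
  proof (rule leibniz_rule_field_derivative[where fx = "\<lambda>r v. (wx (x + r * fst v) (t0 + r * snd v) * fst v
        + wt (x + r * fst v) (t0 + r * snd v) * snd v) * bump v"])
    fix r v assume rv: "r \<in> {0..R}" "v \<in> ?I"
    show "((\<lambda>r. w (x + r * fst v) (t0 + r * snd v) * bump v) has_real_derivative
       (wx (x + r * fst v) (t0 + r * snd v) * fst v + wt (x + r * fst v) (t0 + r * snd v) * snd v) * bump v)
       (at r within {0..R})"
      by (rule DERIV_cmult_right[OF ray_derivative]) (use rv in \<open>auto simp: abs_le_1_cbox\<close>)
  next
    fix r assume r: "r \<in> {0..R}"
    show "(\<lambda>v. w (x + r * fst v) (t0 + r * snd v) * bump v) integrable_on ?I"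
      by (intro integrable_continuous continuous_intros contD[OF cont(1)])
         (use in_Y r in \<open>auto simp: abs_le_1_cbox\<close>)
  next
    show "continuous_on ({0..R} \<times> ?I) (\<lambda>(r, v). (wx (x + r * fst v) (t0 + r * snd v) * fst v
        + wt (x + r * fst v) (t0 + r * snd v) * snd v) * bump v)"
      unfolding case_prod_beta' bump_def
      by (intro continuous_intros c2 cont)
  qed (use r in auto)
  have B: "((\<lambda>a. (bump (a, b))\<^sup>2 / 4) has_real_derivative - a * bump (a, b)) (at a)"
     "((\<lambda>b. (bump (a, b))\<^sup>2 / 4) has_real_derivative - b * bump (a, b)) (at b)" for a b
  proof -
    have 1: "((\<lambda>t. (max 0 t)\<^sup>2) has_real_derivative 2 * max 0 t) (at t)" for t :: real
      using pos_part_power_deriv[of 0 t] by (simp add: numeral_2_eq_2)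
    have "((\<lambda>a. 1 - a\<^sup>2 - b\<^sup>2) has_real_derivative - 2 * a) (at a)"
         "((\<lambda>b. 1 - a\<^sup>2 - b\<^sup>2) has_real_derivative - 2 * b) (at b)"
      by (auto intro!: derivative_eq_intros)
    from DERIV_cdivide[OF DERIV_chain2[OF 1 this(1)], of 4] DERIV_cdivide[OF DERIV_chain2[OF 1 this(2)], of 4]
    show "((\<lambda>a. (bump (a, b))\<^sup>2 / 4) has_real_derivative - a * bump (a, b)) (at a)"
     "((\<lambda>b. (bump (a, b))\<^sup>2 / 4) has_real_derivative - b * bump (a, b)) (at b)"
      by (simp_all add: bump_def algebra_simps)
  qed
  have bz: "bump (1, b) = 0" "bump (-1, b) = 0" "bump (b, 1) = 0" "bump (b, -1) = 0" for b
    by (auto simp: bump_def)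
  have inr: "\<bar>t0 + r * b - t0\<bar> \<le> R" if "\<bar>b\<bar> \<le> 1" for b using in_Y[OF r that] .
  have Dx: "integral ?I (\<lambda>v. r * ?gxx v * ((bump v)\<^sup>2 / 4) - ?gx v * fst v * bump v) = 0"
  proof -
    have "integral ?I (\<lambda>(a, b). r * wxx (x + r * a) (t0 + r * b) * ((bump (a, b))\<^sup>2 / 4)
        - wx (x + r * a) (t0 + r * b) * a * bump (a, b)) = 0"
    proof (rule integral_divergence_fst[where F = "\<lambda>a b. wx (x + r * a) (t0 + r * b) * ((bump (a, b))\<^sup>2
        / 4)"])
      fix a b :: real assume ab: "\<bar>a\<bar> \<le> 1" "\<bar>b\<bar> \<le> 1"
      have l: "((\<lambda>a. x + r * a) has_real_derivative r) (at a)" by (auto intro!: derivative_eq_intros)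
      show "((\<lambda>a. wx (x + r * a) (t0 + r * b) * ((bump (a, b))\<^sup>2 / 4)) has_real_derivative
         r * wxx (x + r * a) (t0 + r * b) * ((bump (a, b))\<^sup>2 / 4) - wx (x + r * a) (t0 + r * b) * a *
             bump (a, b)) (at a)"
        using DERIV_mult[OF DERIV_chain2[OF dxx[OF inr[OF ab(2)]] l] B(1)[of b a]]
        by (simp add: algebra_simps)
    next
      have "continuous_on ?I (\<lambda>v. r * ?gxx v * ((bump v)\<^sup>2 / 4) - ?gx v * fst v * bump v)"
        by (intro continuous_intros c cont) simp_all
      then show "continuous_on ?I (\<lambda>(a, b). r * wxx (x + r * a) (t0 + r * b) * ((bump (a, b))\<^sup>2 / 4)
        - wx (x + r * a) (t0 + r * b) * a * bump (a, b))" by (simp add: case_prod_beta')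
    qed (simp_all add: bz)
    then show ?thesis by (simp add: case_prod_beta')
  qed
  have Dt: "integral ?I (\<lambda>v. r * ?gtt v * ((bump v)\<^sup>2 / 4) - ?gt v * snd v * bump v) = 0"
  proof -
    have "integral ?I (\<lambda>(a, b). r * wtt (x + r * a) (t0 + r * b) * ((bump (a, b))\<^sup>2 / 4)
        - wt (x + r * a) (t0 + r * b) * b * bump (a, b)) = 0"
    proof (rule integral_divergence_snd[where F = "\<lambda>a b. wt (x + r * a) (t0 + r * b) * ((bump (a, b))\<^sup>2
        / 4)"])
      fix a b :: real assume ab: "\<bar>a\<bar> \<le> 1" "\<bar>b\<bar> \<le> 1"
      have l: "((\<lambda>b. t0 + r * b) has_real_derivative r) (at b)" by (auto intro!: derivative_eq_intros)
      show "((\<lambda>b. wt (x + r * a) (t0 + r * b) * ((bump (a, b))\<^sup>2 / 4)) has_real_derivative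
         r * wtt (x + r * a) (t0 + r * b) * ((bump (a, b))\<^sup>2 / 4) - wt (x + r * a) (t0 + r * b) * b *
             bump (a, b)) (at b)"
        using DERIV_mult[OF DERIV_chain2[OF dtt[of "t0 + r * b" "x + r * a", OF inr[OF ab(2)]] l]
            B(2)[of a b]]
        by (simp add: algebra_simps)
    next
      have "continuous_on ?I (\<lambda>v. r * ?gtt v * ((bump v)\<^sup>2 / 4) - ?gt v * snd v * bump v)"
        by (intro continuous_intros c cont) simp_all
      then show "continuous_on ?I (\<lambda>(a, b). r * wtt (x + r * a) (t0 + r * b) * ((bump (a, b))\<^sup>2 / 4)
        - wt (x + r * a) (t0 + r * b) * b * bump (a, b))" by (simp add: case_prod_beta')
    qed (simp_all add: bz)
    then show ?thesis by (simp add: case_prod_beta')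
  qed
  have i1: "(\<lambda>v. r * ((?gxx v + ?gtt v) * ((bump v)\<^sup>2 / 4))) integrable_on ?I"
    by (intro integrable_continuous continuous_intros c cont) simp_all
  have i2: "(\<lambda>v. r * ?gxx v * ((bump v)\<^sup>2 / 4) - ?gx v * fst v * bump v) integrable_on ?I"
    by (intro integrable_continuous continuous_intros c cont) simp_all
  have i3: "(\<lambda>v. r * ?gtt v * ((bump v)\<^sup>2 / 4) - ?gt v * snd v * bump v) integrable_on ?I"
    by (intro integrable_continuous continuous_intros c cont) simp_all
  have "integral ?I (\<lambda>v. (?gx v * fst v + ?gt v * snd v) * bump v)
     = integral ?I (\<lambda>v. r * ((?gxx v + ?gtt v) * ((bump v)\<^sup>2 / 4))
        - ((r * ?gxx v * ((bump v)\<^sup>2 / 4) - ?gx v * fst v * bump v)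
         + (r * ?gtt v * ((bump v)\<^sup>2 / 4) - ?gt v * snd v * bump v)))"
    by (intro integral_cong) (simp add: algebra_simps)
  also have "\<dots> = integral ?I (\<lambda>v. r * ((?gxx v + ?gtt v) * ((bump v)\<^sup>2 / 4)))
       - (integral ?I (\<lambda>v. r * ?gxx v * ((bump v)\<^sup>2 / 4) - ?gx v * fst v * bump v)
       + integral ?I (\<lambda>v. r * ?gtt v * ((bump v)\<^sup>2 / 4) - ?gt v * snd v * bump v))"
    by (subst integral_diff[OF i1 integrable_add[OF i2 i3]], subst integral_add[OF i2 i3]) (rule refl)
  also have "\<dots> = r * integral ?I (\<lambda>v. (?gxx v + ?gtt v) * ((bump v)\<^sup>2 / 4))"
    unfolding Dx Dt by simp
  finally show ?thesis
    using L unfolding disc_mean_def[abs_def] by (simp only:)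
qed

text \<open>
  An approximate mean value property: the derivative of the mean is bounded by \<open>C * r / 4\<close>
  times the mean, since $\rho^2/4\le\rho/4$.
\<close>

lemma disc_mean_bounds:
  assumes r: "r \<in> {0..R}"
  shows "disc_mean w x t0 r \<le> exp (C * r\<^sup>2 / 8) * disc_mean w x t0 0"
    and "disc_mean w x t0 0 \<le> exp (C * r\<^sup>2 / 8) * disc_mean w x t0 r"
proof -
  let ?I = "cbox (-1, -1) (1, 1) :: (real \<times> real) set"
  let ?M = "disc_mean w x t0"
  define M' where "M' = (\<lambda>r. r * integral ?I (\<lambda>v. (wxx (x + r * fst v) (t0 + r * snd v)
        + wtt (x + r * fst v) (t0 + r * snd v)) * ((bump v)\<^sup>2 / 4)))"
  have der: "(?M has_real_derivative M' s) (at s within {0..R})" if "s \<in> {0..R}" for s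
    using disc_mean_derivative[OF that] by (simp add: M'_def)
  have contM: "continuous_on {0..r} ?M"
    by (rule continuous_on_subset[of "{0..R}"])
       (use r in \<open>auto simp: continuous_on_eq_continuous_within intro!: DERIV_continuous[OF der]\<close>)
  have bound: "\<bar>M' s\<bar> \<le> C * s / 4 * ?M s" if s: "s \<in> {0..R}" for s
  proof -
    have in_Y: "\<bar>t0 + s * snd v - t0\<bar> \<le> R" if "v \<in> ?I" for v
    proof -
      have "\<bar>s * snd v\<bar> \<le> R * 1" unfolding abs_mult using that R s by (intro mult_mono) (auto simp:
          abs_le_1_cbox)
      then show ?thesis by simp
    qed
    have c: "continuous_on ?I (\<lambda>v. F (x + s * fst v) (t0 + s * snd v))"
      if "continuous_on (UNIV \<times> {t0-R..t0+R}) (\<lambda>(x, t). F x t)" for F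
      by (rule contD[OF that]) (intro continuous_intros | use in_Y in simp)+
    have "norm (integral ?I (\<lambda>v. (wxx (x + s * fst v) (t0 + s * snd v)
        + wtt (x + s * fst v) (t0 + s * snd v)) * ((bump v)\<^sup>2 / 4)))
      \<le> integral ?I (\<lambda>v. C / 4 * (w (x + s * fst v) (t0 + s * snd v) * bump v))"
    proof (rule integral_norm_bound_integral)
      show "(\<lambda>v. (wxx (x + s * fst v) (t0 + s * snd v)
        + wtt (x + s * fst v) (t0 + s * snd v)) * ((bump v)\<^sup>2 / 4)) integrable_on ?I"
        by (intro integrable_continuous continuous_intros c cont) simp_all
      show "(\<lambda>v. C / 4 * (w (x + s * fst v) (t0 + s * snd v) * bump v)) integrable_on ?I"
        by (intro integrable_continuous continuous_intros c cont) simp_all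
      fix v assume v: "v \<in> ?I"
      let ?w = "w (x + s * fst v) (t0 + s * snd v)"
      have "\<bar>(wxx (x + s * fst v) (t0 + s * snd v) + wtt (x + s * fst v) (t0 + s * snd v)) * ((bump v)\<^sup>2 / 4)\<bar>
         \<le> (C * ?w) * (bump v / 4)"
        unfolding abs_mult
      proof (rule mult_mono)
        show "\<bar>wxx (x + s * fst v) (t0 + s * snd v) + wtt (x + s * fst v) (t0 + s * snd v)\<bar> \<le> C * ?w"
          using laplace[OF in_Y[OF v]] by simp
        have "bump v * bump v \<le> bump v * 1" using bump_bounds[of v] by (intro mult_left_mono) auto
        then show "\<bar>(bump v)\<^sup>2 / 4\<bar> \<le> bump v / 4" by (simp add: power2_eq_square)
        show "0 \<le> C * ?w" using C nonneg[OF in_Y[OF v]] by simp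
      qed simp
      then show "norm ((wxx (x + s * fst v) (t0 + s * snd v) + wtt (x + s * fst v) (t0 + s * snd v)) *
          ((bump v)\<^sup>2 / 4))
         \<le> C / 4 * (?w * bump v)" by simp
    qed
    also have "\<dots> = C / 4 * ?M s" by (simp add: disc_mean_def)
    finally have "s * \<bar>integral ?I (\<lambda>v. (wxx (x + s * fst v) (t0 + s * snd v)
        + wtt (x + s * fst v) (t0 + s * snd v)) * ((bump v)\<^sup>2 / 4))\<bar> \<le> s * (C / 4 * ?M s)"
      using s by (intro mult_left_mono) auto
    then show ?thesis using s by (simp add: M'_def abs_mult mult_ac real_norm_def)
  qed
  have at: "(?M has_real_derivative M' s) (at s)" if "0 < s" "s < r" for s
    using der[of s] at_within_interior[of s "{0..R}"] that r by auto
  have "exp (- (C * r\<^sup>2 / 8)) * ?M r \<le> exp (- (C * 0\<^sup>2 / 8)) * ?M 0"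
  proof (rule DERIV_nonpos_imp_decreasing_open[where f = "\<lambda>s. exp (- (C * s\<^sup>2 / 8)) * ?M s"])
    fix s assume s: "0 < s" "s < r"
    have "((\<lambda>s. exp (- (C * s\<^sup>2 / 8)) * ?M s) has_real_derivative
        exp (- (C * s\<^sup>2 / 8)) * (M' s - C * s / 4 * ?M s)) (at s)"
      by (auto intro!: derivative_eq_intros at[OF s] simp: algebra_simps)
    moreover have "exp (- (C * s\<^sup>2 / 8)) * (M' s - C * s / 4 * ?M s) \<le> 0"
      using bound[of s] s r by (intro mult_nonneg_nonpos) (auto simp: abs_le_iff)
    ultimately show "\<exists>y. ((\<lambda>s. exp (- (C * s\<^sup>2 / 8)) * ?M s) has_real_derivative y) (at s) \<and> y \<le> 0" by blast
  qed (use r contM in \<open>auto intro!: continuous_intros\<close>)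
  then have "exp (C * r\<^sup>2 / 8) * (exp (- (C * r\<^sup>2 / 8)) * ?M r) \<le> exp (C * r\<^sup>2 / 8) * ?M 0" by simp
  then show "?M r \<le> exp (C * r\<^sup>2 / 8) * ?M 0"
    by (simp add: exp_minus field_simps)
  have "exp (C * 0\<^sup>2 / 8) * ?M 0 \<le> exp (C * r\<^sup>2 / 8) * ?M r"
  proof (rule DERIV_nonneg_imp_increasing_open[where f = "\<lambda>s. exp (C * s\<^sup>2 / 8) * ?M s"])
    fix s assume s: "0 < s" "s < r"
    have "((\<lambda>s. exp (C * s\<^sup>2 / 8) * ?M s) has_real_derivative
        exp (C * s\<^sup>2 / 8) * (M' s + C * s / 4 * ?M s)) (at s)"
      by (auto intro!: derivative_eq_intros at[OF s] simp: algebra_simps)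
    moreover have "exp (C * s\<^sup>2 / 8) * (M' s + C * s / 4 * ?M s) \<ge> 0"
      using bound[of s] s r by (intro mult_nonneg_nonneg) (auto simp: abs_le_iff)
    ultimately show "\<exists>y. ((\<lambda>s. exp (C * s\<^sup>2 / 8) * ?M s) has_real_derivative y) (at s) \<and> y \<ge> 0" by blast
  qed (use r contM in \<open>auto intro!: continuous_intros\<close>)
  then show "?M 0 \<le> exp (C * r\<^sup>2 / 8) * ?M r" by simp
qed

text \<open>
  A disc of radius \<open>r\<close> whose centre is displaced by at most \<open>d * r\<close> lies in the disc of radius
  \<open>(1 + d) * r\<close>, and the weights compare up to the factor \<open>1 + d\<close>. This is Nelson's proof of
  Liouville's theorem in quantitative form; the factor \<open>(1 + d)\<^sup>2\<close> is the ratio of the areas.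
\<close>

lemma disc_mean_shift:
  assumes r: "r > 0" and d: "d > 0" and s: "\<bar>s\<bar> \<le> d * r" and rR: "(1 + d) * r \<le> R"
  shows "disc_mean w (x + s) t0 r \<le> (1 + d) ^ 3 * disc_mean w x t0 ((1 + d) * r)"
proof -
  let ?I = "cbox (-1, -1) (1, 1) :: (real \<times> real) set"
  define R' where "R' = (1 + d) * r"
  have R': "0 < R'" "R' \<le> R" using r d rR by (auto simp: R'_def)
  define a where "a = s / r"
  have a: "\<bar>a\<bar> \<le> d" "s = a * r" using s r by (auto simp: a_def divide_simps)
  have in_Y: "\<bar>t0 + R' * snd v - t0\<bar> \<le> R" if "v \<in> ?I" for v
  proof -
    have "\<bar>R' * snd v\<bar> \<le> R * 1" unfolding abs_mult using that R' by (intro mult_mono) (auto simp: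
        abs_le_1_cbox)
    then show ?thesis by simp
  qed
  have wc: "continuous_on ?I (\<lambda>v. w (x + R' * fst v) (t0 + R' * snd v))"
    by (rule contD[OF cont(1)]) (intro continuous_intros | use in_Y in simp)+
  define k where "k = (\<lambda>v::real \<times> real. bump ((1 + d) *\<^sub>R v - (a, 0)))"
  define f where "f = (\<lambda>v. w (x + R' * fst v) (t0 + R' * snd v) * k v)"
  have fc: "continuous_on ?I f" unfolding f_def k_def
    by (intro continuous_intros wc continuous_on_compose2[OF bump_cont[of UNIV]]) auto
  \<comment> \<open>Completing the square in the first coordinate; the bound on a enters through a^2 / d \<le> d.\<close>
  have kle: "k v \<le> (1 + d) * bump v" for v
  proof -
    let ?X = "fst v" and ?Y = "snd v"
    have "a\<^sup>2 \<le> d\<^sup>2" using a d by (metis abs_le_square_iff abs_of_pos)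
    then have "a\<^sup>2 / d \<le> d" using d by (simp add: pos_divide_le_eq power2_eq_square)
    moreover have "0 \<le> (1 + d) * d * (?X - a / d)\<^sup>2 + (1 + d) * d * ?Y\<^sup>2" using d by simp
    moreover have "(1 + d) * (1 - ?X\<^sup>2 - ?Y\<^sup>2) - (1 - ((1 + d) * ?X - a)\<^sup>2 - ((1 + d) * ?Y)\<^sup>2)
       = (1 + d) * d * (?X - a / d)\<^sup>2 + (1 + d) * d * ?Y\<^sup>2 + (d - a\<^sup>2 / d)"
      using d by (simp add: power2_eq_square field_simps)
    ultimately have "1 - ((1 + d) * ?X - a)\<^sup>2 - ((1 + d) * ?Y)\<^sup>2 \<le> (1 + d) * (1 - ?X\<^sup>2 - ?Y\<^sup>2)"
      by linarith
    also have "\<dots> \<le> (1 + d) * bump v" using d by (intro mult_left_mono) (auto simp: bump_def)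
    finally show ?thesis
      using d bump_bounds(1)[of v] by (simp add: k_def bump_def[of "_ - _"])
  qed
  define m where "m = 1 / (1 + d)"
  have m: "m > 0" using d by (simp add: m_def)
  define c :: "real \<times> real" where "c = (a * m, 0)"
  define A B :: "real \<times> real" where "A = m *\<^sub>R (-1, -1) + c" and "B = m *\<^sub>R (1, 1) + c"
  have sub: "cbox A B \<subseteq> ?I"
  proof -
    have "\<bar>a * m\<bar> \<le> d * m" using a m by (simp add: abs_mult)
    moreover have "d * m + m = 1" using d by (simp add: m_def field_simps)
    moreover have "m \<le> 1" using d by (simp add: m_def)
    ultimately show ?thesis by (intro subset_box_imp) (auto simp: A_def B_def c_def Basis_prod_def)
  qed
  have If: "f integrable_on cbox A B" "f integrable_on ?I"
    using fc continuous_on_subset[OF fc sub] by (auto intro: integrable_continuous)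
  have f0: "0 \<le> f v" if "v \<in> ?I" for v
    using nonneg[OF in_Y[OF that]] bump_bounds by (simp add: f_def k_def)
  have "((\<lambda>v. f (m *\<^sub>R v + c)) has_integral integral (cbox A B) f /\<^sub>R m ^ DIM(real \<times> real))
      (cbox ((A - c) /\<^sub>R m) ((B - c) /\<^sub>R m))"
    by (rule has_integral_affinity'[OF integrable_integral[OF If(1)] m])
  moreover have "(A - c) /\<^sub>R m = (-1, -1)" "(B - c) /\<^sub>R m = (1, 1)"
    using m by (auto simp: A_def B_def c_def)
  moreover have "f (m *\<^sub>R v + c) = w (x + s + r * fst v) (t0 + r * snd v) * bump v" for v
  proof -
    have *: "(1 + d) * m = 1" using d by (simp add: m_def)
    have 1: "R' * (m * fst v + a * m) = s + r * fst v"
    proof -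
      have "R' * (m * fst v + a * m) = ((1 + d) * m) * (r * fst v + r * a)" by (simp add: R'_def
          algebra_simps)
      then show ?thesis by (simp only: *) (simp add: a)
    qed
    have 2: "R' * (m * snd v) = r * snd v"
    proof -
      have "R' * (m * snd v) = ((1 + d) * m) * (r * snd v)" by (simp add: R'_def algebra_simps)
      then show ?thesis by (simp only: *)
    qed
    have "(1 + d) *\<^sub>R (m *\<^sub>R v + c) - (a, 0) = v"
    proof -
      have "(1 + d) *\<^sub>R (m *\<^sub>R v + c) = ((1 + d) * m) *\<^sub>R v + (a * ((1 + d) * m), 0)"
        by (simp add: c_def scaleR_add_right)
      then show ?thesis unfolding * by (cases v) simp
    qed
    then show ?thesis by (simp add: f_def k_def 1 2 c_def add.assoc)
  qed
  ultimately have "disc_mean w (x + s) t0 r = integral (cbox A B) f /\<^sub>R m ^ DIM(real \<times> real)"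
    unfolding disc_mean_def by (simp add: integral_unique)
  also have "\<dots> = (1 + d)\<^sup>2 * integral (cbox A B) f"
    by (simp add: m_def power_divide power2_eq_square)
  also have "integral (cbox A B) f \<le> integral ?I f"
    by (rule integral_subset_le[OF sub If]) (use f0 in auto)
  also have "integral ?I f \<le> integral ?I (\<lambda>v. (1 + d) * (w (x + R' * fst v) (t0 + R' * snd v) * bump v))"
  proof (rule integral_le[OF If(2)])
    show "(\<lambda>v. (1 + d) * (w (x + R' * fst v) (t0 + R' * snd v) * bump v)) integrable_on ?I"
      by (intro integrable_continuous continuous_intros wc)
    fix v assume "v \<in> ?I"
    then have "w (x + R' * fst v) (t0 + R' * snd v) * k v
       \<le> w (x + R' * fst v) (t0 + R' * snd v) * ((1 + d) * bump v)"
      using nonneg[OF in_Y] kle by (intro mult_left_mono) auto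
    then show "f v \<le> (1 + d) * (w (x + R' * fst v) (t0 + R' * snd v) * bump v)"
      by (simp add: f_def mult_ac)
  qed
  also have "\<dots> = (1 + d) * disc_mean w x t0 R'"
    by (simp add: disc_mean_def)
  finally show ?thesis
    using d by (simp add: R'_def power2_eq_square power3_eq_cube mult.assoc)
qed

text \<open>
  The factor is close to 1 if the displacement is small against \<open>r\<close> and \<open>C * r\<^sup>2\<close> is small.
\<close>

lemma horizontal_comparison:
  assumes r: "r > 0" and d: "d > 0" and s: "\<bar>s\<bar> \<le> d * r" and rR: "(1 + d) * r \<le> R"
  shows "w (x + s) t0 \<le> (1 + d) ^ 3 * exp (C * ((1 + d) * r)\<^sup>2 / 4) * w x t0"
proof -
  let ?I = "cbox (-1, -1) (1, 1) :: (real \<times> real) set"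
  define R' where "R' = (1 + d) * r"
  have "1 * r \<le> (1 + d) * r" using r d by (intro mult_right_mono) auto
  then have rR': "r \<le> R'" by (simp add: R'_def)
  have I0: "disc_mean w x t0 0 = w x t0 * integral ?I bump" for x by (simp add: disc_mean_def)
  have Ipos: "integral ?I bump > 0"
  proof -
    let ?J = "cbox (-1/2, -1/2) (1/2, 1/2) :: (real \<times> real) set"
    have sub: "?J \<subseteq> ?I" by (auto simp: cbox_Pair_eq)
    have "integral ?J (\<lambda>v. 1 / 2) \<le> integral ?J bump"
    proof (rule integral_le)
      fix v :: "real \<times> real" assume "v \<in> ?J"
      then have "\<bar>fst v\<bar> \<le> 1 / 2" "\<bar>snd v\<bar> \<le> 1 / 2" by (auto simp: cbox_Pair_eq)
      then have "(fst v)\<^sup>2 \<le> (1/2)\<^sup>2" "(snd v)\<^sup>2 \<le> (1/2)\<^sup>2" by (metis abs_le_square_iff abs_of_pos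
          half_gt_zero zero_less_one)+
      then show "1 / 2 \<le> bump v" by (simp add: bump_def power2_eq_square)
    qed (auto intro!: integrable_continuous continuous_intros)
    also have "\<dots> \<le> integral ?I bump"
      by (rule integral_subset_le[OF sub]) (auto intro!: integrable_continuous continuous_intros simp:
          bump_bounds)
    finally show ?thesis by (simp add: content_Pair)
  qed
  have CR: "C * r\<^sup>2 \<le> C * R'\<^sup>2" using C rR' r by (intro mult_left_mono power_mono) auto
  have w0: "0 \<le> w x t0" for x using nonneg R by simp
  have "disc_mean w (x + s) t0 0 \<le> exp (C * r\<^sup>2 / 8) * disc_mean w (x + s) t0 r"
    by (rule disc_mean_bounds) (use rR' rR[folded R'_def] r in simp)
  also have "\<dots> \<le> exp (C * r\<^sup>2 / 8) * ((1 + d) ^ 3 * disc_mean w x t0 R')"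
    using disc_mean_shift[OF assms] by (simp add: R'_def)
  also have "\<dots> \<le> exp (C * r\<^sup>2 / 8) * ((1 + d) ^ 3 * (exp (C * R'\<^sup>2 / 8) * disc_mean w x t0 0))"
    using d rR r by (intro mult_left_mono disc_mean_bounds) (auto simp: R'_def)
  also have "\<dots> = (1 + d) ^ 3 * (exp (C * r\<^sup>2 / 8 + C * R'\<^sup>2 / 8) * disc_mean w x t0 0)"
    by (simp add: exp_add mult_ac)
  also have "\<dots> \<le> (1 + d) ^ 3 * (exp (C * R'\<^sup>2 / 4) * disc_mean w x t0 0)"
    using d CR w0 Ipos by (intro mult_left_mono mult_right_mono) (auto simp: I0)
  finally show ?thesis using Ipos by (simp add: I0 R'_def mult.assoc[symmetric])
qed

end

section \<open>Eigenfunctions with bounded logarithmic derivatives in x and y\<close>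

lemma gronwall_global:
  fixes A A1 :: "real \<Rightarrow> real"
  assumes d: "\<And>z. (A has_real_derivative A1 z) (at z)" and b: "\<And>z. \<bar>A1 z\<bar> \<le> E * A z"
  shows "A (x + s) \<le> exp (E * \<bar>s\<bar>) * A x"
proof (cases "s \<ge> 0")
  case True
  have le: "A1 z \<le> E * A z" for z using b[of z] by linarith
  show ?thesis using gronwall_upper[of x "x + s" A A1 E] d le True by auto
next
  case False
  have ge: "- (E * A z) \<le> A1 z" for z using b[of z] by linarith
  show ?thesis using gronwall_lower[of "x + s" x A A1 E] d ge False by auto
qed

text \<open>
  With $t=e^{pz}/p$ one has $e^{2pz}\partial_x^2+\partial_z^2=e^{2pz}(\partial_x^2+\partial_t^2+t^{-1}\partial_t)$,
  and the factor $\sqrt t$ removes the first order term. Where $z\ge 0$ the contribution of the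
  derivative in the direction \<open>y\<close> is bounded by \<open>K * U\<close>.
\<close>

lemma eigenfunction_flattened:
  assumes E: "eigenfunction p q m U Ux Uxx Uy Uyy Uz Uzz"
    and p: "p > 0" and q: "q > 0" and m: "m \<ge> 0"
    and nonneg: "\<And>x y z. 0 \<le> U x y z"
    and K: "\<And>x y z. \<bar>Uyy x y z\<bar> \<le> K * U x y z" "K \<ge> 0"
    and t0: "t0 \<ge> 2 / p"
  shows "near_harmonic (\<lambda>x t. sqrt t * U x y (ln (p * t) / p)) (\<lambda>x t. sqrt t * Ux x y (ln (p * t) / p))
    (\<lambda>x t. sqrt t * Uxx x y (ln (p * t) / p))
    (\<lambda>x t. U x y (ln (p * t) / p) / (2 * sqrt t) + Uz x y (ln (p * t) / p) / (p * sqrt t))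
    (\<lambda>x t. Uzz x y (ln (p * t) / p) / (p\<^sup>2 * (t * sqrt t)) - U x y (ln (p * t) / p) / (4 * (t * sqrt t)))
    t0 (t0 / 2) (4 * ((m + K + p\<^sup>2 / 4) / p\<^sup>2) / t0\<^sup>2)"
proof -
  interpret eigenfunction p q m U Ux Uxx Uy Uyy Uz Uzz by fact
  have t00: "t0 > 0" using t0 p by (meson divide_pos_pos less_le_trans zero_less_numeral)
  have tpos: "t > 0" "p * t \<ge> 1" "t \<ge> t0 / 2" if "\<bar>t - t0\<bar> \<le> t0 / 2" for t
  proof -
    show t: "t \<ge> t0 / 2" using that unfolding abs_le_iff by linarith
    then show "t > 0" using t00 by linarith
    have "t \<ge> 1 / p" using t t0 by (simp add: field_simps)
    then show "p * t \<ge> 1" using p by (simp add: field_simps)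
  qed
  define \<zeta> where "\<zeta> = (\<lambda>t. ln (p * t) / p)"
  have d\<zeta>: "(\<zeta> has_real_derivative 1 / (p * t)) (at t)" if "t > 0" for t
    unfolding \<zeta>_def using that p by (auto intro!: derivative_eq_intros simp: field_simps)
  have c\<zeta>: "continuous_on (UNIV \<times> {t0 - t0 / 2..t0 + t0 / 2}) (\<lambda>v. F (fst v) y (\<zeta> (snd v)))" if "cont3
      F" for F
    by (rule cont3D[OF that], unfold \<zeta>_def, (intro continuous_intros)+)
       (use p t00 in \<open>auto simp: field_simps\<close>)
  show ?thesis
    unfolding \<zeta>_def[symmetric, THEN fun_cong, simplified]
  proof
    show "t0 / 2 > 0" using t00 by simp
    show "4 * ((m + K + p\<^sup>2 / 4) / p\<^sup>2) / t0\<^sup>2 \<ge> 0" using m K by simp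
    fix x t assume t: "\<bar>t - t0\<bar> \<le> t0 / 2"
    note tp = tpos[OF t]
    have st: "sqrt t > 0" "sqrt t * sqrt t = t" using tp by auto
    show "((\<lambda>x. sqrt t * U x y (\<zeta> t)) has_real_derivative sqrt t * Ux x y (\<zeta> t)) (at x)"
      by (rule DERIV_cmult[OF dx])
    show "((\<lambda>x. sqrt t * Ux x y (\<zeta> t)) has_real_derivative sqrt t * Uxx x y (\<zeta> t)) (at x)"
      by (rule DERIV_cmult[OF dxx])
    have ds: "(sqrt has_real_derivative 1 / (2 * sqrt t)) (at t)"
      using DERIV_real_sqrt[OF tp(1)] by (simp add: field_simps)
    have dU: "((\<lambda>t. U x y (\<zeta> t)) has_real_derivative Uz x y (\<zeta> t) * (1 / (p * t))) (at t)"
      by (rule DERIV_chain2[OF dz d\<zeta>[OF tp(1)]])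
    have dUz: "((\<lambda>t. Uz x y (\<zeta> t)) has_real_derivative Uzz x y (\<zeta> t) * (1 / (p * t))) (at t)"
      by (rule DERIV_chain2[OF dzz d\<zeta>[OF tp(1)]])
    have "1 / (2 * sqrt t) * U x y (\<zeta> t) + Uz x y (\<zeta> t) * (1 / (p * t)) * sqrt t
        = U x y (\<zeta> t) / (2 * sqrt t) + Uz x y (\<zeta> t) / (p * sqrt t)"
    proof -
      define r where "r = sqrt t"
      have r: "r > 0" "t = r * r" using st by (auto simp: r_def)
      show ?thesis unfolding r_def[symmetric] unfolding r(2) using r(1) p by (simp add: field_simps)
    qed
    then show "((\<lambda>t. sqrt t * U x y (\<zeta> t)) has_real_derivative
        U x y (\<zeta> t) / (2 * sqrt t) + Uz x y (\<zeta> t) / (p * sqrt t)) (at t)"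
      using DERIV_mult[OF ds dU] by (simp only:)
    have "((\<lambda>t. U x y (\<zeta> t) / (2 * sqrt t) + Uz x y (\<zeta> t) / (p * sqrt t)) has_real_derivative
        ((Uz x y (\<zeta> t) * (1 / (p * t))) * (2 * sqrt t) - U x y (\<zeta> t) * (2 * (1 / (2 * sqrt t))))
           / ((2 * sqrt t) * (2 * sqrt t))
        + ((Uzz x y (\<zeta> t) * (1 / (p * t))) * (p * sqrt t) - Uz x y (\<zeta> t) * (p * (1 / (2 * sqrt t))))
           / ((p * sqrt t) * (p * sqrt t))) (at t)"
      using st p by (intro DERIV_add DERIV_divide DERIV_cmult dU dUz ds) auto
    moreover have "((Uz x y (\<zeta> t) * (1 / (p * t))) * (2 * sqrt t) - U x y (\<zeta> t) * (2 * (1 / (2 * sqrt t))))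
           / ((2 * sqrt t) * (2 * sqrt t))
        + ((Uzz x y (\<zeta> t) * (1 / (p * t))) * (p * sqrt t) - Uz x y (\<zeta> t) * (p * (1 / (2 * sqrt t))))
           / ((p * sqrt t) * (p * sqrt t))
      = Uzz x y (\<zeta> t) / (p\<^sup>2 * (t * sqrt t)) - U x y (\<zeta> t) / (4 * (t * sqrt t))"
    proof -
      define r where "r = sqrt t"
      have r: "r > 0" "t = r * r" using st by (auto simp: r_def)
      show ?thesis unfolding r_def[symmetric] unfolding r(2)
        using r(1) p by (simp add: field_simps power2_eq_square)
    qed
    ultimately show "((\<lambda>t. U x y (\<zeta> t) / (2 * sqrt t) + Uz x y (\<zeta> t) / (p * sqrt t)) has_real_derivative
        Uzz x y (\<zeta> t) / (p\<^sup>2 * (t * sqrt t)) - U x y (\<zeta> t) / (4 * (t * sqrt t))) (at t)"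
      by simp
    show "0 \<le> sqrt t * U x y (\<zeta> t)" using nonneg tp by simp
    have z0: "\<zeta> t \<ge> 0" using tp p by (simp add: \<zeta>_def)
    have ez: "exp (2 * p * \<zeta> t) = (p * t)\<^sup>2"
    proof -
      have "exp (2 * p * \<zeta> t) = exp (2 * ln (p * t))" using p by (simp add: \<zeta>_def)
      also have "\<dots> = (p * t)\<^sup>2" using p tp by (subst exp_double) simp
      finally show ?thesis .
    qed
    let ?u = "U x y (\<zeta> t)" and ?uxx = "Uxx x y (\<zeta> t)" and ?uyy = "Uyy x y (\<zeta> t)" and ?uzz = "Uzz x y (\<zeta> t)"
    define c where "c = sqrt t / (p\<^sup>2 * t\<^sup>2)"
    have c: "c \<ge> 0" using tp by (simp add: c_def)
    have "sqrt t * ?uxx + (?uzz / (p\<^sup>2 * (t * sqrt t)) - ?u / (4 * (t * sqrt t)))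
       = c * ((p * t)\<^sup>2 * ?uxx + ?uzz - p\<^sup>2 / 4 * ?u)"
    proof -
      define r where "r = sqrt t"
      have r: "r > 0" "t = r * r" using st by (auto simp: r_def)
      show ?thesis unfolding c_def unfolding r_def[symmetric] unfolding r(2)
        using r(1) p by (simp add: field_simps power2_eq_square)
    qed
    also have "(p * t)\<^sup>2 * ?uxx + ?uzz = m * ?u - exp (- 2 * q * \<zeta> t) * ?uyy"
      using pde[of "\<zeta> t" x y] by (simp add: ez)
    finally have "\<bar>sqrt t * ?uxx + (?uzz / (p\<^sup>2 * (t * sqrt t)) - ?u / (4 * (t * sqrt t)))\<bar>
       = c * \<bar>m * ?u - exp (- 2 * q * \<zeta> t) * ?uyy - p\<^sup>2 / 4 * ?u\<bar>"
      using c by (simp add: abs_mult)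
    also have "\<dots> \<le> c * ((m + K + p\<^sup>2 / 4) * ?u)"
    proof (rule mult_left_mono[OF _ c])
      have "\<bar>exp (- 2 * q * \<zeta> t) * ?uyy\<bar> \<le> 1 * (K * ?u)"
        unfolding abs_mult using q z0 K by (intro mult_mono) auto
      moreover have "\<bar>m * ?u\<bar> = m * ?u" "\<bar>p\<^sup>2 / 4 * ?u\<bar> = p\<^sup>2 / 4 * ?u" using m nonneg by (simp_all add:
          abs_mult)
      ultimately show "\<bar>m * ?u - exp (- 2 * q * \<zeta> t) * ?uyy - p\<^sup>2 / 4 * ?u\<bar> \<le> (m + K + p\<^sup>2 / 4) * ?u"
        unfolding distrib_right by linarith
    qed
    also have "\<dots> = (m + K + p\<^sup>2 / 4) / p\<^sup>2 / t\<^sup>2 * (sqrt t * ?u)"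
      by (simp add: c_def field_simps)
    also have "\<dots> \<le> (m + K + p\<^sup>2 / 4) / p\<^sup>2 / (t0 / 2)\<^sup>2 * (sqrt t * ?u)"
      using m K nonneg tp t00 by (intro mult_right_mono divide_left_mono power_mono) auto
    also have "(m + K + p\<^sup>2 / 4) / p\<^sup>2 / (t0 / 2)\<^sup>2 = 4 * ((m + K + p\<^sup>2 / 4) / p\<^sup>2) / t0\<^sup>2"
      by (simp add: power_divide)
    finally show "\<bar>sqrt t * ?uxx + (?uzz / (p\<^sup>2 * (t * sqrt t)) - ?u / (4 * (t * sqrt t)))\<bar>
       \<le> 4 * ((m + K + p\<^sup>2 / 4) / p\<^sup>2) / t0\<^sup>2 * (sqrt t * ?u)" .
  next
    have snz: "snd v \<noteq> 0" if "v \<in> (UNIV :: real set) \<times> {t0 - t0 / 2..t0 + t0 / 2}" for v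
      using that t00 by auto
    note ci = c\<zeta>[OF cont(1)] c\<zeta>[OF cont(2)] c\<zeta>[OF cont(3)] c\<zeta>[OF cont(6)] c\<zeta>[OF cont(7)]
      continuous_intros
    have nz: "\<forall>v\<in>(UNIV :: real set) \<times> {t0 - t0 / 2..t0 + t0 / 2}. 2 * sqrt (snd v) \<noteq> 0"
      "\<forall>v\<in>(UNIV :: real set) \<times> {t0 - t0 / 2..t0 + t0 / 2}. p * sqrt (snd v) \<noteq> 0"
      "\<forall>v\<in>(UNIV :: real set) \<times> {t0 - t0 / 2..t0 + t0 / 2}. p\<^sup>2 * (snd v * sqrt (snd v)) \<noteq> 0"
      "\<forall>v\<in>(UNIV :: real set) \<times> {t0 - t0 / 2..t0 + t0 / 2}. 4 * (snd v * sqrt (snd v)) \<noteq> 0"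
      using snz p by auto
    show "continuous_on (UNIV \<times> {t0 - t0 / 2..t0 + t0 / 2}) (\<lambda>(x, t). sqrt t * U x y (\<zeta> t))"
      "continuous_on (UNIV \<times> {t0 - t0 / 2..t0 + t0 / 2}) (\<lambda>(x, t). sqrt t * Ux x y (\<zeta> t))"
      "continuous_on (UNIV \<times> {t0 - t0 / 2..t0 + t0 / 2}) (\<lambda>(x, t). sqrt t * Uxx x y (\<zeta> t))"
      "continuous_on (UNIV \<times> {t0 - t0 / 2..t0 + t0 / 2})
         (\<lambda>(x, t). U x y (\<zeta> t) / (2 * sqrt t) + Uz x y (\<zeta> t) / (p * sqrt t))"
      "continuous_on (UNIV \<times> {t0 - t0 / 2..t0 + t0 / 2})
         (\<lambda>(x, t). Uzz x y (\<zeta> t) / (p\<^sup>2 * (t * sqrt t)) - U x y (\<zeta> t) / (4 * (t * sqrt t)))"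
      unfolding case_prod_beta' by (intro ci nz)+
  qed
qed

text \<open>
  At height $t=e^{pz}/p$ the radius $r=\sqrt t$ is large compared with the fixed displacement \<open>s\<close>, but
  small compared with the scale $t$ on which the Laplacian is controlled.
\<close>

lemma horizontal_ratio_limit:
  assumes E: "eigenfunction p q m U Ux Uxx Uy Uyy Uz Uzz"
    and p: "p > 0" and q: "q > 0" and m: "m \<ge> 0"
    and nonneg: "\<And>x y z. 0 \<le> U x y z"
    and K: "\<And>x y z. \<bar>Uyy x y z\<bar> \<le> K * U x y z" "K \<ge> 0"
    and e: "e > 0"
  shows "\<exists>Z. \<forall>x y z. z \<ge> Z \<longrightarrow> U (x + s) y z \<le> (1 + e) * U x y z"
proof -
  define c where "c = \<bar>s\<bar> + 1"
  have c: "c > 0" by (simp add: c_def)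
  define C where "C = (m + K + p\<^sup>2 / 4) / p\<^sup>2"
  have C: "C \<ge> 0" using m K by (simp add: C_def)
  \<comment> \<open>The factor of the comparison for the radius sqrt t and the relative displacement c / sqrt t.\<close>
  define F where "F = (\<lambda>t. (1 + c / sqrt t) ^ 3 * exp (C * (1 / sqrt t + c / t)\<^sup>2))"
  have lim0: "((\<lambda>t. a / sqrt t) \<longlongrightarrow> 0) at_top" "((\<lambda>t. a / t) \<longlongrightarrow> 0) at_top" for a :: real
    by (intro real_tendsto_divide_at_top[OF tendsto_const] sqrt_at_top filterlim_ident)+
  have "(F \<longlongrightarrow> (1 + 0) ^ 3 * exp (C * (0 + 0)\<^sup>2)) at_top"
    unfolding F_def by (intro tendsto_intros lim0)
  then have "(F \<longlongrightarrow> 1) at_top" by simp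
  then have ev1: "\<forall>\<^sub>F t in at_top. F t < 1 + e" by (rule order_tendstoD) (use e in simp)
  have "((\<lambda>t. 1 / sqrt t + c / t) \<longlongrightarrow> 0 + 0) at_top" by (intro tendsto_add lim0)
  then have ev2: "\<forall>\<^sub>F t in at_top. 1 / sqrt t + c / t < 1 / 2" by (rule order_tendstoD) simp
  have ev3: "\<forall>\<^sub>F t in at_top. t \<ge> max 1 (2 / p)" by (rule eventually_ge_at_top)
  have "\<forall>\<^sub>F t in at_top. F t < 1 + e \<and> 1 / sqrt t + c / t < 1 / 2 \<and> t \<ge> max 1 (2 / p)"
    using ev1 ev2 ev3 by (intro eventually_conj)
  then obtain T where T: "\<And>t. t \<ge> T \<Longrightarrow> F t < 1 + e \<and> 1 / sqrt t + c / t < 1 / 2 \<and> t \<ge> max 1 (2 / p)"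
    by (auto simp: eventually_at_top_linorder)
  define T1 where "T1 = max T 1"
  have "U (x + s) y z \<le> (1 + e) * U x y z" if z: "z \<ge> ln (p * T1) / p" for x y z
  proof -
    define t where "t = exp (p * z) / p"
    have "T1 > 0" by (simp add: T1_def)
    have "ln (p * T1) \<le> p * z" using z p by (simp add: field_simps)
    then have "p * T1 \<le> exp (p * z)" using p \<open>T1 > 0\<close> by (metis exp_le_cancel_iff exp_ln mult_pos_pos)
    then have "T1 \<le> t" using p by (simp add: t_def field_simps)
    then have t: "F t < 1 + e" "1 / sqrt t + c / t < 1 / 2" "t \<ge> 1" "t \<ge> 2 / p"
      using T[of t] by (auto simp: T1_def)
    have tz: "ln (p * t) / p = z" using p by (simp add: t_def)
    have st: "sqrt t > 0" "sqrt t * sqrt t = t" using t by auto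
    interpret h: near_harmonic "\<lambda>x t. sqrt t * U x y (ln (p * t) / p)" "\<lambda>x t. sqrt t * Ux x y (ln (p *
        t) / p)"
    "\<lambda>x t. sqrt t * Uxx x y (ln (p * t) / p)"
    "\<lambda>x t. U x y (ln (p * t) / p) / (2 * sqrt t) + Uz x y (ln (p * t) / p) / (p * sqrt t)"
    "\<lambda>x t. Uzz x y (ln (p * t) / p) / (p\<^sup>2 * (t * sqrt t)) - U x y (ln (p * t) / p) / (4 * (t * sqrt t))"
    t "t / 2" "4 * C / t\<^sup>2"
      unfolding C_def by (rule eigenfunction_flattened) fact+
    have eq: "(1 + c / sqrt t) * sqrt t = t * (1 / sqrt t + c / t)"
    proof -
      define r where "r = sqrt t"
      have r: "r > 0" "t = r * r" using st by (auto simp: r_def)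
      show ?thesis unfolding r_def[symmetric] unfolding r(2) using r(1) by (simp add: field_simps)
    qed
    have "sqrt t * U (x + s) y z
      \<le> (1 + c / sqrt t) ^ 3 * exp (4 * C / t\<^sup>2 * ((1 + c / sqrt t) * sqrt t)\<^sup>2 / 4) * (sqrt t * U x y z)"
    proof (rule h.horizontal_comparison[of "sqrt t" "c / sqrt t" s x, unfolded tz])
      show "\<bar>s\<bar> \<le> c / sqrt t * sqrt t" using st by (simp add: c_def)
      show "(1 + c / sqrt t) * sqrt t \<le> t / 2" unfolding eq using t by simp
    qed (use st c in auto)
    also have "4 * C / t\<^sup>2 * ((1 + c / sqrt t) * sqrt t)\<^sup>2 / 4 = C * (1 / sqrt t + c / t)\<^sup>2"
      unfolding eq using t by (simp add: power_mult_distrib)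
    also have "(1 + c / sqrt t) ^ 3 * exp (C * (1 / sqrt t + c / t)\<^sup>2) * (sqrt t * U x y z)
      = F t * (sqrt t * U x y z)" by (simp add: F_def)
    also have "\<dots> \<le> (1 + e) * (sqrt t * U x y z)"
      using t st nonneg by (intro mult_right_mono) auto
    finally have "sqrt t * U (x + s) y z \<le> sqrt t * ((1 + e) * U x y z)" by (simp add: mult_ac)
    then show ?thesis using st by simp
  qed
  then show ?thesis by blast
qed

lemma horizontal_oscillation_decay:
  assumes E: "eigenfunction p q m U Ux Uxx Uy Uyy Uz Uzz"
    and p: "p > 0" and q: "q > 0" and m: "m \<ge> 0"
    and nonneg: "\<And>x y z. 0 \<le> U x y z"
    and K: "\<And>x y z. \<bar>Uyy x y z\<bar> \<le> K * U x y z" "K \<ge> 0"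
    and e: "e > 0"
  shows "\<exists>Z. \<forall>x y z. z \<ge> Z \<longrightarrow> \<bar>U (x + s) y z - U x y z\<bar> \<le> e * U x y z"
proof -
  define d where "d = min 1 (e / 2)"
  have d: "d > 0" "d \<le> 1" "2 * d \<le> e" using e by (auto simp: d_def)
  obtain Z1 where Z1: "\<And>x y z. z \<ge> Z1 \<Longrightarrow> U (x + s) y z \<le> (1 + d) * U x y z"
    using horizontal_ratio_limit[OF E p q m nonneg K d(1), of s] by auto
  obtain Z2 where Z2: "\<And>x y z. z \<ge> Z2 \<Longrightarrow> U (x + - s) y z \<le> (1 + d) * U x y z"
    using horizontal_ratio_limit[OF E p q m nonneg K d(1), of "- s"] by auto
  have "\<bar>U (x + s) y z - U x y z\<bar> \<le> e * U x y z" if z: "z \<ge> max Z1 Z2" for x y z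
  proof -
    have 1: "U (x + s) y z \<le> (1 + d) * U x y z" using Z1 z by simp
    have 2: "U x y z \<le> (1 + d) * U (x + s) y z" using Z2[of z "x + s" y] z by simp
    have "d * U (x + s) y z \<le> d * ((1 + d) * U x y z)" using 1 d by simp
    also have "\<dots> \<le> d * (2 * U x y z)" using d nonneg by (intro mult_left_mono mult_right_mono) auto
    finally have "d * U (x + s) y z \<le> 2 * d * U x y z" by simp
    moreover have "2 * d * U x y z \<le> e * U x y z" "d * U x y z \<le> 2 * d * U x y z"
      using d nonneg by (auto intro!: mult_right_mono)
    ultimately show ?thesis using 1 2 unfolding distrib_right by linarith
  qed
  then show ?thesis by blast
qed

text \<open>
  Near $z=+\infty$ the mixed difference is read as the difference in \<open>y\<close> of two differences in \<open>x\<close>, near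
  $z=-\infty$ the other way round. The comparison function is \<open>U\<close> plus a solution that
  depends on \<open>z\<close> alone, which makes it strictly positive.
\<close>

lemma mixed_difference_nonpos:
  assumes E: "eigenfunction p q m U Ux Uxx Uy Uyy Uz Uzz"
    and p: "p > 0" and q: "q > 0" and m: "m \<ge> 0"
    and nonneg: "\<And>x y z. 0 \<le> U x y z"
    and K: "K \<ge> 0" "\<And>x y z. \<bar>Ux x y z\<bar> \<le> K * U x y z" "\<And>x y z. \<bar>Uy x y z\<bar> \<le> K * U x y z"
      "\<And>x y z. \<bar>Uxx x y z\<bar> \<le> K * U x y z" "\<And>x y z. \<bar>Uyy x y z\<bar> \<le> K * U x y z"
  shows "U (x + s) (y + t) z - U x (y + t) z - (U (x + s) y z - U x y z) \<le> 0"
proof -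
  interpret U: eigenfunction p q m U Ux Uxx Uy Uyy Uz Uzz by fact
  define W where "W = (\<lambda>x y z. U x y z + exp (sqrt m * z))"
  have UW: "U x y z \<le> W x y z" for x y z by (simp add: W_def)
  have W: "eigenfunction p q m W Ux Uxx Uy Uyy
    (\<lambda>x y z. Uz x y z + sqrt m * exp (sqrt m * z)) (\<lambda>x y z. Uzz x y z + m * exp (sqrt m * z))"
    unfolding W_def by (rule eigenfunction_add_vertical[OF E m])
  have V: "eigenfunction p q m (\<lambda>x y z. U (x + s) (y + 0) z - U x y z) (\<lambda>x y z. Ux (x + s) (y + 0) z -
      Ux x y z)
     (\<lambda>x y z. Uxx (x + s) (y + 0) z - Uxx x y z) (\<lambda>x y z. Uy (x + s) (y + 0) z - Uy x y z)
     (\<lambda>x y z. Uyy (x + s) (y + 0) z - Uyy x y z) (\<lambda>x y z. Uz (x + s) (y + 0) z - Uz x y z)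
     (\<lambda>x y z. Uzz (x + s) (y + 0) z - Uzz x y z)"
    by (rule eigenfunction_diff[OF eigenfunction_shift[OF E] E])
  have Ex: "U (x + s) y z \<le> exp (K * \<bar>s\<bar>) * U x y z" for x y z s
    by (rule gronwall_global[where A = "\<lambda>x. U x y z" and ?A1.0 = "\<lambda>x. Ux x y z"]) (rule U.dx K)+
  have Ey: "U x (y + s) z \<le> exp (K * \<bar>s\<bar>) * U x y z" for x y z s
    by (rule gronwall_global[where A = "\<lambda>y. U x y z" and ?A1.0 = "\<lambda>y. Uy x y z"]) (rule U.dy K)+
  have "(U (x + 0 + s) (y + t + 0) z - U (x + 0) (y + t) z) - (U (x + s) (y + 0) z - U x y z) \<le> 0"
  proof (rule max_principle_quotient[OF eigenfunction_diff[OF eigenfunction_shift[OF V] V] W p q _ K(1)])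
    fix x y z
    show "W x y z > 0" using nonneg[of x y z] by (simp add: W_def add_nonneg_pos)
    show "\<bar>Ux x y z\<bar> \<le> K * W x y z" "\<bar>Uy x y z\<bar> \<le> K * W x y z"
      using K UW[of x y z] by (meson mult_left_mono order_trans)+
  next
    fix n :: nat
    define D where "D = sqrt (m + (exp (2 * p * (n + 1)) + exp (2 * q * (n + 1))) * K + 1)"
    have D2: "D\<^sup>2 = m + (exp (2 * p * (n + 1)) + exp (2 * q * (n + 1))) * K + 1"
      using m K by (simp add: D_def)
    have D0: "D > 0" using m K by (simp add: D_def add_nonneg_pos)
    have "Uz x y z + sqrt m * exp (sqrt m * z) \<le> max (D + 1) (sqrt m) * W x y z" if z: "\<bar>z\<bar> \<le> real n"
        for x y z
    proof -
      have "Uz x y z \<le> (D + 1) * U x y z"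
      proof (rule log_derivative_upper[OF D0, where A = "\<lambda>z. U x y z" and ?A1.0 = "\<lambda>z. Uz x y z" and
          ?A2.0 = "\<lambda>z. Uzz x y z"])
        fix \<zeta> assume "\<zeta> \<in> {z - 1..z}"
        then have \<zeta>: "\<bar>\<zeta>\<bar> \<le> n + 1" using z by (auto simp: abs_le_iff)
        have b: "- (exp a * Q) \<le> exp b * (K * U x y \<zeta>)" if "a \<le> b" "\<bar>Q\<bar> \<le> K * U x y \<zeta>" for a b Q
        proof -
          have "\<bar>exp a * Q\<bar> \<le> exp b * (K * U x y \<zeta>)"
            unfolding abs_mult using that by (intro mult_mono) auto
          then show ?thesis by linarith
        qed
        have "- (exp (2 * p * \<zeta>) * Uxx x y \<zeta>) \<le> exp (2 * p * (n + 1)) * (K * U x y \<zeta>)"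
          by (rule b[OF _ K(4)]) (use p \<zeta> in auto)
        moreover have "- (exp (- 2 * q * \<zeta>) * Uyy x y \<zeta>) \<le> exp (2 * q * (n + 1)) * (K * U x y \<zeta>)"
        proof (rule b[OF _ K(5)])
          have "q * - \<zeta> \<le> q * (n + 1)" using q \<zeta> by (intro mult_left_mono) auto
          then show "- 2 * q * \<zeta> \<le> 2 * q * (n + 1)" by (simp add: algebra_simps)
        qed
        ultimately show "Uzz x y \<zeta> \<le> D\<^sup>2 * U x y \<zeta>"
          using U.pde[of \<zeta> x y] nonneg[of x y \<zeta>] unfolding D2 by (simp add: algebra_simps)
      qed (rule U.dz U.dzz nonneg)+
      also have "\<dots> \<le> max (D + 1) (sqrt m) * U x y z" using nonneg by (intro mult_right_mono) auto
      finally have "Uz x y z \<le> max (D + 1) (sqrt m) * U x y z" .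
      moreover have "sqrt m * exp (sqrt m * z) \<le> max (D + 1) (sqrt m) * exp (sqrt m * z)"
        by (intro mult_right_mono) auto
      ultimately show ?thesis unfolding W_def distrib_left by linarith
    qed
    then show "\<exists>D. \<forall>x y z. \<bar>z\<bar> \<le> real n \<longrightarrow> Uz x y z + sqrt m * exp (sqrt m * z) \<le> D * W x y z" by blast
  next
    fix x y z
    have "U (x + s) (y + t) z \<le> exp (K * \<bar>s\<bar>) * U x (y + t) z" by (rule Ex)
    also have "\<dots> \<le> exp (K * \<bar>s\<bar>) * (exp (K * \<bar>t\<bar>) * U x y z)" using Ey by simp
    finally have 1: "U (x + s) (y + t) z \<le> exp (K * \<bar>s\<bar>) * exp (K * \<bar>t\<bar>) * U x y z" by simp
    have "U (x + s) (y + t) z - U x (y + t) z - (U (x + s) y z - U x y z)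
       \<le> (exp (K * \<bar>s\<bar>) * exp (K * \<bar>t\<bar>) + 1) * U x y z"
      unfolding distrib_right using 1 nonneg[of x "y + t" z] nonneg[of "x + s" y z] by linarith
    also have "\<dots> \<le> (exp (K * \<bar>s\<bar>) * exp (K * \<bar>t\<bar>) + 1) * W x y z"
      using UW by (intro mult_left_mono) (auto intro: add_nonneg_nonneg)
    finally show "U (x + 0 + s) (y + t + 0) z - U (x + 0) (y + t) z - (U (x + s) (y + 0) z - U x y z)
       \<le> (exp (K * \<bar>s\<bar>) * exp (K * \<bar>t\<bar>) + 1) * W x y z" by simp
  next
    fix e :: real assume e: "e > 0"
    define e1 where "e1 = e / (exp (K * \<bar>t\<bar>) + 1)"
    define e2 where "e2 = e / (exp (K * \<bar>s\<bar>) + 1)"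
    have ex: "exp (K * \<bar>r\<bar>) + 1 > 0" for r by (simp add: add_pos_pos)
    have e12: "e1 > 0" "e2 > 0" using e ex by (auto simp: e1_def e2_def)
    obtain Z1 where Z1: "\<And>x y z. z \<ge> Z1 \<Longrightarrow> \<bar>U (x + s) y z - U x y z\<bar> \<le> e1 * U x y z"
      using horizontal_oscillation_decay[OF E p q m nonneg K(5) K(1) e12(1)] by blast
    obtain Z2 where Z2: "\<And>y x z. z \<ge> Z2 \<Longrightarrow> \<bar>U x (y + t) (- z) - U x y (- z)\<bar> \<le> e2 * U x y (- z)"
      using horizontal_oscillation_decay[OF eigenfunction_swap[OF E] q p m nonneg K(4) K(1) e12(2)] by blast
    obtain n :: nat where n: "real n \<ge> max Z1 Z2" using real_arch_simple by blast
    have "U (x + s) (y + t) z - U x (y + t) z - (U (x + s) y z - U x y z) \<le> e * W x y z"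
      if z: "\<bar>z\<bar> \<ge> real n" for x y z
    proof -
      have "U (x + s) (y + t) z - U x (y + t) z - (U (x + s) y z - U x y z) \<le> e * U x y z"
      proof (cases "z \<ge> 0")
        case True
        have "\<bar>U (x + s) (y + t) z - U x (y + t) z\<bar> \<le> e1 * U x (y + t) z"
          "\<bar>U (x + s) y z - U x y z\<bar> \<le> e1 * U x y z"
          by (rule Z1, use z n True in simp)+
        moreover have "e1 * U x (y + t) z \<le> e1 * (exp (K * \<bar>t\<bar>) * U x y z)" using Ey e12 by simp
        moreover have "e1 * (exp (K * \<bar>t\<bar>) * U x y z) + e1 * U x y z = e * U x y z"
        proof -
          have "e1 * (exp (K * \<bar>t\<bar>) + 1) = e" using ex[of t] by (simp add: e1_def)
          then show ?thesis by (metis distrib_right mult.assoc mult.commute mult_1)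
        qed
        ultimately show ?thesis by linarith
      next
        case False
        have "\<bar>U (x + s) (y + t) (- (- z)) - U (x + s) y (- (- z))\<bar> \<le> e2 * U (x + s) y (- (- z))"
          "\<bar>U x (y + t) (- (- z)) - U x y (- (- z))\<bar> \<le> e2 * U x y (- (- z))"
          by (rule Z2, use z n False in simp)+
        moreover have "e2 * U (x + s) y z \<le> e2 * (exp (K * \<bar>s\<bar>) * U x y z)" using Ex e12 by simp
        moreover have "e2 * (exp (K * \<bar>s\<bar>) * U x y z) + e2 * U x y z = e * U x y z"
        proof -
          have "e2 * (exp (K * \<bar>s\<bar>) + 1) = e" using ex[of s] by (simp add: e2_def)
          then show ?thesis by (metis distrib_right mult.assoc mult.commute mult_1)
        qed
        ultimately show ?thesis unfolding minus_minus by linarith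
      qed
      also have "\<dots> \<le> e * W x y z" using UW e by simp
      finally show ?thesis .
    qed
    then show "\<exists>n::nat. \<forall>x y z. \<bar>z\<bar> \<ge> real n \<longrightarrow> U (x + 0 + s) (y + t + 0) z - U (x + 0) (y + t) z
        - (U (x + s) (y + 0) z - U x y z) \<le> e * W x y z"
      unfolding add_0_right by blast
  qed
  then show ?thesis by simp
qed

text \<open>
  Replacing \<open>s\<close> by \<open>- s\<close> reverses the sign of the mixed difference.
\<close>

lemma mixed_difference_zero:
  assumes E: "eigenfunction p q m U Ux Uxx Uy Uyy Uz Uzz"
    and "p > 0" and "q > 0" and "m \<ge> 0" and "\<And>x y z. 0 \<le> U x y z"
    and "K \<ge> 0" "\<And>x y z. \<bar>Ux x y z\<bar> \<le> K * U x y z" "\<And>x y z. \<bar>Uy x y z\<bar> \<le> K * U x y z"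
      "\<And>x y z. \<bar>Uxx x y z\<bar> \<le> K * U x y z" "\<And>x y z. \<bar>Uyy x y z\<bar> \<le> K * U x y z"
  shows "U (x + s) (y + t) z - U x (y + t) z - (U (x + s) y z - U x y z) = 0"
  using mixed_difference_nonpos[OF assms, of x s y t z]
    mixed_difference_nonpos[OF assms, of "x + s" "- s" y t z] by simp

section \<open>Convolution in x and y\<close>

lemma compact_support_integral:
  fixes F :: "real \<times> real \<Rightarrow> real"
  assumes c: "continuous_on UNIV F" and z: "\<And>w. w \<notin> cbox a b \<Longrightarrow> F w = 0"
  shows "integrable lborel F" and "(\<integral>w. F w \<partial>lborel) = integral (cbox a b) F"
proof -
  have si: "set_integrable lborel (cbox a b) F"
    unfolding set_integrable_def
    by (rule borel_integrable_compact) (auto intro: continuous_on_subset[OF c])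
  have eq: "(\<lambda>w. indicator (cbox a b) w *\<^sub>R F w) = F"
    using z by (auto simp: fun_eq_iff indicator_def)
  show "integrable lborel F" using si unfolding set_integrable_def eq .
  show "(\<integral>w. F w \<partial>lborel) = integral (cbox a b) F"
    using set_borel_integral_eq_integral(2)[OF si] unfolding set_lebesgue_integral_def eq .
qed

lemma compact_support_integral_deriv:
  fixes \<Phi> \<Phi>' :: "real \<Rightarrow> real \<times> real \<Rightarrow> real"
  assumes d: "\<And>t w. ((\<lambda>t. \<Phi> t w) has_real_derivative \<Phi>' t w) (at t)"
    and c: "\<And>t. continuous_on UNIV (\<Phi> t)"
    and c': "continuous_on UNIV (\<lambda>v. \<Phi>' (fst v) (snd v))"
    and z: "\<And>t w. \<bar>t - t0\<bar> \<le> 1 \<Longrightarrow> w \<notin> cbox a b \<Longrightarrow> \<Phi> t w = 0 \<and> \<Phi>' t w = 0"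
  shows "((\<lambda>t. \<integral>w. \<Phi> t w \<partial>lborel) has_real_derivative (\<integral>w. \<Phi>' t0 w \<partial>lborel)) (at t0)"
proof -
  let ?U = "{t0-1<..<t0+1}"
  have "((\<lambda>t. integral (cbox a b) (\<Phi> t)) has_real_derivative integral (cbox a b) (\<Phi>' t0)) (at t0 within ?U)"
  proof (rule leibniz_rule_field_derivative)
    show "((\<lambda>t. \<Phi> t w) has_real_derivative \<Phi>' t w) (at t within ?U)" for t w
      by (rule has_field_derivative_at_within[OF d])
    show "\<Phi> t integrable_on cbox a b" for t
      by (rule integrable_continuous) (rule continuous_on_subset[OF c], simp)
    show "continuous_on (?U \<times> cbox a b) (\<lambda>(t, w). \<Phi>' t w)"
      using continuous_on_subset[OF c', of "?U \<times> cbox a b"] by (simp add: case_prod_beta')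
    show "t0 \<in> ?U" "convex ?U" by simp_all
  qed
  then have "((\<lambda>t. integral (cbox a b) (\<Phi> t)) has_real_derivative integral (cbox a b) (\<Phi>' t0)) (at t0)"
    using at_within_open[of t0 ?U] by (simp only: open_greaterThanLessThan greaterThanLessThan_iff) simp
  then have "((\<lambda>t. \<integral>w. \<Phi> t w \<partial>lborel) has_real_derivative integral (cbox a b) (\<Phi>' t0)) (at t0)"
  proof (rule has_field_derivative_transform_within_open[of _ _ _ ?U])
    fix t assume "t \<in> ?U"
    then have "\<bar>t - t0\<bar> \<le> 1" by auto
    then show "integral (cbox a b) (\<Phi> t) = (\<integral>w. \<Phi> t w \<partial>lborel)"
      using compact_support_integral(2)[OF c[of t], of a b] z[of t] by auto
  qed auto
  moreover have "continuous_on UNIV (\<Phi>' t0)"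
  proof -
    have "continuous_on UNIV (\<lambda>w::real \<times> real. (t0, w))" by (intro continuous_intros)
    from continuous_on_compose2[OF c' this] show ?thesis by simp
  qed
  then have "(\<integral>w. \<Phi>' t0 w \<partial>lborel) = integral (cbox a b) (\<Phi>' t0)"
    by (rule compact_support_integral(2)) (use z in auto)
  ultimately show ?thesis by simp
qed

lemma lborel_integral_shift:
  fixes F :: "real \<times> real \<Rightarrow> real"
  assumes "continuous_on UNIV F"
  shows "(\<integral>w. F (c + w) \<partial>lborel) = (\<integral>w. F w \<partial>lborel)"
proof -
  have "(\<integral>w. F w \<partial>lborel) = (\<integral>w. F w \<partial>distr lborel borel ((+) c))"
    by (simp add: lborel_distr_plus)
  also have "\<dots> = (\<integral>w. F (c + w) \<partial>lborel)"
    by (rule integral_distr) (auto intro: borel_measurable_continuous_onI[OF assms])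
  finally show ?thesis by simp
qed

text \<open>
  The bound \<open>L\<close> of the support is kept explicit, so that integrals can be taken over a fixed box.
\<close>

definition kernel :: "real \<Rightarrow> (real \<Rightarrow> real) \<Rightarrow> bool" where
  "kernel L f \<longleftrightarrow> continuous_on UNIV f \<and> (\<forall>x. \<bar>x\<bar> \<ge> L \<longrightarrow> f x = 0)"

definition kernel2 :: "real \<Rightarrow> (real \<Rightarrow> real) \<Rightarrow> (real \<Rightarrow> real) \<Rightarrow> (real \<Rightarrow> real) \<Rightarrow> bool" where
  "kernel2 L f f1 f2 \<longleftrightarrow> kernel L f \<and> kernel L f1 \<and> kernel L f2 \<and>
     (\<forall>x. (f has_real_derivative f1 x) (at x)) \<and> (\<forall>x. (f1 has_real_derivative f2 x) (at x))"

definition conv :: "(real \<Rightarrow> real \<Rightarrow> real \<Rightarrow> real) \<Rightarrow> (real \<Rightarrow> real) \<Rightarrow> (real \<Rightarrow> real) \<Rightarrow>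
    real \<Rightarrow> real \<Rightarrow> real \<Rightarrow> real" where
  "conv F f g x y z = (\<integral>w. F (fst w) (snd w) z * (f (fst w - x) * g (snd w - y)) \<partial>lborel)"

lemma conv_integrand_cont:
  assumes "cont3 F" "continuous_on UNIV f" "continuous_on UNIV g"
    "continuous_on S a" "continuous_on S b" "continuous_on S c" "continuous_on S d" "continuous_on S e"
  shows "continuous_on S (\<lambda>v. F (a v) (b v) (c v) * (f (d v) * g (e v)))"
  by (intro continuous_intros cont3D[OF assms(1)] assms
      continuous_on_compose2[OF assms(2), of S d] continuous_on_compose2[OF assms(3), of S e]) auto

lemma kernel_cont: "kernel L f \<Longrightarrow> continuous_on UNIV f"
  by (simp add: kernel_def)

lemma kernel_zero_box:
  assumes "kernel L f" "kernel L g" "\<bar>t - x\<bar> \<le> 1" "\<bar>s - y\<bar> \<le> 1"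
    "w \<notin> cbox (x - L - 1, y - L - 1) (x + L + 1, y + L + 1)"
  shows "f (fst w - t) * g (snd w - s) = 0"
proof -
  have "\<bar>fst w - t\<bar> \<ge> L \<or> \<bar>snd w - s\<bar> \<ge> L"
    using assms(3-5) by (cases w) (auto simp: cbox_Pair_eq)
  then show ?thesis using assms(1,2) by (auto simp: kernel_def)
qed

lemma conv_integrable:
  assumes F: "cont3 F" and k: "kernel L f" "kernel L g"
  shows "integrable lborel (\<lambda>w. F (fst w) (snd w) z * (f (fst w - x) * g (snd w - y)))"
proof (rule compact_support_integral(1))
  show "continuous_on UNIV (\<lambda>w. F (fst w) (snd w) z * (f (fst w - x) * g (snd w - y)))"
    by (rule conv_integrand_cont[OF F kernel_cont[OF k(1)] kernel_cont[OF k(2)]]) (intro continuous_intros)+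
  show "F (fst w) (snd w) z * (f (fst w - x) * g (snd w - y)) = 0"
    if "w \<notin> cbox (x - L - 1, y - L - 1) (x + L + 1, y + L + 1)" for w
    using kernel_zero_box[OF k _ _ that, of x y] by simp
qed

lemma conv_shifted:
  assumes F: "cont3 F" and k: "kernel L f" "kernel L g"
  shows "conv F f g x y z = (\<integral>w. F (x + fst w) (y + snd w) z * (f (fst w) * g (snd w)) \<partial>lborel)"
proof -
  have "continuous_on UNIV (\<lambda>w. F (fst w) (snd w) z * (f (fst w - x) * g (snd w - y)))"
    by (rule conv_integrand_cont[OF F kernel_cont[OF k(1)] kernel_cont[OF k(2)]]) (intro continuous_intros)+
  from lborel_integral_shift[OF this, of "(x, y)"] show ?thesis
    by (simp add: conv_def)
qed

lemma conv_cont: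
  assumes F: "cont3 F" and k: "kernel L f" "kernel L g"
  shows "cont3 (conv F f g)"
proof -
  let ?G = "\<lambda>v w. F (fst v + fst w) (fst (snd v) + snd w) (snd (snd v)) * (f (fst w) * g (snd w))"
  have ci: "continuous_on S (\<lambda>u. F (a u) (b u) (c u) * (f (d u) * g (e u)))"
    if "continuous_on S a" "continuous_on S b" "continuous_on S c" "continuous_on S d" "continuous_on S
        e" for S a b c d e
    by (rule conv_integrand_cont[OF F kernel_cont[OF k(1)] kernel_cont[OF k(2)]]) fact+
  have "continuous_on UNIV (\<lambda>v. integral (cbox (0 - L - 1, 0 - L - 1) (0 + L + 1, 0 + L + 1)) (?G v))"
    by (rule integral_continuous_on_param) (unfold case_prod_beta', rule ci, (intro continuous_intros)+)
  moreover have "integral (cbox (0 - L - 1, 0 - L - 1) (0 + L + 1, 0 + L + 1)) (?G v)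
     = conv F f g (fst v) (fst (snd v)) (snd (snd v))" for v
    unfolding conv_shifted[OF assms]
  proof (rule compact_support_integral(2)[symmetric])
    show "continuous_on UNIV (?G v)" by (rule ci) (intro continuous_intros)+
    show "?G v w = 0" if "w \<notin> cbox (0 - L - 1, 0 - L - 1) (0 + L + 1, 0 + L + 1)" for w
      using kernel_zero_box[OF k _ _ that, of 0 0] by simp
  qed
  ultimately show ?thesis by (simp add: case_prod_beta')
qed

text \<open>
  The integrals are written with the shift in the argument of \<open>F\<close>, so that the kernel is not
  differentiated.
\<close>

lemma conv_deriv_function:
  assumes F: "cont3 F" and k: "kernel L f" "kernel L g"
  shows "(\<And>x y z. ((\<lambda>t. F t y z) has_real_derivative Fx x y z) (at x)) \<Longrightarrow> cont3 Fx \<Longrightarrow>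
      ((\<lambda>t. conv F f g t y z) has_real_derivative conv Fx f g x y z) (at x)"
    and "(\<And>x y z. ((\<lambda>t. F x t z) has_real_derivative Fy x y z) (at y)) \<Longrightarrow> cont3 Fy \<Longrightarrow>
      ((\<lambda>t. conv F f g x t z) has_real_derivative conv Fy f g x y z) (at y)"
    and "(\<And>x y z. ((\<lambda>t. F x y t) has_real_derivative Fz x y z) (at z)) \<Longrightarrow> cont3 Fz \<Longrightarrow>
      ((\<lambda>t. conv F f g x y t) has_real_derivative conv Fz f g x y z) (at z)"
proof -
  have ci: "continuous_on S (\<lambda>u. G (a u) (b u) (c u) * (f (d u) * g (e u)))"
    if "cont3 G" "continuous_on S a" "continuous_on S b" "continuous_on S c" "continuous_on S d"
        "continuous_on S e"
    for S a b c d e G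
    by (rule conv_integrand_cont[OF that(1) kernel_cont[OF k(1)] kernel_cont[OF k(2)]]) fact+
  have sh: "((\<lambda>t. t + c) has_real_derivative 1) (at t)" for c t :: real
    by (auto intro!: derivative_eq_intros)
  let ?a = "(0 - L - 1, 0 - L - 1)" and ?b = "(0 + L + 1, 0 + L + 1)"
  have z: "f (fst w) * g (snd w) = 0" if "w \<notin> cbox ?a ?b" for w
    using kernel_zero_box[OF k _ _ that, of 0 0] by simp
  show "((\<lambda>t. conv F f g t y z) has_real_derivative conv Fx f g x y z) (at x)"
    if d: "\<And>x y z. ((\<lambda>t. F t y z) has_real_derivative Fx x y z) (at x)" and c: "cont3 Fx"
    unfolding conv_shifted[OF F k] conv_shifted[OF c k]
  proof (rule compact_support_integral_deriv[where a = ?a and b = ?b])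
    show "((\<lambda>t. F (t + fst w) (y + snd w) z * (f (fst w) * g (snd w))) has_real_derivative
       Fx (t + fst w) (y + snd w) z * (f (fst w) * g (snd w))) (at t)" for t w
      using DERIV_cmult_right[OF DERIV_chain2[OF d[of "y + snd w" z "t + fst w"] sh]] by simp
    show "continuous_on UNIV (\<lambda>w. F (t + fst w) (y + snd w) z * (f (fst w) * g (snd w)))" for t
      by (rule ci[OF F]) (intro continuous_intros)+
    show "continuous_on UNIV (\<lambda>v. Fx (fst v + fst (snd v)) (y + snd (snd v)) z * (f (fst (snd v)) * g
        (snd (snd v))))"
      by (rule ci[OF c]) (intro continuous_intros)+
    show "F (t + fst w) (y + snd w) z * (f (fst w) * g (snd w)) = 0 \<and> Fx (t + fst w) (y + snd w) z * (f
        (fst w) * g (snd w)) = 0"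
      if "w \<notin> cbox ?a ?b" for t w
      using z[OF that] by simp
  qed
  show "((\<lambda>t. conv F f g x t z) has_real_derivative conv Fy f g x y z) (at y)"
    if d: "\<And>x y z. ((\<lambda>t. F x t z) has_real_derivative Fy x y z) (at y)" and c: "cont3 Fy"
    unfolding conv_shifted[OF F k] conv_shifted[OF c k]
  proof (rule compact_support_integral_deriv[where a = ?a and b = ?b])
    show "((\<lambda>t. F (x + fst w) (t + snd w) z * (f (fst w) * g (snd w))) has_real_derivative
       Fy (x + fst w) (t + snd w) z * (f (fst w) * g (snd w))) (at t)" for t w
      using DERIV_cmult_right[OF DERIV_chain2[OF d[of "x + fst w" z "t + snd w"] sh]] by simp
    show "continuous_on UNIV (\<lambda>w. F (x + fst w) (t + snd w) z * (f (fst w) * g (snd w)))" for t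
      by (rule ci[OF F]) (intro continuous_intros)+
    show "continuous_on UNIV (\<lambda>v. Fy (x + fst (snd v)) (fst v + snd (snd v)) z * (f (fst (snd v)) * g
        (snd (snd v))))"
      by (rule ci[OF c]) (intro continuous_intros)+
    show "F (x + fst w) (t + snd w) z * (f (fst w) * g (snd w)) = 0 \<and> Fy (x + fst w) (t + snd w) z * (f
        (fst w) * g (snd w)) = 0"
      if "w \<notin> cbox ?a ?b" for t w
      using z[OF that] by simp
  qed
  show "((\<lambda>t. conv F f g x y t) has_real_derivative conv Fz f g x y z) (at z)"
    if d: "\<And>x y z. ((\<lambda>t. F x y t) has_real_derivative Fz x y z) (at z)" and c: "cont3 Fz"
    unfolding conv_shifted[OF F k] conv_shifted[OF c k]
  proof (rule compact_support_integral_deriv[where a = ?a and b = ?b])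
    show "((\<lambda>t. F (x + fst w) (y + snd w) t * (f (fst w) * g (snd w))) has_real_derivative
       Fz (x + fst w) (y + snd w) t * (f (fst w) * g (snd w))) (at t)" for t w
      by (rule DERIV_cmult_right[OF d])
    show "continuous_on UNIV (\<lambda>w. F (x + fst w) (y + snd w) t * (f (fst w) * g (snd w)))" for t
      by (rule ci[OF F]) (intro continuous_intros)+
    show "continuous_on UNIV (\<lambda>v. Fz (x + fst (snd v)) (y + snd (snd v)) (fst v) * (f (fst (snd v)) * g
        (snd (snd v))))"
      by (rule ci[OF c]) (intro continuous_intros)+
    show "F (x + fst w) (y + snd w) t * (f (fst w) * g (snd w)) = 0 \<and> Fz (x + fst w) (y + snd w) t * (f
        (fst w) * g (snd w)) = 0"
      if "w \<notin> cbox ?a ?b" for t w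
      using z[OF that] by simp
  qed
qed

lemma conv_deriv_kernel:
  assumes F: "cont3 F" and k: "kernel L f" "kernel L g" "kernel L f'"
    and d: "\<And>x. (f has_real_derivative f' x) (at x)"
  shows "((\<lambda>t. conv F f g t y z) has_real_derivative conv F (\<lambda>x. - f' x) g x y z) (at x)"
    and "((\<lambda>t. conv F g f y t z) has_real_derivative conv F g (\<lambda>x. - f' x) y x z) (at x)"
proof -
  have k': "kernel L (\<lambda>x. - f' x)" using k(3) by (auto simp: kernel_def intro!: continuous_on_minus)
  have c: "continuous_on UNIV f" "continuous_on UNIV g" "continuous_on UNIV (\<lambda>x. - f' x)"
    using k k' kernel_cont by blast+
  have sh: "((\<lambda>t. c - t) has_real_derivative - 1) (at t)" for c t :: real
    by (auto intro!: derivative_eq_intros)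
  have df: "((\<lambda>t. f (c - t)) has_real_derivative - f' (c - t)) (at t)" for c t
    using DERIV_chain2[OF d sh] by simp
  note ci = conv_integrand_cont[OF F]
  show "((\<lambda>t. conv F f g t y z) has_real_derivative conv F (\<lambda>x. - f' x) g x y z) (at x)"
    unfolding conv_def
  proof (rule compact_support_integral_deriv)
    show "((\<lambda>t. F (fst w) (snd w) z * (f (fst w - t) * g (snd w - y))) has_real_derivative
       F (fst w) (snd w) z * (- f' (fst w - t) * g (snd w - y))) (at t)" for t w
      by (rule DERIV_cmult[OF DERIV_cmult_right[OF df]])
    show "F (fst w) (snd w) z * (f (fst w - t) * g (snd w - y)) = 0
      \<and> F (fst w) (snd w) z * (- f' (fst w - t) * g (snd w - y)) = 0"
      if "\<bar>t - x\<bar> \<le> 1" "w \<notin> cbox (x - L - 1, y - L - 1) (x + L + 1, y + L + 1)" for t w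
      using kernel_zero_box[OF k(1,2) that(1) _ that(2), of y] kernel_zero_box[OF k(3,2) that(1) _
          that(2), of y] by simp
    show "continuous_on UNIV (\<lambda>w. F (fst w) (snd w) z * (f (fst w - t) * g (snd w - y)))" for t
      by (rule ci[OF c(1) c(2)]) (intro continuous_intros)+
    show "continuous_on UNIV (\<lambda>v. F (fst (snd v)) (snd (snd v)) z * (- f' (fst (snd v) - fst v) * g (snd
        (snd v) - y)))"
      by (rule ci[OF c(3) c(2)]) (intro continuous_intros)+
  qed
  show "((\<lambda>t. conv F g f y t z) has_real_derivative conv F g (\<lambda>x. - f' x) y x z) (at x)"
    unfolding conv_def
  proof (rule compact_support_integral_deriv)
    show "((\<lambda>t. F (fst w) (snd w) z * (g (fst w - y) * f (snd w - t))) has_real_derivative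
       F (fst w) (snd w) z * (g (fst w - y) * - f' (snd w - t))) (at t)" for t w
      by (rule DERIV_cmult[OF DERIV_cmult[OF df]])
    show "F (fst w) (snd w) z * (g (fst w - y) * f (snd w - t)) = 0
      \<and> F (fst w) (snd w) z * (g (fst w - y) * - f' (snd w - t)) = 0"
      if "\<bar>t - x\<bar> \<le> 1" "w \<notin> cbox (y - L - 1, x - L - 1) (y + L + 1, x + L + 1)" for t w
      using kernel_zero_box[OF k(2,1) _ that(1) that(2), of y] kernel_zero_box[OF k(2,3) _ that(1)
          that(2), of y] by simp
    show "continuous_on UNIV (\<lambda>w. F (fst w) (snd w) z * (g (fst w - y) * f (snd w - t)))" for t
      by (rule ci[OF c(2) c(1)]) (intro continuous_intros)+
    show "continuous_on UNIV (\<lambda>v. F (fst (snd v)) (snd (snd v)) z * (g (fst (snd v) - y) * - f' (snd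
        (snd v) - fst v)))"
      by (rule ci[OF c(2) c(3)]) (intro continuous_intros)+
  qed
qed

text \<open>
  The first derivative of the convolution in \<open>x\<close> can be computed by differentiating \<open>u\<close> or the
  kernel. As derivatives are unique, \<open>conv u f2 g = conv uxx f g\<close>, which replaces integration by
  parts.
\<close>

lemma eigenfunction_conv:
  assumes E: "eigenfunction p q m u ux uxx uy uyy uz uzz"
    and f: "kernel2 L f f1 f2" and g: "kernel2 L g g1 g2"
  shows "eigenfunction p q m (conv u f g) (conv u (\<lambda>x. - f1 x) g) (conv u f2 g)
    (conv u f (\<lambda>x. - g1 x)) (conv u f g2) (conv uz f g) (conv uzz f g)"
proof -
  interpret eigenfunction p q m u ux uxx uy uyy uz uzz by fact
  have kf: "kernel L f" "kernel L f1" "kernel L f2" and kg: "kernel L g" "kernel L g1" "kernel L g2"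
    and d: "\<And>x. (f has_real_derivative f1 x) (at x)" "\<And>x. (f1 has_real_derivative f2 x) (at x)"
      "\<And>x. (g has_real_derivative g1 x) (at x)" "\<And>x. (g1 has_real_derivative g2 x) (at x)"
    using f g by (auto simp: kernel2_def)
  have km: "kernel L (\<lambda>x. - f1 x)" "kernel L (\<lambda>x. - f2 x)" "kernel L (\<lambda>x. - g1 x)" "kernel L (\<lambda>x. - g2 x)"
    using kf kg by (auto simp: kernel_def intro!: continuous_on_minus)
  have dm: "\<And>x. ((\<lambda>x. - f1 x) has_real_derivative - f2 x) (at x)" "\<And>x. ((\<lambda>x. - g1 x) has_real_derivative
      - g2 x) (at x)"
    using d by (auto intro: DERIV_minus)
  have x1: "((\<lambda>t. conv u f g t y z) has_real_derivative conv u (\<lambda>x. - f1 x) g x y z) (at x)"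
    and y1: "((\<lambda>t. conv u f g x t z) has_real_derivative conv u f (\<lambda>x. - g1 x) x y z) (at y)" for x y z
    using conv_deriv_kernel(1)[OF cont(1) kf(1) kg(1) kf(2) d(1)]
      conv_deriv_kernel(2)[OF cont(1) kg(1) kf(1) kg(2) d(3)] by auto
  have x2: "((\<lambda>t. conv u (\<lambda>x. - f1 x) g t y z) has_real_derivative conv u f2 g x y z) (at x)"
    and y2: "((\<lambda>t. conv u f (\<lambda>x. - g1 x) x t z) has_real_derivative conv u f g2 x y z) (at y)" for x y z
    using conv_deriv_kernel(1)[OF cont(1) km(1) kg(1) km(2) dm(1)]
      conv_deriv_kernel(2)[OF cont(1) km(3) kf(1) km(4) dm(2)] by auto
  have x1': "conv u (\<lambda>x. - f1 x) g x y z = conv ux f g x y z" for x y z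
    by (rule DERIV_unique[OF x1 conv_deriv_function(1)[OF cont(1) kf(1) kg(1) dx cont(2)]])
  have y1': "conv u f (\<lambda>x. - g1 x) x y z = conv uy f g x y z" for x y z
    by (rule DERIV_unique[OF y1 conv_deriv_function(2)[OF cont(1) kf(1) kg(1) dy cont(4)]])
  have x2': "conv u f2 g x y z = conv uxx f g x y z" for x y z
    by (rule DERIV_unique[OF x2[unfolded x1'] conv_deriv_function(1)[OF cont(2) kf(1) kg(1) dxx cont(3)]])
  have y2': "conv u f g2 x y z = conv uyy f g x y z" for x y z
    by (rule DERIV_unique[OF y2[unfolded y1'] conv_deriv_function(2)[OF cont(4) kf(1) kg(1) dyy cont(5)]])
  show ?thesis
  proof
    fix x y z
    note int = conv_integrable[OF _ kf(1) kg(1), of _ z x y]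
    have "exp (2 * p * z) * conv uxx f g x y z + exp (- 2 * q * z) * conv uyy f g x y z + conv uzz f g x y z
      = (\<integral>w. exp (2 * p * z) * (uxx (fst w) (snd w) z * (f (fst w - x) * g (snd w - y)))
          + exp (- 2 * q * z) * (uyy (fst w) (snd w) z * (f (fst w - x) * g (snd w - y)))
          + uzz (fst w) (snd w) z * (f (fst w - x) * g (snd w - y)) \<partial>lborel)"
      using int[OF cont(3)] int[OF cont(5)] int[OF cont(7)] by (simp add: conv_def)
    also have "\<dots> = (\<integral>w. m * (u (fst w) (snd w) z * (f (fst w - x) * g (snd w - y))) \<partial>lborel)"
    proof (rule Bochner_Integration.integral_cong[OF refl])
      fix w
      have "exp (2 * p * z) * (uxx (fst w) (snd w) z * (f (fst w - x) * g (snd w - y)))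
          + exp (- 2 * q * z) * (uyy (fst w) (snd w) z * (f (fst w - x) * g (snd w - y)))
          + uzz (fst w) (snd w) z * (f (fst w - x) * g (snd w - y))
        = (exp (2 * p * z) * uxx (fst w) (snd w) z + exp (- 2 * q * z) * uyy (fst w) (snd w) z + uzz
            (fst w) (snd w) z)
           * (f (fst w - x) * g (snd w - y))" by (simp add: algebra_simps)
      then show "exp (2 * p * z) * (uxx (fst w) (snd w) z * (f (fst w - x) * g (snd w - y)))
          + exp (- 2 * q * z) * (uyy (fst w) (snd w) z * (f (fst w - x) * g (snd w - y)))
          + uzz (fst w) (snd w) z * (f (fst w - x) * g (snd w - y))
        = m * (u (fst w) (snd w) z * (f (fst w - x) * g (snd w - y)))"
        unfolding pde by simp
    qed
    finally show "exp (2 * p * z) * conv u f2 g x y z + exp (- 2 * q * z) * conv u f g2 x y z + conv uzz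
        f g x y z
       = m * conv u f g x y z"
      unfolding x2' y2' by (simp add: conv_def)
    show "((\<lambda>t. conv u f g t y z) has_real_derivative conv u (\<lambda>x. - f1 x) g x y z) (at x)" by (rule x1)
    show "((\<lambda>t. conv u (\<lambda>x. - f1 x) g t y z) has_real_derivative conv u f2 g x y z) (at x)" by (rule x2)
    show "((\<lambda>t. conv u f g x t z) has_real_derivative conv u f (\<lambda>x. - g1 x) x y z) (at y)" by (rule y1)
    show "((\<lambda>t. conv u f (\<lambda>x. - g1 x) x t z) has_real_derivative conv u f g2 x y z) (at y)" by (rule y2)
    show "((\<lambda>t. conv u f g x y t) has_real_derivative conv uz f g x y z) (at z)"
      by (rule conv_deriv_function(3)[OF cont(1) kf(1) kg(1) dz cont(6)])
    show "((\<lambda>t. conv uz f g x y t) has_real_derivative conv uzz f g x y z) (at z)"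
      by (rule conv_deriv_function(3)[OF cont(6) kf(1) kg(1) dzz cont(7)])
  next
    show "cont3 (conv u f g)" by (rule conv_cont[OF cont(1) kf(1) kg(1)])
    show "cont3 (conv u (\<lambda>x. - f1 x) g)" by (rule conv_cont[OF cont(1) km(1) kg(1)])
    show "cont3 (conv u f2 g)" by (rule conv_cont[OF cont(1) kf(3) kg(1)])
    show "cont3 (conv u f (\<lambda>x. - g1 x))" by (rule conv_cont[OF cont(1) kf(1) km(3)])
    show "cont3 (conv u f g2)" by (rule conv_cont[OF cont(1) kf(1) kg(3)])
    show "cont3 (conv uz f g)" by (rule conv_cont[OF cont(6) kf(1) kg(1)])
    show "cont3 (conv uzz f g)" by (rule conv_cont[OF cont(7) kf(1) kg(1)])
  qed
qed

lemma conv_nonneg: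
  assumes "\<And>x y z. 0 \<le> u x y z" "\<And>x. 0 \<le> f x" "\<And>x. 0 \<le> g x"
  shows "0 \<le> conv u f g x y z"
  unfolding conv_def using assms by (intro Bochner_Integration.integral_nonneg) auto

text \<open>
  Pointwise inequalities between product kernels pass to convolutions of nonnegative functions. The third kernel
  accommodates error terms.
\<close>

lemma conv_ineq:
  assumes u: "cont3 u" "\<And>x y z. 0 \<le> u x y z"
    and k: "kernel L f" "kernel L g" "kernel L f'" "kernel L g'" "kernel L h" "kernel L l"
    and le: "\<And>a b. \<alpha> * (f a * g b) \<le> f' a * g' b + \<beta> * (h a * l b)"
  shows "\<alpha> * conv u f g x y z \<le> conv u f' g' x y z + \<beta> * conv u h l x y z"
proof -
  note i1 = conv_integrable[OF u(1) k(1,2), of z x y] and i2 = conv_integrable[OF u(1) k(3,4), of z x y]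
    and i3 = conv_integrable[OF u(1) k(5,6), of z x y]
  have "\<alpha> * conv u f g x y z = (\<integral>w. \<alpha> * (u (fst w) (snd w) z * (f (fst w - x) * g (snd w - y))) \<partial>lborel)"
    by (simp add: conv_def)
  also have "\<dots> \<le> (\<integral>w. u (fst w) (snd w) z * (f' (fst w - x) * g' (snd w - y))
      + \<beta> * (u (fst w) (snd w) z * (h (fst w - x) * l (snd w - y))) \<partial>lborel)"
  proof (rule integral_mono)
    fix w
    have "u (fst w) (snd w) z * (\<alpha> * (f (fst w - x) * g (snd w - y)))
      \<le> u (fst w) (snd w) z * (f' (fst w - x) * g' (snd w - y) + \<beta> * (h (fst w - x) * l (snd w - y)))"
      by (rule mult_left_mono[OF le u(2)])
    then show "\<alpha> * (u (fst w) (snd w) z * (f (fst w - x) * g (snd w - y)))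
      \<le> u (fst w) (snd w) z * (f' (fst w - x) * g' (snd w - y)) + \<beta> * (u (fst w) (snd w) z * (h (fst w -
          x) * l (snd w - y)))"
      by (simp add: algebra_simps)
  qed (intro Bochner_Integration.integrable_add integrable_mult_right i1 i2 i3)+
  also have "\<dots> = conv u f' g' x y z + \<beta> * conv u h l x y z"
    using i2 i3 by (simp add: conv_def)
  finally show ?thesis .
qed

lemma conv_swap:
  assumes "cont3 u" "kernel L f" "kernel L g"
  shows "conv (\<lambda>x y z. u y x (- z)) g f y x z = conv u f g x y (- z)"
proof -
  let ?H = "\<lambda>w. u (fst w) (snd w) (- z) * (f (fst w - x) * g (snd w - y))"
  have H: "?H \<in> borel_measurable (lborel \<Otimes>\<^sub>M lborel)"
    using borel_measurable_integrable[OF conv_integrable[OF assms, of "- z" x y]] by (simp add: lborel_prod)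
  have "(\<integral>w. ?H w \<partial>(lborel \<Otimes>\<^sub>M lborel)) = (\<integral>w. (\<lambda>(a, b). ?H (b, a)) w \<partial>(lborel \<Otimes>\<^sub>M lborel))"
    by (rule lborel_pair.integral_product_swap[OF H, symmetric])
  then show ?thesis
    by (simp add: conv_def lborel_prod case_prod_beta' mult.commute)
qed

section \<open>Truncated powers of the hyperbolic secant\<close>

definition sech :: "real \<Rightarrow> real \<Rightarrow> real" where "sech k x = 1 / cosh (k * x)"
definition sech1 :: "real \<Rightarrow> real \<Rightarrow> real" where "sech1 k x = - k * (sinh (k * x) / (cosh (k * x))\<^sup>2)"
definition sech2 :: "real \<Rightarrow> real \<Rightarrow> real" where "sech2 k x = k\<^sup>2 * (sech k x - 2 * sech k x ^ 3)"

text \<open>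
  The cube of the positive part of \<open>sech k x - e\<close> is of class $C^2$ and has compact support for
  \<open>e > 0\<close>; the value \<open>e = 0\<close> gives the kernel $\cosh^{-3}(kx)$ itself.
\<close>

definition cut_sech :: "real \<Rightarrow> real \<Rightarrow> real \<Rightarrow> real" where
  "cut_sech k e x = max 0 (sech k x - e) ^ 3"
definition cut_sech1 :: "real \<Rightarrow> real \<Rightarrow> real \<Rightarrow> real" where
  "cut_sech1 k e x = 3 * max 0 (sech k x - e) ^ 2 * sech1 k x"
definition cut_sech2 :: "real \<Rightarrow> real \<Rightarrow> real \<Rightarrow> real" where
  "cut_sech2 k e x = 6 * max 0 (sech k x - e) * (sech1 k x)\<^sup>2 + 3 * max 0 (sech k x - e) ^ 2 * sech2 k x"

lemma sech_bounds: "0 < sech k x" "sech k x \<le> 1"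
  using cosh_real_ge_1[of "k * x"] by (auto simp: sech_def cosh_real_pos)

lemma sech_deriv:
  "(sech k has_real_derivative sech1 k x) (at x)"
  "(sech1 k has_real_derivative sech2 k x) (at x)"
proof -
  let ?c = "cosh (k * x)" and ?s = "sinh (k * x)"
  have c: "?c > 0" by (rule cosh_real_pos)
  have kx: "((\<lambda>x. k * x) has_real_derivative k) (at x)" by (auto intro!: derivative_eq_intros)
  have dc: "((\<lambda>x. cosh (k * x)) has_real_derivative ?s * k) (at x)"
    and ds: "((\<lambda>x. sinh (k * x)) has_real_derivative ?c * k) (at x)"
    by (auto intro!: derivative_eq_intros)
  have "((\<lambda>x. 1 / cosh (k * x)) has_real_derivative (0 * ?c - 1 * (?s * k)) / (?c * ?c)) (at x)"
    using c by (intro DERIV_divide DERIV_const dc) auto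
  then show "(sech k has_real_derivative sech1 k x) (at x)"
    by (simp add: sech_def[abs_def] sech1_def power2_eq_square mult.commute)
  have "((\<lambda>x. - k * (sinh (k * x) / (cosh (k * x))\<^sup>2)) has_real_derivative
      - k * (((?c * k) * ?c\<^sup>2 - ?s * (of_nat 2 * (?s * k * ?c ^ (2 - Suc 0)))) / (?c\<^sup>2 * ?c\<^sup>2))) (at x)"
    using c by (intro DERIV_cmult DERIV_divide DERIV_power dc ds) auto
  moreover have "- k * (((?c * k) * ?c\<^sup>2 - ?s * (of_nat 2 * (?s * k * ?c ^ (2 - Suc 0)))) / (?c\<^sup>2 *
      ?c\<^sup>2)) = sech2 k x"
  proof -
    have "- k * (((?c * k) * ?c\<^sup>2 - ?s * (of_nat 2 * (?s * k * ?c ^ (2 - Suc 0)))) / (?c\<^sup>2 * ?c\<^sup>2))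
       = - k\<^sup>2 * (?c ^ 3 - 2 * ?s\<^sup>2 * ?c) / ?c ^ 4"
      by (simp add: power2_eq_square power3_eq_cube power4_eq_xxxx algebra_simps)
    also have "?s\<^sup>2 = ?c\<^sup>2 - 1" by (simp add: cosh_square_eq)
    also have "- k\<^sup>2 * (?c ^ 3 - 2 * (?c\<^sup>2 - 1) * ?c) / ?c ^ 4 = sech2 k x"
      unfolding sech2_def sech_def using c
      by (simp add: field_simps power2_eq_square power3_eq_cube power4_eq_xxxx)
    finally show ?thesis .
  qed
  ultimately show "(sech1 k has_real_derivative sech2 k x) (at x)"
    by (simp add: sech1_def[abs_def])
qed

lemma sech1_square: "(sech1 k x)\<^sup>2 = k\<^sup>2 * ((sech k x)\<^sup>2 - sech k x ^ 4)"
proof -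
  have c: "cosh (k * x) > 0" by (rule cosh_real_pos)
  have "(sech1 k x)\<^sup>2 = k\<^sup>2 * (sinh (k * x))\<^sup>2 / (cosh (k * x)) ^ 4"
    by (simp add: sech1_def power_mult_distrib power_divide flip: power_mult)
  also have "(sinh (k * x))\<^sup>2 = (cosh (k * x))\<^sup>2 - 1" by (simp add: cosh_square_eq)
  also have "k\<^sup>2 * ((cosh (k * x))\<^sup>2 - 1) / (cosh (k * x)) ^ 4 = k\<^sup>2 * ((sech k x)\<^sup>2 - sech k x ^ 4)"
    using c by (simp add: sech_def field_simps power2_eq_square power4_eq_xxxx)
  finally show ?thesis .
qed

lemma sech_derivs_bounds:
  assumes "k \<ge> 0"
  shows "\<bar>sech1 k x\<bar> \<le> k * sech k x" "\<bar>sech2 k x\<bar> \<le> k\<^sup>2 * sech k x" "(sech1 k x)\<^sup>2 \<le> k\<^sup>2 * (sech k x)\<^sup>2"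
proof -
  note b = sech_bounds[of k x]
  show 1: "(sech1 k x)\<^sup>2 \<le> k\<^sup>2 * (sech k x)\<^sup>2"
    unfolding sech1_square by (intro mult_left_mono) auto
  then have "(sech1 k x)\<^sup>2 \<le> (k * sech k x)\<^sup>2" by (simp add: power_mult_distrib)
  then show "\<bar>sech1 k x\<bar> \<le> k * sech k x"
    using assms b by (metis abs_le_square_iff abs_of_nonneg less_imp_le mult_nonneg_nonneg)
  have "sech k x ^ 3 \<le> sech k x ^ 1" using b by (intro power_decreasing) auto
  moreover have "0 \<le> sech k x ^ 3" using b by simp
  ultimately have "\<bar>sech k x - 2 * sech k x ^ 3\<bar> \<le> sech k x" by (auto simp: abs_le_iff)
  then show "\<bar>sech2 k x\<bar> \<le> k\<^sup>2 * sech k x" by (simp add: sech2_def abs_mult mult_left_mono)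
qed

lemma cut_sech_kernel:
  assumes k: "k > 0" and e: "e > 0" and L: "L \<ge> 2 / (k * e)"
  shows "kernel2 L (cut_sech k e) (cut_sech1 k e) (cut_sech2 k e)"
proof -
  have z: "max 0 (sech k x - e) = 0" if "\<bar>x\<bar> \<ge> L" for x
  proof -
    have "2 / (k * e) \<le> \<bar>x\<bar>" using L that by simp
    then have "2 \<le> \<bar>x\<bar> * (k * e)" using k e by (simp add: pos_divide_le_eq)
    then have "1 / e \<le> \<bar>k * x\<bar> / 2" using k e by (simp add: field_simps abs_mult)
    also have "\<dots> \<le> exp \<bar>k * x\<bar> / 2" using exp_ge_add_one_self[of "\<bar>k * x\<bar>"] by linarith
    also have "\<dots> \<le> cosh \<bar>k * x\<bar>" unfolding cosh_def by simp
    also have "\<dots> = cosh (k * x)" by (rule cosh_real_abs)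
    finally have "1 / cosh (k * x) \<le> e" using e cosh_real_pos[of "k * x"] by (simp add: field_simps)
    then show ?thesis by (simp add: sech_def)
  qed
  have cs: "continuous_on UNIV (sech k)" "continuous_on UNIV (sech1 k)"
    using sech_deriv by (auto intro!: continuous_at_imp_continuous_on DERIV_isCont)
  have cs2: "continuous_on UNIV (sech2 k)"
    unfolding sech2_def by (intro continuous_intros cs)
  have p3: "((\<lambda>t. max 0 t ^ 3) has_real_derivative 3 * max 0 t ^ 2) (at t)" for t :: real
    using pos_part_power_deriv[of 1 t] by (simp add: numeral_3_eq_3 numeral_2_eq_2)
  have p2: "((\<lambda>t. max 0 t ^ 2) has_real_derivative 2 * max 0 t) (at t)" for t :: real
    using pos_part_power_deriv[of 0 t] by (simp add: numeral_2_eq_2)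
  have s: "((\<lambda>x. sech k x - e) has_real_derivative sech1 k x) (at x)" for x
    using DERIV_diff[OF sech_deriv(1) DERIV_const] by simp
  have "(cut_sech k e has_real_derivative cut_sech1 k e x) (at x)" for x
    unfolding cut_sech_def[abs_def] cut_sech1_def by (rule DERIV_chain2[OF p3 s])
  moreover have "(cut_sech1 k e has_real_derivative cut_sech2 k e x) (at x)" for x
  proof -
    have "((\<lambda>x. 3 * max 0 (sech k x - e) ^ 2 * sech1 k x) has_real_derivative
        3 * (2 * max 0 (sech k x - e) * sech1 k x) * sech1 k x + sech2 k x * (3 * max 0 (sech k x - e) ^
            2)) (at x)"
      by (intro DERIV_mult DERIV_cmult DERIV_chain2[OF p2 s] sech_deriv)
    then show ?thesis
      by (simp add: cut_sech1_def[abs_def] cut_sech2_def power2_eq_square mult_ac)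
  qed
  ultimately show ?thesis
    unfolding kernel2_def kernel_def cut_sech_def cut_sech1_def cut_sech2_def
    using z by (auto intro!: continuous_intros cs cs2)
qed

text \<open>
  For \<open>e\<close> up to half of the minimum of \<open>sech k\<close> on $[-1,1]$ the truncation removes at most half of
  \<open>sech k\<close> there.
\<close>

definition cut_level :: "real \<Rightarrow> real" where "cut_level k = 1 / (2 * cosh k)"

lemma cut_level_pos: "cut_level k > 0" by (simp add: cut_level_def cosh_real_pos)

lemma cut_sech_bounds:
  assumes e: "e \<ge> 0"
  shows "0 \<le> cut_sech k e x" "cut_sech k e x \<le> sech k x ^ 3"
  using e sech_bounds[of k x] by (auto simp: cut_sech_def intro!: power_mono)

lemma cut_sech_center:
  assumes k: "k \<ge> 0" and e: "0 < e" "e \<le> cut_level k" and x: "\<bar>x\<bar> \<le> 1"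
  shows "max 0 (sech k x - e) \<ge> sech k x / 2" "cut_sech k e x \<ge> cut_level k ^ 3"
proof -
  have "\<bar>k * x\<bar> \<le> k * 1" using k x by (simp add: abs_mult mult_left_le)
  then have "cosh (k * x) \<le> cosh k" using k by (metis abs_of_nonneg cosh_real_abs
      cosh_real_nonneg_le_iff abs_ge_zero mult_1_right)
  then have "1 / cosh k \<le> sech k x" using cosh_real_pos[of "k * x"] by (simp add: sech_def frac_le)
  then have "2 * cut_level k \<le> sech k x" by (simp add: cut_level_def)
  then show 1: "max 0 (sech k x - e) \<ge> sech k x / 2" and "cut_sech k e x \<ge> cut_level k ^ 3"
    using e cut_level_pos[of k] by (auto simp: cut_sech_def intro!: power_mono)
qed

lemma cut_sech2_lower_outside:
  assumes k: "k \<ge> 2" and e: "e > 0" and x: "\<bar>x\<bar> \<ge> 1"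
  shows "cut_sech2 k e x \<ge> 3 / 2 * k\<^sup>2 * cut_sech k e x"
proof -
  define s where "s = max 0 (sech k x - e)"
  have s: "0 \<le> s" "s \<le> sech k x" using e sech_bounds[of k x] by (auto simp: s_def)
  have "2 \<le> \<bar>k * x\<bar>" using k x mult_mono[of 2 k 1 "\<bar>x\<bar>"] by (simp add: abs_mult)
  then have "exp 2 \<le> exp \<bar>k * x\<bar>" by simp
  moreover have "exp (2::real) \<ge> 4"
  proof -
    have "exp (1::real) \<ge> 2" using exp_ge_add_one_self[of 1] by simp
    then have "exp (1::real) * exp 1 \<ge> 2 * 2" by (intro mult_mono) auto
    then show ?thesis by (simp add: exp_add[symmetric])
  qed
  moreover have "exp \<bar>k * x\<bar> / 2 \<le> cosh \<bar>k * x\<bar>" unfolding cosh_def by simp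
  ultimately have "2 \<le> cosh (k * x)" unfolding cosh_real_abs by linarith
  then have h: "sech k x \<le> 1 / 2" by (simp add: sech_def field_simps)
  have "sech k x * sech k x \<le> 1 / 2 * (1 / 2)" using h sech_bounds[of k x] by (intro mult_mono) auto
  then have "sech k x * (2 * (sech k x * sech k x)) \<le> sech k x * (1 / 2)"
    using sech_bounds[of k x] by (intro mult_left_mono) auto
  then have "sech k x - 2 * sech k x ^ 3 \<ge> sech k x / 2"
    by (simp add: power3_eq_cube mult_ac)
  then have "sech2 k x \<ge> k\<^sup>2 * (s / 2)"
    unfolding sech2_def using s by (intro mult_left_mono) auto
  then have "3 * s\<^sup>2 * sech2 k x \<ge> 3 * s\<^sup>2 * (k\<^sup>2 * (s / 2))" by (intro mult_left_mono) auto
  moreover have "0 \<le> 6 * s * (sech1 k x)\<^sup>2" using s by simp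
  ultimately show ?thesis
    unfolding cut_sech2_def cut_sech_def s_def[symmetric] by (simp add: power2_eq_square power3_eq_cube)
qed

lemma cut_sech2_lower_inside:
  assumes k: "k \<ge> 0" and e: "0 < e" "e \<le> cut_level k" and x: "\<bar>x\<bar> \<le> 1"
  shows "cut_sech2 k e x \<ge> - (6 * k\<^sup>2) * cut_sech k e x"
proof -
  define s where "s = max 0 (sech k x - e)"
  have s: "0 \<le> s" "sech k x \<le> 2 * s" using cut_sech_center(1)[OF assms] by (auto simp: s_def)
  have "sech2 k x \<ge> - (k\<^sup>2 * sech k x)" using sech_derivs_bounds(2)[OF k, of x] by (simp add: abs_le_iff)
  moreover have "k\<^sup>2 * sech k x \<le> k\<^sup>2 * (2 * s)" using s by (intro mult_left_mono) auto
  ultimately have "sech2 k x \<ge> - (k\<^sup>2 * (2 * s))" by linarith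
  then have "3 * s\<^sup>2 * sech2 k x \<ge> 3 * s\<^sup>2 * - (k\<^sup>2 * (2 * s))" by (intro mult_left_mono) auto
  moreover have "0 \<le> 6 * s * (sech1 k x)\<^sup>2" using s by simp
  ultimately show ?thesis
    unfolding cut_sech2_def cut_sech_def s_def[symmetric] by (simp add: power2_eq_square power3_eq_cube)
qed

text \<open>
  The estimates do not depend on the truncation level \<open>e\<close>. Outside of $[-1,1]$ the second derivative
  dominates a multiple of \<open>k\<^sup>2\<close> times the function, by convexity of the tail. Inside, the error is absorbed by a fixed
  bump which does not depend on \<open>k\<close>.
\<close>

lemma cut_sech2_lower:
  assumes k: "k \<ge> 2" and e: "0 < e" "e \<le> cut_level k"
  shows "- (6 * k\<^sup>2) * cut_sech k e x \<le> cut_sech2 k e x"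
    and "3 / 2 * k\<^sup>2 * cut_sech k e x \<le> cut_sech2 k e x + 15 / 2 * k\<^sup>2 / cut_level 2 ^ 3 * cut_sech 2
        (cut_level 2) x"
proof -
  have t: "0 \<le> cut_sech k e x" "cut_sech k e x \<le> 1" "0 \<le> cut_sech 2 (cut_level 2) x"
    using cut_sech_bounds[of e k x] cut_sech_bounds[of "cut_level 2" 2 x] e cut_level_pos[of 2]
        sech_bounds[of k x]
    by (auto intro: order_trans[OF _ power_le_one[of "sech k x" 3]])
  have i: "- (6 * k\<^sup>2) * cut_sech k e x \<le> cut_sech2 k e x" if "\<bar>x\<bar> \<le> 1"
    using cut_sech2_lower_inside[of k e x] k e that by simp
  have o: "3 / 2 * k\<^sup>2 * cut_sech k e x \<le> cut_sech2 k e x" if "\<bar>x\<bar> \<ge> 1"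
    using cut_sech2_lower_outside[of k e x] k e that by simp
  have kt: "0 \<le> k\<^sup>2 * cut_sech k e x" using t by simp
  show "- (6 * k\<^sup>2) * cut_sech k e x \<le> cut_sech2 k e x"
    using i o kt by (cases "\<bar>x\<bar> \<le> 1") auto
  show "3 / 2 * k\<^sup>2 * cut_sech k e x \<le> cut_sech2 k e x + 15 / 2 * k\<^sup>2 / cut_level 2 ^ 3 * cut_sech 2
      (cut_level 2) x"
  proof (cases "\<bar>x\<bar> \<le> 1")
    case True
    have "cut_level 2 ^ 3 \<le> cut_sech 2 (cut_level 2) x" using cut_sech_center(2)[of 2 "cut_level 2" x]
        True cut_level_pos by simp
    then have "1 \<le> cut_sech 2 (cut_level 2) x / cut_level 2 ^ 3" using cut_level_pos[of 2] by simp
    then have "15 / 2 * k\<^sup>2 * cut_sech k e x \<le> 15 / 2 * k\<^sup>2 * (cut_sech 2 (cut_level 2) x / cut_level 2 ^ 3)"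
      using t by (intro mult_left_mono) auto
    then show ?thesis using i[OF True] by simp
  next
    case False
    then show ?thesis using o t cut_level_pos[of 2] by (simp add: add_increasing2)
  qed
qed

lemma cut_sech_antimono: "e \<le> d \<Longrightarrow> cut_sech k d x \<le> cut_sech k e x"
  unfolding cut_sech_def by (intro power_mono) auto

lemma sech_antimono:
  assumes "0 \<le> k" "k \<le> l"
  shows "sech l x \<le> sech k x"
proof -
  have "cosh \<bar>k * x\<bar> \<le> cosh \<bar>l * x\<bar>"
    using assms by (subst cosh_real_nonneg_le_iff) (auto simp: abs_mult mult_right_mono)
  then show ?thesis unfolding cosh_real_abs sech_def by (simp add: frac_le cosh_real_pos)
qed

lemma sech_cont: "continuous_on S (sech k)"
  by (rule continuous_on_subset[of UNIV])
     (auto intro!: continuous_at_imp_continuous_on DERIV_isCont[OF sech_deriv(1)])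

lemma cut_sech_tendsto:
  assumes "e \<longlonglongrightarrow> 0"
  shows "(\<lambda>n. cut_sech k (e n) x) \<longlonglongrightarrow> sech k x ^ 3"
proof -
  have "(\<lambda>n. cut_sech k (e n) x) \<longlonglongrightarrow> max 0 (sech k x - 0) ^ 3"
    unfolding cut_sech_def by (intro tendsto_intros assms)
  then show ?thesis using sech_bounds[of k x] by simp
qed

section \<open>Convergence of the convolution\<close>

locale pos_eigenfunction = eigenfunction +
  assumes p: "p > 0" and q: "q > 0" and m: "m \<ge> 0" and nonneg: "\<And>x y z. 0 \<le> u x y z"
begin

lemma swapped:
  "pos_eigenfunction q p m (\<lambda>x y z. u y x (- z)) (\<lambda>x y z. uy y x (- z)) (\<lambda>x y z. uyy y x (- z))
    (\<lambda>x y z. ux y x (- z)) (\<lambda>x y z. uxx y x (- z)) (\<lambda>x y z. - uz y x (- z)) (\<lambda>x y z. uzz y x (- z))"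
  by (intro pos_eigenfunction.intro eigenfunction_swap pos_eigenfunction_axioms.intro p q m nonneg)
      (rule eigenfunction_axioms)

context
  fixes L f f1 f2 g g1 g2 Cf Cg
  assumes f: "kernel2 L f f1 f2" and g: "kernel2 L g g1 g2"
    and f0: "\<And>x. 0 \<le> f x" and g0: "\<And>x. 0 \<le> g x" and Cf: "Cf \<ge> 0" and Cg: "Cg \<ge> 0"
    and fl: "\<And>x. - Cf * f x \<le> f2 x" and gl: "\<And>x. - Cg * g x \<le> g2 x"
begin

lemma kernels: "kernel L f" "kernel L f1" "kernel L f2" "kernel L g" "kernel L g1" "kernel L g2"
  using f g by (auto simp: kernel2_def)

interpretation A: eigenfunction p q m "conv u f g" "conv u (\<lambda>x. - f1 x) g" "conv u f2 g"
    "conv u f (\<lambda>x. - g1 x)" "conv u f g2" "conv uz f g" "conv uzz f g"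
  by (rule eigenfunction_conv[OF eigenfunction_axioms f g])

lemma smoothed_nonneg: "0 \<le> conv u f g x y z"
  using nonneg f0 g0 by (rule conv_nonneg)

lemma conv_snd_lower: "- Cg * conv u f g x y z \<le> conv u f g2 x y z"
proof -
  have "- Cg * conv u f g x y z \<le> conv u f g2 x y z + 0 * conv u f g x y z"
  proof (rule conv_ineq[OF cont(1) nonneg])
    fix a b
    show "- Cg * (f a * g b) \<le> f a * g2 b + 0 * (f a * g b)"
      using mult_left_mono[OF gl[of b] f0[of a]] by (simp add: mult_ac)
  qed (rule kernels)+
  then show ?thesis by simp
qed

lemma conv_fst_lower: "- Cf * conv u f g x y z \<le> conv u f2 g x y z"
proof -
  have "- Cf * conv u f g x y z \<le> conv u f2 g x y z + 0 * conv u f g x y z"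
  proof (rule conv_ineq[OF cont(1) nonneg])
    fix a b
    show "- Cf * (f a * g b) \<le> f2 a * g b + 0 * (f a * g b)"
      using mult_right_mono[OF fl[of a] g0[of b]] by (simp add: mult_ac)
  qed (rule kernels)+
  then show ?thesis by simp
qed

lemma exp_bounds:
  assumes "\<bar>z\<bar> \<le> R"
  shows "exp (2 * p * z) \<le> exp (2 * p * R)" "exp (- (2 * p * R)) \<le> exp (2 * p * z)"
    "exp (- 2 * q * z) \<le> exp (2 * q * R)"
proof -
  have "p * z \<le> p * R" "- (p * R) \<le> p * z" "- (q * z) \<le> q * R"
    using assms p q mult_left_mono[of z R p] mult_left_mono[of "- R" z p] mult_left_mono[of "- z" R q] by auto
  then show "exp (2 * p * z) \<le> exp (2 * p * R)" "exp (- (2 * p * R)) \<le> exp (2 * p * z)"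
    "exp (- 2 * q * z) \<le> exp (2 * q * R)" by (simp_all add: algebra_simps)
qed

lemma conv_zz_upper:
  assumes z: "\<bar>z\<bar> \<le> R"
  shows "conv uzz f g x y z \<le> (m + Cf * exp (2 * p * R) + Cg * exp (2 * q * R)) * conv u f g x y z"
proof -
  note e = exp_bounds[OF z]
  have 1: "- (exp (2 * p * z) * conv u f2 g x y z) \<le> exp (2 * p * R) * (Cf * conv u f g x y z)"
  proof -
    have "exp (2 * p * z) * - conv u f2 g x y z \<le> exp (2 * p * z) * (Cf * conv u f g x y z)"
      using conv_fst_lower[of x y z] by (intro mult_left_mono) auto
    also have "\<dots> \<le> exp (2 * p * R) * (Cf * conv u f g x y z)"
      using e Cf smoothed_nonneg by (intro mult_right_mono) auto
    finally show ?thesis by simp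
  qed
  have 2: "- (exp (- 2 * q * z) * conv u f g2 x y z) \<le> exp (2 * q * R) * (Cg * conv u f g x y z)"
  proof -
    have "exp (- 2 * q * z) * - conv u f g2 x y z \<le> exp (- 2 * q * z) * (Cg * conv u f g x y z)"
      using conv_snd_lower[of x y z] by (intro mult_left_mono) auto
    also have "\<dots> \<le> exp (2 * q * R) * (Cg * conv u f g x y z)"
      using e Cg smoothed_nonneg by (intro mult_right_mono) auto
    finally show ?thesis by simp
  qed
  show ?thesis using 1 2 A.pde[of z x y] by (simp add: algebra_simps)
qed

text \<open>
  Only one-sided bounds for the second derivatives of the kernels enter. Together they give
  $A''\le D^2A$ for $A(z)=\int u f g$, where \<open>D\<close> depends on these bounds, on the equation and on the height, but not on the kernels.
\<close>

lemma conv_vertical_harnack: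
  assumes z: "\<bar>z\<bar> \<le> R"
  shows "conv u f g x y z
     \<le> exp ((sqrt (m + Cf * exp (2 * p * (R + 1)) + Cg * exp (2 * q * (R + 1)) + 1) + 1) * R) * conv u f
         g x y 0"
proof -
  define D where "D = sqrt (m + Cf * exp (2 * p * (R + 1)) + Cg * exp (2 * q * (R + 1)) + 1)"
  have D2: "D\<^sup>2 = m + Cf * exp (2 * p * (R + 1)) + Cg * exp (2 * q * (R + 1)) + 1"
    using m Cf Cg by (simp add: D_def)
  have D: "D > 0" using m Cf Cg by (simp add: D_def add_nonneg_pos)
  have zz: "conv uzz f g x y t \<le> D\<^sup>2 * conv u f g x y t" if "\<bar>t\<bar> \<le> R + 1" for t
  proof -
    have "conv uzz f g x y t \<le> (D\<^sup>2 - 1) * conv u f g x y t"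
      using conv_zz_upper[OF that] unfolding D2 by simp
    also have "\<dots> \<le> D\<^sup>2 * conv u f g x y t" using smoothed_nonneg by (intro mult_right_mono) auto
    finally show ?thesis .
  qed
  have lo: "- (D + 1) * conv u f g x y t \<le> conv uz f g x y t" if "\<bar>t\<bar> \<le> R" for t
    by (rule log_derivative_lower[OF D, where A = "\<lambda>z. conv u f g x y z" and ?A1.0 = "\<lambda>z. conv uz f g x y z"
          and ?A2.0 = "\<lambda>z. conv uzz f g x y z"])
       (use that in \<open>auto intro!: A.dz A.dzz smoothed_nonneg zz\<close>)
  have up: "conv uz f g x y t \<le> (D + 1) * conv u f g x y t" if "\<bar>t\<bar> \<le> R" for t
    by (rule log_derivative_upper[OF D, where A = "\<lambda>z. conv u f g x y z" and ?A1.0 = "\<lambda>z. conv uz f g x y z"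
          and ?A2.0 = "\<lambda>z. conv uzz f g x y z"])
       (use that in \<open>auto intro!: A.dz A.dzz smoothed_nonneg zz\<close>)
  have "conv u f g x y z \<le> exp ((D + 1) * \<bar>z\<bar>) * conv u f g x y 0"
  proof (cases "z \<ge> 0")
    case True
    have "conv u f g x y z \<le> exp ((D + 1) * (z - 0)) * conv u f g x y 0"
      by (rule gronwall_upper[where A = "\<lambda>z. conv u f g x y z" and ?A1.0 = "\<lambda>z. conv uz f g x y z"])
         (use True z up in \<open>auto intro!: A.dz\<close>)
    then show ?thesis using True by simp
  next
    case False
    have "conv u f g x y z \<le> exp ((D + 1) * (0 - z)) * conv u f g x y 0"
      by (rule gronwall_lower[where A = "\<lambda>z. conv u f g x y z" and ?A1.0 = "\<lambda>z. conv uz f g x y z"])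
         (use False z lo in \<open>auto intro!: A.dz\<close>)
    then show ?thesis using False by simp
  qed
  also have "\<dots> \<le> exp ((D + 1) * R) * conv u f g x y 0"
    using z D smoothed_nonneg by (intro mult_right_mono) auto
  finally show ?thesis by (simp add: D_def)
qed

text \<open>
  If $f''\ge\alpha f$ up to a multiple of \<open>fs\<close>, with \<open>\<alpha>\<close> large enough to beat all other terms of the
  equation, then the mean with respect to \<open>f\<close> is controlled by the mean with respect to \<open>fs\<close>.
\<close>

lemma conv_absorb_fst:
  assumes fs: "kernel L fs" and \<beta>: "\<beta> \<ge> 0" and \<alpha>: "\<alpha> \<ge> 0"
    and strong: "\<And>x. \<alpha> * f x \<le> f2 x + \<beta> * fs x"
    and large: "\<alpha> * exp (- (2 * p)) \<ge> m + Cg * exp (2 * q) + 17"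
    and B: "\<And>z. \<bar>z\<bar> \<le> 1 \<Longrightarrow> conv u fs g x y z \<le> B" "B \<ge> 0"
  shows "conv u f g x y 0 \<le> exp (sqrt (m + Cf * exp (2 * p * 2) + Cg * exp (2 * q * 2) + 1) + 1) * (\<beta> *
      exp (2 * p) * B)"
proof -
  define D where "D = sqrt (m + Cf * exp (2 * p * 2) + Cg * exp (2 * q * 2) + 1)"
  have D2: "D\<^sup>2 = m + Cf * exp (2 * p * 2) + Cg * exp (2 * q * 2) + 1"
    using m Cf Cg by (simp add: D_def)
  have D: "D > 0" using m Cf Cg by (simp add: D_def add_nonneg_pos)
  have "conv u f g x y 0 \<le> exp (D + 1) * (\<beta> * exp (2 * p) * B)"
  proof (rule interval_sturm_bound[OF D, where A = "\<lambda>z. conv u f g x y z" and ?A1.0 = "\<lambda>z. conv uz f g x y z"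
          and ?A2.0 = "\<lambda>z. conv uzz f g x y z"])
    fix z :: real
    show "0 \<le> conv u f g x y z" by (rule smoothed_nonneg)
    show "((\<lambda>z. conv u f g x y z) has_real_derivative conv uz f g x y z) (at z)" by (rule A.dz)
    show "((\<lambda>z. conv uz f g x y z) has_real_derivative conv uzz f g x y z) (at z)" by (rule A.dzz)
    show "conv uzz f g x y z \<le> D\<^sup>2 * conv u f g x y z" if "\<bar>z\<bar> \<le> 2"
    proof -
      have "conv uzz f g x y z \<le> (D\<^sup>2 - 1) * conv u f g x y z"
        using conv_zz_upper[OF that] unfolding D2 by simp
      also have "\<dots> \<le> D\<^sup>2 * conv u f g x y z" using smoothed_nonneg by (intro mult_right_mono) auto
      finally show ?thesis .
    qed
    show "conv uzz f g x y z \<le> - 17 * conv u f g x y z + \<beta> * exp (2 * p) * B" if z: "\<bar>z\<bar> \<le> 1"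
    proof -
      let ?A = "conv u f g x y z"
      note e = exp_bounds[OF z, unfolded mult_1_right]
      have "\<alpha> * ?A \<le> conv u f2 g x y z + \<beta> * conv u fs g x y z"
      proof (rule conv_ineq[OF cont(1) nonneg])
        show "\<alpha> * (f a * g b) \<le> f2 a * g b + \<beta> * (fs a * g b)" for a b
          using mult_right_mono[OF strong[of a] g0[of b]] by (simp add: algebra_simps)
      qed (rule kernels fs)+
      also have "\<dots> \<le> conv u f2 g x y z + \<beta> * B" using B(1)[OF z] \<beta> by (simp add: mult_left_mono)
      finally have "exp (2 * p * z) * (\<alpha> * ?A) \<le> exp (2 * p * z) * (conv u f2 g x y z + \<beta> * B)" by simp
      moreover have "exp (2 * p * z) * (\<beta> * B) \<le> exp (2 * p) * (\<beta> * B)"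
        using e \<beta> B(2) by (intro mult_right_mono) auto
      moreover have "exp (- (2 * p)) * (\<alpha> * ?A) \<le> exp (2 * p * z) * (\<alpha> * ?A)"
        using e \<alpha> smoothed_nonneg by (intro mult_right_mono) auto
      ultimately have 1: "\<alpha> * exp (- (2 * p)) * ?A \<le> exp (2 * p * z) * conv u f2 g x y z + \<beta> * exp (2 *
          p) * B"
        by (simp add: algebra_simps)
      have "exp (- 2 * q * z) * - conv u f g2 x y z \<le> exp (- 2 * q * z) * (Cg * ?A)"
        using conv_snd_lower[of x y z] by (intro mult_left_mono) auto
      also have "\<dots> \<le> exp (2 * q) * (Cg * ?A)"
        using e Cg smoothed_nonneg by (intro mult_right_mono) auto
      finally have 2: "- (exp (- 2 * q * z) * conv u f g2 x y z) \<le> Cg * exp (2 * q) * ?A" by (simp add: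
          mult_ac)
      have "(m + Cg * exp (2 * q) + 17) * ?A \<le> \<alpha> * exp (- (2 * p)) * ?A"
        using large smoothed_nonneg by (rule mult_right_mono)
      then show ?thesis using 1 2 A.pde[of z x y] by (simp add: algebra_simps)
    qed
  next
    show "continuous_on {-1..1} (\<lambda>z. conv uzz f g x y z)"
      by (rule cont3D[OF A.cont(7)]) (intro continuous_intros)+
  qed
  then show ?thesis by (simp add: D_def)
qed

end

text \<open>
  The absorption is used twice. The parameter \<open>ky\<close> is chosen large relative to the fixed bump \<open>h\<close> and
  \<open>kx\<close> large relative to \<open>ky\<close>, which avoids a circular choice of constants.
\<close>

lemma truncated_uniform_bound:
  "\<exists>kx\<ge>2. \<exists>ky\<ge>2. \<forall>R\<ge>0. \<exists>C. \<forall>d e z. 0 < d \<longrightarrow> d \<le> cut_level kx \<longrightarrow> 0 < e \<longrightarrow> e \<le> cut_level ky \<longrightarrow> \<bar>z\<bar> \<le> R \<longrightarrow>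
     conv u (cut_sech kx d) (cut_sech ky e) 0 0 z \<le> C"
proof -
  interpret S: pos_eigenfunction q p m "\<lambda>x y z. u y x (- z)" "\<lambda>x y z. uy y x (- z)" "\<lambda>x y z. uyy y x (- z)"
    "\<lambda>x y z. ux y x (- z)" "\<lambda>x y z. uxx y x (- z)" "\<lambda>x y z. - uz y x (- z)" "\<lambda>x y z. uzz y x (- z)"
    by (rule swapped)
  have large: "\<exists>k\<ge>2. 3 / 2 * k\<^sup>2 * exp (- (2 * r)) \<ge> c" for r c :: real
  proof -
    define k where "k = 2 + \<bar>c\<bar> * exp (2 * r)"
    have k: "k \<ge> 2" by (simp add: k_def)
    have "c \<le> \<bar>c\<bar> * exp (2 * r) * exp (- (2 * r))" by (simp add: mult.assoc flip: exp_add)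
    also have "\<dots> \<le> k * exp (- (2 * r))" by (intro mult_right_mono) (auto simp: k_def)
    also have "k \<le> 3 / 2 * k\<^sup>2" using k mult_mono[of 1 k k k] by (simp add: power2_eq_square)
    then have "k * exp (- (2 * r)) \<le> 3 / 2 * k\<^sup>2 * exp (- (2 * r))" by (intro mult_right_mono) auto
    finally show ?thesis using k by blast
  qed
  define h where "h = cut_sech 2 (cut_level 2)"
  define h1 where "h1 = cut_sech1 2 (cut_level 2)"
  define h2 where "h2 = cut_sech2 2 (cut_level 2)"
  have h0: "0 \<le> h x" for x using cut_sech_bounds cut_level_pos[of 2] by (simp add: h_def)
  have hl: "- 24 * h x \<le> h2 x" for x
    using cut_sech2_lower(1)[of 2 "cut_level 2" x] cut_level_pos[of 2] by (simp add: h_def h2_def)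
  have kh: "kernel2 L h h1 h2" if "L \<ge> 2 / (2 * cut_level 2)" for L
    unfolding h_def h1_def h2_def by (rule cut_sech_kernel[OF _ cut_level_pos that]) simp
  define \<beta> where "\<beta> = (\<lambda>k::real. 15 / 2 * k\<^sup>2 / cut_level 2 ^ 3)"
  have \<beta>: "\<beta> k \<ge> 0" for k using cut_level_pos[of 2] by (simp add: \<beta>_def)
  have strong: "3 / 2 * k\<^sup>2 * cut_sech k e x \<le> cut_sech2 k e x + \<beta> k * h x" if "k \<ge> 2" "0 < e" "e \<le>
      cut_level k" for k e x
    using cut_sech2_lower(2)[OF that] by (simp add: h_def \<beta>_def)
  obtain ky where ky: "ky \<ge> 2" "3 / 2 * ky\<^sup>2 * exp (- (2 * q)) \<ge> m + 24 * exp (2 * p) + 17"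
    using large by blast
  obtain kx where kx: "kx \<ge> 2" "3 / 2 * kx\<^sup>2 * exp (- (2 * p)) \<ge> m + 6 * ky\<^sup>2 * exp (2 * q) + 17"
    using large by blast
  have "compact ((\<lambda>z. conv u h h 0 0 z) ` {-1..1})"
    by (intro compact_continuous_image cont3D[OF conv_cont[OF cont(1), of "2 / (2 * cut_level 2)"]])
       (use kh in \<open>auto simp: kernel2_def intro!: continuous_intros\<close>)
  then obtain B0 where B0: "\<And>z. \<bar>z\<bar> \<le> 1 \<Longrightarrow> conv u h h 0 0 z \<le> B0"
    by (fastforce dest!: compact_imp_bounded simp: bounded_iff abs_le_iff)
  have "0 \<le> conv u h h 0 0 0" by (rule conv_nonneg) (auto intro: nonneg h0)
  then have B00: "B0 \<ge> 0" using B0[of 0] by simp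
  define D1 where "D1 = exp (sqrt (m + 6 * ky\<^sup>2 * exp (2 * q * 2) + 24 * exp (2 * p * 2) + 1) + 1) * (\<beta>
      ky * exp (2 * q) * B0)"
  have step1: "conv u h (cut_sech ky e) 0 0 0 \<le> D1" if e: "0 < e" "e \<le> cut_level ky" for e
  proof -
    define L where "L = max (2 / (2 * cut_level 2)) (2 / (ky * e))"
    have k1: "kernel2 L (cut_sech ky e) (cut_sech1 ky e) (cut_sech2 ky e)" by (rule cut_sech_kernel)
        (use e ky in \<open>auto simp: L_def\<close>)
    have k2: "kernel2 L h h1 h2" by (rule kh) (simp add: L_def)
    have kk: "kernel L h" "kernel L (cut_sech ky e)" using k1 k2 by (auto simp: kernel2_def)
    have "conv (\<lambda>x y z. u y x (- z)) (cut_sech ky e) h 0 0 0 \<le> D1"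
      unfolding D1_def
    proof (rule S.conv_absorb_fst[OF k1 k2])
      show "- (6 * ky\<^sup>2) * cut_sech ky e x \<le> cut_sech2 ky e x" for x by (rule cut_sech2_lower(1)[OF ky(1) e])
      show "conv (\<lambda>x y z. u y x (- z)) h h 0 0 z \<le> B0" if "\<bar>z\<bar> \<le> 1" for z
        unfolding conv_swap[OF cont(1) kk(1) kk(1)] using B0[of "- z"] that by simp
      show "3 / 2 * ky\<^sup>2 * cut_sech ky e x \<le> cut_sech2 ky e x + \<beta> ky * h x" for x by (rule strong[OF ky(1) e])
    qed (use ky h0 hl kk B00 \<beta> cut_sech_bounds e in \<open>auto intro: order_trans\<close>)
    then show ?thesis using conv_swap[OF cont(1) kk, of 0 0 0] by simp
  qed
  define B1 where "B1 = exp ((sqrt (m + 24 * exp (2 * p * (1 + 1)) + 6 * ky\<^sup>2 * exp (2 * q * (1 + 1)) +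
      1) + 1) * 1) * D1"
  have step2: "conv u h (cut_sech ky e) 0 0 z \<le> B1" if e: "0 < e" "e \<le> cut_level ky" and z: "\<bar>z\<bar> \<le> 1" for e z
  proof -
    define L where "L = max (2 / (2 * cut_level 2)) (2 / (ky * e))"
    have k1: "kernel2 L (cut_sech ky e) (cut_sech1 ky e) (cut_sech2 ky e)" by (rule cut_sech_kernel)
        (use e ky in \<open>auto simp: L_def\<close>)
    have k2: "kernel2 L h h1 h2" by (rule kh) (simp add: L_def)
    have "conv u h (cut_sech ky e) 0 0 z \<le> exp ((sqrt (m + 24 * exp (2 * p * (1 + 1)) + 6 * ky\<^sup>2 * exp
        (2 * q * (1 + 1)) + 1) + 1) * 1) * conv u h (cut_sech ky e) 0 0 0"
      by (rule conv_vertical_harnack[OF k2 k1 h0 _ _ _ hl cut_sech2_lower(1)[OF ky(1) e] z]) (use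
          cut_sech_bounds e in auto)
    also have "\<dots> \<le> B1" unfolding B1_def using step1[OF e] by (intro mult_left_mono) auto
    finally show ?thesis .
  qed
  have "0 \<le> conv u h (cut_sech ky (cut_level ky)) 0 0 0"
    by (rule conv_nonneg) (auto intro!: nonneg h0 cut_sech_bounds less_imp_le[OF cut_level_pos])
  then have B10: "B1 \<ge> 0"
    using step2[of "cut_level ky" 0] cut_level_pos[of ky] by simp
  define D2 where "D2 = exp (sqrt (m + 6 * kx\<^sup>2 * exp (2 * p * 2) + 6 * ky\<^sup>2 * exp (2 * q * 2) + 1) + 1)
      * (\<beta> kx * exp (2 * p) * B1)"
  have bound: "conv u (cut_sech kx d) (cut_sech ky e) 0 0 z
      \<le> exp ((sqrt (m + 6 * kx\<^sup>2 * exp (2 * p * (R + 1)) + 6 * ky\<^sup>2 * exp (2 * q * (R + 1)) + 1) + 1) *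
          R) * D2"
    if d: "0 < d" "d \<le> cut_level kx" and e: "0 < e" "e \<le> cut_level ky" and z: "\<bar>z\<bar> \<le> R" for d e z R
  proof -
    \<comment> \<open>A common bound for the supports of all kernels in play, which may depend on the truncation levels.\<close>
    define L where "L = max (max (2 / (2 * cut_level 2)) (2 / (ky * e))) (2 / (kx * d))"
    have k1: "kernel2 L (cut_sech ky e) (cut_sech1 ky e) (cut_sech2 ky e)" by (rule cut_sech_kernel)
        (use e ky in \<open>auto simp: L_def\<close>)
    have k2: "kernel2 L (cut_sech kx d) (cut_sech1 kx d) (cut_sech2 kx d)" by (rule cut_sech_kernel)
        (use d kx in \<open>auto simp: L_def\<close>)
    have k3: "kernel L h" using kh[of L] by (auto simp: L_def kernel2_def)
    have t0: "0 \<le> cut_sech kx d x" "0 \<le> cut_sech ky e x" for x using cut_sech_bounds d e by auto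
    have "conv u (cut_sech kx d) (cut_sech ky e) 0 0 0 \<le> D2"
      unfolding D2_def
    proof (rule conv_absorb_fst[OF k2 k1 t0 _ _ cut_sech2_lower(1)[OF kx(1) d] cut_sech2_lower(1)[OF
        ky(1) e] k3])
      show "3 / 2 * kx\<^sup>2 * cut_sech kx d x \<le> cut_sech2 kx d x + \<beta> kx * h x" for x by (rule strong[OF kx(1) d])
    qed (use kx step2[OF e] \<beta> B10 in auto)
    moreover have "conv u (cut_sech kx d) (cut_sech ky e) 0 0 z
      \<le> exp ((sqrt (m + 6 * kx\<^sup>2 * exp (2 * p * (R + 1)) + 6 * ky\<^sup>2 * exp (2 * q * (R + 1)) + 1) + 1) * R)
        * conv u (cut_sech kx d) (cut_sech ky e) 0 0 0"
      by (rule conv_vertical_harnack[OF k2 k1 t0 _ _ cut_sech2_lower(1)[OF kx(1) d]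
          cut_sech2_lower(1)[OF ky(1) e] z]) auto
    ultimately show ?thesis by (meson mult_left_mono exp_ge_zero order_trans)
  qed
  show ?thesis using kx(1) ky(1) bound by blast
qed

text \<open>
  The uniform bounds for the truncated kernels pass to the full kernel by monotone convergence; the
  larger of the two parameters serves for both coordinates, as \<open>sech k\<close> decreases in \<open>k\<close>.
\<close>

lemma sech_kernel_integrable:
  "\<exists>k\<ge>2. \<forall>R\<ge>0. \<exists>C. \<forall>z. \<bar>z\<bar> \<le> R \<longrightarrow>
     integrable lborel (\<lambda>w. u (fst w) (snd w) z * (sech k (fst w) ^ 3 * sech k (snd w) ^ 3)) \<and>
     (\<integral>w. u (fst w) (snd w) z * (sech k (fst w) ^ 3 * sech k (snd w) ^ 3) \<partial>lborel) \<le> C"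
proof -
  obtain kx ky where k: "kx \<ge> 2" "ky \<ge> 2" and bd: "\<And>R. R \<ge> 0 \<Longrightarrow> \<exists>C. \<forall>d e z. 0 < d \<longrightarrow> d \<le> cut_level kx \<longrightarrow> 0
      < e \<longrightarrow> e \<le> cut_level ky \<longrightarrow> \<bar>z\<bar> \<le> R \<longrightarrow>
     conv u (cut_sech kx d) (cut_sech ky e) 0 0 z \<le> C"
    using truncated_uniform_bound by blast
  define l where "l = max kx ky"
  define c where "c = min (cut_level kx) (cut_level ky)"
  have c: "c > 0" "c \<le> cut_level kx" "c \<le> cut_level ky" using cut_level_pos by (auto simp: c_def)
  define e where "e = (\<lambda>n::nat. c / real (Suc n))"
  have e: "0 < e n" "e n \<le> c" for n using c(1) by (auto simp: e_def divide_le_eq mult_left_le)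
  have emono: "e n \<le> e n'" if "n' \<le> n" for n n' unfolding e_def using c(1) that by (intro
      divide_left_mono) auto
  have elim: "e \<longlonglongrightarrow> 0" 
    using tendsto_mult_right_zero[OF LIMSEQ_inverse_real_of_nat, of c] by (simp add: e_def divide_inverse)
  have ucont: "continuous_on UNIV (\<lambda>w. u (fst w) (snd w) z)" for z
    by (rule cont3D[OF cont(1)]) (intro continuous_intros)+
  have scont: "continuous_on UNIV (\<lambda>w::real \<times> real. sech a (fst w))" "continuous_on UNIV (\<lambda>w::real \<times>
      real. sech a (snd w))" for a
    by (rule continuous_on_compose2[OF sech_cont[of UNIV]], auto intro!: continuous_intros)+
  have "\<exists>C. \<forall>z. \<bar>z\<bar> \<le> R \<longrightarrow>
     integrable lborel (\<lambda>w. u (fst w) (snd w) z * (sech l (fst w) ^ 3 * sech l (snd w) ^ 3)) \<and>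
     (\<integral>w. u (fst w) (snd w) z * (sech l (fst w) ^ 3 * sech l (snd w) ^ 3) \<partial>lborel) \<le> C" if R: "R \<ge> 0" for R
  proof -
    obtain C where C: "\<And>d e z. 0 < d \<Longrightarrow> d \<le> cut_level kx \<Longrightarrow> 0 < e \<Longrightarrow> e \<le> cut_level ky \<Longrightarrow> \<bar>z\<bar> \<le> R \<Longrightarrow>
        conv u (cut_sech kx d) (cut_sech ky e) 0 0 z \<le> C" using bd[OF R] by blast
    have "integrable lborel (\<lambda>w. u (fst w) (snd w) z * (sech l (fst w) ^ 3 * sech l (snd w) ^ 3)) \<and>
     (\<integral>w. u (fst w) (snd w) z * (sech l (fst w) ^ 3 * sech l (snd w) ^ 3) \<partial>lborel) \<le> C" if z: "\<bar>z\<bar> \<le> R" for z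
    proof -
      let ?F = "\<lambda>n w. u (fst w) (snd w) z * (cut_sech kx (e n) (fst w) * cut_sech ky (e n) (snd w))"
      let ?G = "\<lambda>w. u (fst w) (snd w) z * (sech kx (fst w) ^ 3 * sech ky (snd w) ^ 3)"
      have cv: "(\<integral>w. ?F n w \<partial>lborel) = conv u (cut_sech kx (e n)) (cut_sech ky (e n)) 0 0 z" for n
        by (simp add: conv_def)
      have le: "(\<integral>w. ?F n w \<partial>lborel) \<le> C" for n
        unfolding cv by (rule C) (use e[of n] c z in auto)
      have int: "integrable lborel (?F n)" for n
      proof -
        define L where "L = max (2 / (kx * e n)) (2 / (ky * e n))"
        have "kernel L (cut_sech kx (e n))" "kernel L (cut_sech ky (e n))"
          using cut_sech_kernel[of kx "e n" L] cut_sech_kernel[of ky "e n" L] k e[of n] by (auto simp: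
              L_def kernel2_def)
        from conv_integrable[OF cont(1) this, of z 0 0] show ?thesis by simp
      qed
      have mono: "mono (\<lambda>n. ?F n w)" for w
        by (intro monoI mult_left_mono mult_mono cut_sech_antimono emono nonneg)
           (use cut_sech_bounds(1)[OF less_imp_le[OF e(1)]] in auto)
      have inc: "incseq (\<lambda>n. \<integral>w. ?F n w \<partial>lborel)"
        by (intro incseq_SucI integral_mono int) (use mono in \<open>auto simp: mono_iff_le_Suc\<close>)
      obtain I where I: "(\<lambda>n. \<integral>w. ?F n w \<partial>lborel) \<longlonglongrightarrow> I"
        using incseq_convergent[OF inc] le by blast
      have IC: "I \<le> C" by (rule LIMSEQ_le_const2[OF I]) (use le in auto)
      have lim: "(\<lambda>n. ?F n w) \<longlonglongrightarrow> ?G w" for w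
        by (intro tendsto_intros cut_sech_tendsto elim)
      have Gc: "continuous_on UNIV ?G" by (intro continuous_intros ucont scont)
      have G: "integrable lborel ?G" "(\<integral>w. ?G w \<partial>lborel) = I"
        by (rule integrable_monotone_convergence[OF int _ _ I] integral_monotone_convergence[OF int _ _ I],
            use mono lim Gc in \<open>auto intro: borel_measurable_continuous_onI\<close>)+
      let ?H = "\<lambda>w. u (fst w) (snd w) z * (sech l (fst w) ^ 3 * sech l (snd w) ^ 3)"
      have HG: "0 \<le> ?H w \<and> ?H w \<le> ?G w" for w
        using sech_bounds nonneg k
        by (auto intro!: mult_left_mono mult_mono power_mono sech_antimono mult_nonneg_nonneg simp:
            l_def less_imp_le)
      have H: "integrable lborel ?H"
      proof (rule Bochner_Integration.integrable_bound[OF G(1)])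
        have "continuous_on UNIV ?H" by (intro continuous_intros ucont scont)
        then show "?H \<in> borel_measurable lborel" by (auto intro: borel_measurable_continuous_onI)
        have "norm (?H w) \<le> norm (?G w)" for w using HG[of w] unfolding real_norm_def by linarith
        then show "AE w in lborel. norm (?H w) \<le> norm (?G w)" by auto
      qed
      have "(\<integral>w. ?H w \<partial>lborel) \<le> (\<integral>w. ?G w \<partial>lborel)" by (rule integral_mono[OF H G(1)]) (use HG in auto)
      then show ?thesis using H G(2) IC by simp
    qed
    then show ?thesis by blast
  qed
  moreover have "l \<ge> 2" using k by (simp add: l_def)
  ultimately show ?thesis by blast
qed

end

section \<open>Locally uniform limits of eigenfunctions\<close>

definition loc_unif :: "(nat \<Rightarrow> real \<Rightarrow> real \<Rightarrow> real \<Rightarrow> real) \<Rightarrow> (real \<Rightarrow> real \<Rightarrow> real \<Rightarrow> real) \<Rightarrow> bool" where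
  "loc_unif F F0 \<longleftrightarrow> (\<forall>R. \<forall>e>0. \<exists>N. \<forall>n\<ge>N. \<forall>x y z. \<bar>x\<bar> \<le> R \<longrightarrow> \<bar>y\<bar> \<le> R \<longrightarrow> \<bar>z\<bar> \<le> R \<longrightarrow>
     \<bar>F n x y z - F0 x y z\<bar> \<le> e)"

lemma loc_unifD:
  assumes "loc_unif F F0" "e > 0"
  obtains N where "\<And>n x y z. n \<ge> N \<Longrightarrow> \<bar>x\<bar> \<le> R \<Longrightarrow> \<bar>y\<bar> \<le> R \<Longrightarrow> \<bar>z\<bar> \<le> R \<Longrightarrow> \<bar>F n x y z - F0 x y z\<bar> \<le> e"
  using assms unfolding loc_unif_def by blast

lemma loc_unif_tendsto:
  assumes "loc_unif F F0"
  shows "(\<lambda>n. F n x y z) \<longlonglongrightarrow> F0 x y z"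
proof (rule metric_LIMSEQ_I)
  fix r :: real assume "r > 0"
  then have "r / 2 > 0" by simp
  then obtain N where N: "\<And>n a b c. n \<ge> N \<Longrightarrow> \<bar>a\<bar> \<le> \<bar>x\<bar> + \<bar>y\<bar> + \<bar>z\<bar> \<Longrightarrow> \<bar>b\<bar> \<le> \<bar>x\<bar> + \<bar>y\<bar> + \<bar>z\<bar> \<Longrightarrow>
      \<bar>c\<bar> \<le> \<bar>x\<bar> + \<bar>y\<bar> + \<bar>z\<bar> \<Longrightarrow> \<bar>F n a b c - F0 a b c\<bar> \<le> r / 2"
    using loc_unifD[OF assms, of "r / 2" "\<bar>x\<bar> + \<bar>y\<bar> + \<bar>z\<bar>"] by blast
  have "dist (F n x y z) (F0 x y z) < r" if "n \<ge> N" for n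
    using N[OF that, of x y z] \<open>r > 0\<close> by (simp add: dist_real_def)
  then show "\<exists>N. \<forall>n\<ge>N. dist (F n x y z) (F0 x y z) < r" by blast
qed

lemma loc_unif_add:
  assumes "loc_unif F F0" "loc_unif G G0"
  shows "loc_unif (\<lambda>n x y z. F n x y z + G n x y z) (\<lambda>x y z. F0 x y z + G0 x y z)"
  unfolding loc_unif_def
proof (intro allI impI)
  fix R e :: real assume e: "e > 0"
  then have e2: "e / 2 > 0" by simp
  obtain N1 where N1: "\<And>n x y z. n \<ge> N1 \<Longrightarrow> \<bar>x\<bar> \<le> R \<Longrightarrow> \<bar>y\<bar> \<le> R \<Longrightarrow> \<bar>z\<bar> \<le> R \<Longrightarrow> \<bar>F n x y z - F0 x y z\<bar> \<le> e / 2"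
    using loc_unifD[OF assms(1) e2] by blast
  obtain N2 where N2: "\<And>n x y z. n \<ge> N2 \<Longrightarrow> \<bar>x\<bar> \<le> R \<Longrightarrow> \<bar>y\<bar> \<le> R \<Longrightarrow> \<bar>z\<bar> \<le> R \<Longrightarrow> \<bar>G n x y z - G0 x y z\<bar> \<le> e / 2"
    using loc_unifD[OF assms(2) e2] by blast
  show "\<exists>N. \<forall>n\<ge>N. \<forall>x y z. \<bar>x\<bar> \<le> R \<longrightarrow> \<bar>y\<bar> \<le> R \<longrightarrow> \<bar>z\<bar> \<le> R \<longrightarrow>
      \<bar>F n x y z + G n x y z - (F0 x y z + G0 x y z)\<bar> \<le> e"
  proof (intro exI[of _ "max N1 N2"] allI impI)
    fix n x y z assume *: "max N1 N2 \<le> n" "\<bar>x\<bar> \<le> R" "\<bar>y\<bar> \<le> R" "\<bar>z\<bar> \<le> R"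
    show "\<bar>F n x y z + G n x y z - (F0 x y z + G0 x y z)\<bar> \<le> e"
      using N1[of n x y z] N2[of n x y z] * by linarith
  qed
qed

lemma loc_unif_mult:
  assumes F: "loc_unif F F0" and c: "\<And>R. \<exists>C. \<forall>z. \<bar>z\<bar> \<le> R \<longrightarrow> \<bar>c z\<bar> \<le> C"
  shows "loc_unif (\<lambda>n x y z. c z * F n x y z) (\<lambda>x y z. c z * F0 x y z)"
  unfolding loc_unif_def
proof (intro allI impI)
  fix R e :: real assume e: "e > 0"
  obtain C where C: "\<And>z. \<bar>z\<bar> \<le> R \<Longrightarrow> \<bar>c z\<bar> \<le> C" using c by blast
  have "e / (\<bar>C\<bar> + 1) > 0" using e by simp
  then obtain N where N: "\<And>n x y z. n \<ge> N \<Longrightarrow> \<bar>x\<bar> \<le> R \<Longrightarrow> \<bar>y\<bar> \<le> R \<Longrightarrow> \<bar>z\<bar> \<le> R \<Longrightarrow>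
      \<bar>F n x y z - F0 x y z\<bar> \<le> e / (\<bar>C\<bar> + 1)" using loc_unifD[OF F] by blast
  show "\<exists>N. \<forall>n\<ge>N. \<forall>x y z. \<bar>x\<bar> \<le> R \<longrightarrow> \<bar>y\<bar> \<le> R \<longrightarrow> \<bar>z\<bar> \<le> R \<longrightarrow> \<bar>c z * F n x y z - c z * F0 x y z\<bar> \<le> e"
  proof (intro exI[of _ N] allI impI)
    fix n x y z assume *: "N \<le> n" "\<bar>x\<bar> \<le> R" "\<bar>y\<bar> \<le> R" "\<bar>z\<bar> \<le> R"
    have "\<bar>c z * F n x y z - c z * F0 x y z\<bar> = \<bar>c z\<bar> * \<bar>F n x y z - F0 x y z\<bar>"
      by (simp add: abs_mult flip: right_diff_distrib)
    also have "\<dots> \<le> (\<bar>C\<bar> + 1) * (e / (\<bar>C\<bar> + 1))"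
      using C[OF *(4)] by (intro mult_mono N *) auto
    also have "\<dots> = e" by (simp add: add_nonneg_eq_0_iff)
    finally show "\<bar>c z * F n x y z - c z * F0 x y z\<bar> \<le> e" .
  qed
qed

lemma loc_unif_cont:
  assumes F: "loc_unif F F0" and c: "\<And>n. cont3 (F n)"
  shows "cont3 F0"
proof -
  have "continuous_on (box (- R, - R, - R) (R, R, R)) (\<lambda>(x, y, z). F0 x y z)" for R
  proof (rule uniform_limit_theorem[where f = "\<lambda>n (x, y, z). F n x y z" and F = sequentially])
    show "\<forall>\<^sub>F n in sequentially. continuous_on (box (- R, - R, - R) (R, R, R)) (\<lambda>(x, y, z). F n x y z)"
      by (intro always_eventually allI continuous_on_subset[OF c]) simp
    show "uniform_limit (box (- R, - R, - R) (R, R, R)) (\<lambda>n (x, y, z). F n x y z) (\<lambda>(x, y, z). F0 x y z)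
        sequentially"
    proof (rule uniform_limitI)
      fix e :: real assume e: "e > 0"
      then have "e / 2 > 0" by simp
      then obtain N where N: "\<And>n x y z. n \<ge> N \<Longrightarrow> \<bar>x\<bar> \<le> R \<Longrightarrow> \<bar>y\<bar> \<le> R \<Longrightarrow> \<bar>z\<bar> \<le> R \<Longrightarrow> \<bar>F n x y z - F0 x y z\<bar> \<le> e / 2"
        using loc_unifD[OF F] by blast
      have "\<forall>v\<in>box (- R, - R, - R) (R, R, R). dist (case v of (x, y, z) \<Rightarrow> F n x y z) (case v of (x, y,
          z) \<Rightarrow> F0 x y z) < e"
        if "n \<ge> N" for n
      proof
        fix v assume "v \<in> box (- R, - R, - R) (R, R, R)"
        then obtain x y z where v: "v = (x, y, z)" "\<bar>x\<bar> \<le> R" "\<bar>y\<bar> \<le> R" "\<bar>z\<bar> \<le> R"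
          by (cases v) (auto simp: mem_box Basis_prod_def)
        show "dist (case v of (x, y, z) \<Rightarrow> F n x y z) (case v of (x, y, z) \<Rightarrow> F0 x y z) < e"
          using N[OF that v(2-4)] e by (simp add: v(1) dist_real_def)
      qed
      then show "\<forall>\<^sub>F n in sequentially. \<forall>v\<in>box (- R, - R, - R) (R, R, R).
          dist (case v of (x, y, z) \<Rightarrow> F n x y z) (case v of (x, y, z) \<Rightarrow> F0 x y z) < e"
        by (auto simp: eventually_sequentially)
    qed
  qed simp
  then have "continuous_on (\<Union>R\<in>UNIV. box (- R, - R, - R) (R, R, R)) (\<lambda>(x, y, z). F0 x y z)"
    by (intro continuous_on_open_UN) auto
  moreover have "(\<Union>R\<in>(UNIV::real set). box (- R, - R, - R) (R, R, R)) = (UNIV :: (real \<times> real \<times> real) set)"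
  proof (intro equalityI subsetI UN_I UNIV_I)
    fix v :: "real \<times> real \<times> real"
    show "v \<in> box (- (\<bar>fst v\<bar> + \<bar>fst (snd v)\<bar> + \<bar>snd (snd v)\<bar> + 1), - (\<bar>fst v\<bar> + \<bar>fst (snd v)\<bar> + \<bar>snd
        (snd v)\<bar> + 1),
        - (\<bar>fst v\<bar> + \<bar>fst (snd v)\<bar> + \<bar>snd (snd v)\<bar> + 1))
       (\<bar>fst v\<bar> + \<bar>fst (snd v)\<bar> + \<bar>snd (snd v)\<bar> + 1, \<bar>fst v\<bar> + \<bar>fst (snd v)\<bar> + \<bar>snd (snd v)\<bar> + 1,
        \<bar>fst v\<bar> + \<bar>fst (snd v)\<bar> + \<bar>snd (snd v)\<bar> + 1)"
      by (cases v) (auto simp: mem_box Basis_prod_def)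
  qed
  ultimately show ?thesis by simp
qed

lemma deriv_of_limit:
  fixes f f' :: "nat \<Rightarrow> real \<Rightarrow> real"
  assumes d: "\<And>n t. (f n has_real_derivative f' n t) (at t)"
    and lim: "\<And>t. (\<lambda>n. f n t) \<longlonglongrightarrow> f0 t"
    and un: "\<And>e. e > 0 \<Longrightarrow> \<exists>N. \<forall>n\<ge>N. \<forall>t. \<bar>t - x\<bar> \<le> 1 \<longrightarrow> \<bar>f' n t - g t\<bar> \<le> e"
  shows "(f0 has_real_derivative g x) (at x)"
proof -
  let ?S = "{x-1..x+1}"
  have A: "(f n has_derivative (*) (f' n t)) (at t within ?S)" for n t
    using has_field_derivative_at_within[OF d[of n t]] by (simp add: has_field_derivative_def)
  have B: "\<forall>\<^sub>F n in sequentially. \<forall>t\<in>?S. \<forall>h. norm (f' n t * h - g t * h) \<le> e * norm h" if e: "e > 0" for e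
  proof -
    obtain N where N: "\<And>n t. n \<ge> N \<Longrightarrow> \<bar>t - x\<bar> \<le> 1 \<Longrightarrow> \<bar>f' n t - g t\<bar> \<le> e" using un[OF e] by blast
    have "norm (f' n t * h - g t * h) \<le> e * norm h" if "n \<ge> N" "t \<in> ?S" for n t h
    proof -
      have "\<bar>f' n t - g t\<bar> * \<bar>h\<bar> \<le> e * \<bar>h\<bar>"
        using that by (intro mult_right_mono N) (auto simp: abs_le_iff)
      then show ?thesis by (simp add: abs_mult flip: left_diff_distrib)
    qed
    then show ?thesis unfolding eventually_sequentially by blast
  qed
  have S: "convex ?S" "x \<in> ?S" by simp_all
  have "\<exists>h. \<forall>t\<in>?S. (\<lambda>n. f n t) \<longlonglongrightarrow> h t \<and> (h has_derivative (*) (g t)) (at t within ?S)"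
    by (rule has_derivative_sequence[OF S(1) A B S(2) lim])
  then obtain h where h: "\<And>t. t \<in> ?S \<Longrightarrow> (\<lambda>n. f n t) \<longlonglongrightarrow> h t"
      "\<And>t. t \<in> ?S \<Longrightarrow> (h has_derivative (*) (g t)) (at t within ?S)" by blast
  have eq: "h t = f0 t" if "t \<in> ?S" for t using LIMSEQ_unique[OF h(1)[OF that] lim] .
  have "(h has_real_derivative g x) (at x within ?S)"
    using h(2)[of x] by (simp add: has_field_derivative_def)
  then have "(h has_real_derivative g x) (at x)"
    using at_within_interior[of x ?S] by simp
  then show ?thesis
    by (rule has_field_derivative_transform_within_open[of _ _ _ "{x-1<..<x+1}"]) (use eq in auto)
qed

lemma loc_unif_derivs:
  assumes F: "loc_unif F F0" and G: "loc_unif G G0"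
  shows "(\<And>n x y z. ((\<lambda>t. F n t y z) has_real_derivative G n x y z) (at x)) \<Longrightarrow>
      ((\<lambda>t. F0 t y z) has_real_derivative G0 x y z) (at x)"
    and "(\<And>n x y z. ((\<lambda>t. F n x t z) has_real_derivative G n x y z) (at y)) \<Longrightarrow>
      ((\<lambda>t. F0 x t z) has_real_derivative G0 x y z) (at y)"
    and "(\<And>n x y z. ((\<lambda>t. F n x y t) has_real_derivative G n x y z) (at z)) \<Longrightarrow>
      ((\<lambda>t. F0 x y t) has_real_derivative G0 x y z) (at z)"
proof -
  define R where "R = \<bar>x\<bar> + \<bar>y\<bar> + \<bar>z\<bar> + 1"
  have N: "\<exists>N. \<forall>n\<ge>N. \<forall>x y z. \<bar>x\<bar> \<le> R \<longrightarrow> \<bar>y\<bar> \<le> R \<longrightarrow> \<bar>z\<bar> \<le> R \<longrightarrow> \<bar>G n x y z - G0 x y z\<bar> \<le> e"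
    if "e > 0" for e using G that unfolding loc_unif_def by blast
  have R: "\<bar>x\<bar> \<le> R" "\<bar>y\<bar> \<le> R" "\<bar>z\<bar> \<le> R"
    "\<And>t. \<bar>t - x\<bar> \<le> 1 \<Longrightarrow> \<bar>t\<bar> \<le> R" "\<And>t. \<bar>t - y\<bar> \<le> 1 \<Longrightarrow> \<bar>t\<bar> \<le> R" "\<And>t. \<bar>t - z\<bar> \<le> 1 \<Longrightarrow> \<bar>t\<bar> \<le> R"
    by (auto simp: R_def)
  show "((\<lambda>t. F0 t y z) has_real_derivative G0 x y z) (at x)"
    if d: "\<And>n x y z. ((\<lambda>t. F n t y z) has_real_derivative G n x y z) (at x)"
    by (rule deriv_of_limit[where f = "\<lambda>n t. F n t y z" and f' = "\<lambda>n t. G n t y z" and g = "\<lambda>t. G0 t y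
        z", OF d loc_unif_tendsto[OF F]])
       (meson N R)
  show "((\<lambda>t. F0 x t z) has_real_derivative G0 x y z) (at y)"
    if d: "\<And>n x y z. ((\<lambda>t. F n x t z) has_real_derivative G n x y z) (at y)"
    by (rule deriv_of_limit[where f = "\<lambda>n t. F n x t z" and f' = "\<lambda>n t. G n x t z" and g = "\<lambda>t. G0 x t
        z", OF d loc_unif_tendsto[OF F]])
       (meson N R)
  show "((\<lambda>t. F0 x y t) has_real_derivative G0 x y z) (at z)"
    if d: "\<And>n x y z. ((\<lambda>t. F n x y t) has_real_derivative G n x y z) (at z)"
    by (rule deriv_of_limit[where f = "\<lambda>n t. F n x y t" and f' = "\<lambda>n t. G n x y t" and g = "\<lambda>t. G0 x y
        t", OF d loc_unif_tendsto[OF F]])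
       (meson N R)
qed

text \<open>
  The first derivative is expressed by values of the function and of the second derivative. This is
  how convergence of the vertical derivatives is obtained below.
\<close>

lemma taylor_integral:
  fixes f f1 f2 :: "real \<Rightarrow> real"
  assumes d1: "\<And>z. (f has_real_derivative f1 z) (at z)" and d2: "\<And>z. (f1 has_real_derivative f2 z) (at z)"
  shows "((\<lambda>s. (1 - s) * f2 (z + s)) has_integral f (z + 1) - f z - f1 z) {0..1}"
proof -
  have "((\<lambda>s. (1 - s) * f2 (z + s)) has_integral ((1 - 1) * f1 (z + 1) + f (z + 1)) - ((1 - 0) * f1 (z +
      0) + f (z + 0))) {0..1}"
  proof (rule fundamental_theorem_of_calculus)
    fix s :: real
    have sh: "((\<lambda>s. z + s) has_real_derivative 1) (at s)" by (auto intro!: derivative_eq_intros)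
    have "((\<lambda>s. (1 - s) * f1 (z + s) + f (z + s)) has_real_derivative (1 - s) * f2 (z + s)) (at s)"
      using DERIV_chain2[OF d1 sh] DERIV_chain2[OF d2 sh] by (auto intro!: derivative_eq_intros)
    then show "((\<lambda>s. (1 - s) * f1 (z + s) + f (z + s)) has_vector_derivative (1 - s) * f2 (z + s)) (at s
        within {0..1})"
      by (simp add: has_real_derivative_iff_has_vector_derivative has_vector_derivative_at_within)
  qed simp
  then show ?thesis by (simp add: diff_diff_eq add.commute)
qed

text \<open>
  The second derivative in \<open>z\<close> converges because of the equation, and then the first one by Taylor's
  formula.
\<close>

lemma eigenfunction_limit:
  assumes E: "\<And>n. eigenfunction p q m (U n) (Ux n) (Uxx n) (Uy n) (Uyy n) (Uz n) (Uzz n)"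
    and l: "loc_unif U U0" "loc_unif Ux Ux0" "loc_unif Uxx Uxx0" "loc_unif Uy Uy0" "loc_unif Uyy Uyy0"
  shows "\<exists>Uz0 Uzz0. eigenfunction p q m U0 Ux0 Uxx0 Uy0 Uyy0 Uz0 Uzz0"
proof -
  define G where "G = (\<lambda>x y z. m * U0 x y z + (- exp (2 * p * z) * Uxx0 x y z + - exp (- 2 * q * z) *
      Uyy0 x y z))"
  have bexp: "\<exists>C. \<forall>z. \<bar>z\<bar> \<le> R \<longrightarrow> \<bar>- exp (a * z)\<bar> \<le> C" for a R :: real
  proof (intro exI allI impI)
    fix z :: real assume "\<bar>z\<bar> \<le> R"
    then have "\<bar>a * z\<bar> \<le> \<bar>a\<bar> * R" by (simp add: abs_mult mult_left_mono)
    then show "\<bar>- exp (a * z)\<bar> \<le> exp (\<bar>a\<bar> * R)" by simp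
  qed
  have "loc_unif (\<lambda>n x y z. m * U n x y z + (- exp (2 * p * z) * Uxx n x y z + - exp (- 2 * q * z) * Uyy
      n x y z)) G"
    unfolding G_def
    by (intro loc_unif_add loc_unif_mult l bexp) auto
  moreover have "(\<lambda>n x y z. m * U n x y z + (- exp (2 * p * z) * Uxx n x y z + - exp (- 2 * q * z) * Uyy
      n x y z)) = Uzz"
    using eigenfunction.pde[OF E] by (intro ext) (simp add: algebra_simps)
  ultimately have lG: "loc_unif Uzz G" by simp
  have cG: "cont3 G" by (rule loc_unif_cont[OF lG eigenfunction.cont(7)[OF E]])
  \<comment> \<open>The limit of the vertical derivatives, predicted by Taylor's formula.\<close>
  define V where "V = (\<lambda>x y z. U0 x y (z + 1) - U0 x y z - integral {0..1} (\<lambda>s. (1 - s) * G x y (z + s)))"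
  have lV: "loc_unif Uz V"
    unfolding loc_unif_def
  proof (intro allI impI)
    fix R e :: real assume e: "e > 0"
    then have e3: "e / 3 > 0" by simp
    obtain N1 where N1: "\<And>n x y z. n \<ge> N1 \<Longrightarrow> \<bar>x\<bar> \<le> R + 1 \<Longrightarrow> \<bar>y\<bar> \<le> R + 1 \<Longrightarrow> \<bar>z\<bar> \<le> R + 1 \<Longrightarrow> \<bar>U n x y z - U0 x
        y z\<bar> \<le> e / 3"
      using loc_unifD[OF l(1) e3] by blast
    obtain N2 where N2: "\<And>n x y z. n \<ge> N2 \<Longrightarrow> \<bar>x\<bar> \<le> R + 1 \<Longrightarrow> \<bar>y\<bar> \<le> R + 1 \<Longrightarrow> \<bar>z\<bar> \<le> R + 1 \<Longrightarrow> \<bar>Uzz n x y z - G x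
        y z\<bar> \<le> e / 3"
      using loc_unifD[OF lG e3] by blast
    show "\<exists>N. \<forall>n\<ge>N. \<forall>x y z. \<bar>x\<bar> \<le> R \<longrightarrow> \<bar>y\<bar> \<le> R \<longrightarrow> \<bar>z\<bar> \<le> R \<longrightarrow> \<bar>Uz n x y z - V x y z\<bar> \<le> e"
    proof (intro exI[of _ "max N1 N2"] allI impI)
      fix n x y z assume *: "max N1 N2 \<le> n" "\<bar>x\<bar> \<le> R" "\<bar>y\<bar> \<le> R" "\<bar>z\<bar> \<le> R"
      have T: "((\<lambda>s. (1 - s) * Uzz n x y (z + s)) has_integral U n x y (z + 1) - U n x y z - Uz n x y z)
          {0..1}"
        by (rule taylor_integral) (rule eigenfunction.dz[OF E] eigenfunction.dzz[OF E])+
      have "(\<lambda>s. (1 - s) * G x y (z + s)) integrable_on {0..1}"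
        by (intro integrable_continuous_interval continuous_intros cont3D[OF cG])
      then have TG: "((\<lambda>s. (1 - s) * G x y (z + s)) has_integral U0 x y (z + 1) - U0 x y z - V x y z) {0..1}"
        by (simp add: V_def integrable_integral)
      have "norm ((U n x y (z + 1) - U n x y z - Uz n x y z) - (U0 x y (z + 1) - U0 x y z - V x y z)) \<le>
          e / 3 * measure lborel {0..1::real}"
      proof (rule has_integral_bound_real[OF _ _ has_integral_diff[OF T TG]])
        show "0 \<le> e / 3" using e by simp
        show "finite ({}::real set)" by simp
        fix s :: real assume "s \<in> {0..1} - {}"
        then have s: "0 \<le> s" "s \<le> 1" by auto
        have "\<bar>Uzz n x y (z + s) - G x y (z + s)\<bar> \<le> e / 3" by (rule N2) (use * s in auto)
        then have "\<bar>1 - s\<bar> * \<bar>Uzz n x y (z + s) - G x y (z + s)\<bar> \<le> 1 * (e / 3)"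
          using s by (intro mult_mono) auto
        then show "norm ((1 - s) * Uzz n x y (z + s) - (1 - s) * G x y (z + s)) \<le> e / 3"
          by (simp add: abs_mult flip: right_diff_distrib)
      qed
      then have "\<bar>(U n x y (z + 1) - U n x y z - Uz n x y z) - (U0 x y (z + 1) - U0 x y z - V x y z)\<bar> \<le> e / 3"
        by simp
      moreover have "\<bar>U n x y (z + 1) - U0 x y (z + 1)\<bar> \<le> e / 3" "\<bar>U n x y z - U0 x y z\<bar> \<le> e / 3"
        using N1[of n x y "z + 1"] N1[of n x y z] * by linarith+
      ultimately show "\<bar>Uz n x y z - V x y z\<bar> \<le> e"
        unfolding abs_le_iff by linarith
    qed
  qed
  have "eigenfunction p q m U0 Ux0 Uxx0 Uy0 Uyy0 V G"
  proof
    fix x y z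
    show "((\<lambda>t. U0 t y z) has_real_derivative Ux0 x y z) (at x)" by (rule loc_unif_derivs(1)[OF l(1,2)
        eigenfunction.dx[OF E]])
    show "((\<lambda>t. Ux0 t y z) has_real_derivative Uxx0 x y z) (at x)" by (rule loc_unif_derivs(1)[OF l(2,3)
        eigenfunction.dxx[OF E]])
    show "((\<lambda>t. U0 x t z) has_real_derivative Uy0 x y z) (at y)" by (rule loc_unif_derivs(2)[OF l(1,4)
        eigenfunction.dy[OF E]])
    show "((\<lambda>t. Uy0 x t z) has_real_derivative Uyy0 x y z) (at y)" by (rule loc_unif_derivs(2)[OF l(4,5)
        eigenfunction.dyy[OF E]])
    show "((\<lambda>t. U0 x y t) has_real_derivative V x y z) (at z)" by (rule loc_unif_derivs(3)[OF l(1) lV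
        eigenfunction.dz[OF E]])
    show "((\<lambda>t. V x y t) has_real_derivative G x y z) (at z)" by (rule loc_unif_derivs(3)[OF lV lG
        eigenfunction.dzz[OF E]])
    show "exp (2 * p * z) * Uxx0 x y z + exp (- 2 * q * z) * Uyy0 x y z + G x y z = m * U0 x y z"
      by (simp add: G_def)
  next
    show "cont3 U0" by (rule loc_unif_cont[OF l(1) eigenfunction.cont(1)[OF E]])
    show "cont3 Ux0" by (rule loc_unif_cont[OF l(2) eigenfunction.cont(2)[OF E]])
    show "cont3 Uxx0" by (rule loc_unif_cont[OF l(3) eigenfunction.cont(3)[OF E]])
    show "cont3 Uy0" by (rule loc_unif_cont[OF l(4) eigenfunction.cont(4)[OF E]])
    show "cont3 Uyy0" by (rule loc_unif_cont[OF l(5) eigenfunction.cont(5)[OF E]])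
    show "cont3 V" by (rule loc_unif_cont[OF lV eigenfunction.cont(6)[OF E]])
    show "cont3 G" by (rule cG)
  qed
  then show ?thesis by blast
qed

section \<open>Removing the truncation and the smoothing\<close>

lemma cut_sech_diff_bounds:
  assumes k: "k \<ge> 1" and e: "e \<ge> 0"
  shows "\<bar>cut_sech k e x - cut_sech k 0 x\<bar> \<le> 12 * k\<^sup>2 * e * (sech k x)\<^sup>2"
    "\<bar>cut_sech1 k e x - cut_sech1 k 0 x\<bar> \<le> 12 * k\<^sup>2 * e * (sech k x)\<^sup>2"
    "\<bar>cut_sech2 k e x - cut_sech2 k 0 x\<bar> \<le> 12 * k\<^sup>2 * e * (sech k x)\<^sup>2"
proof -
  define a where "a = sech k x"
  define s where "s = max 0 (a - e)"
  have a: "0 < a" "a \<le> 1" using sech_bounds[of k x] by (auto simp: a_def)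
  have m0: "max 0 (a - 0) = a" using a by simp
  have s: "0 \<le> s" "s \<le> a" "a - s \<le> e" using a e by (auto simp: s_def)
  have d2: "\<bar>s\<^sup>2 - a\<^sup>2\<bar> \<le> 2 * e * a"
  proof -
    have "a\<^sup>2 - s\<^sup>2 = (a - s) * (a + s)" by (simp add: power2_eq_square algebra_simps)
    also have "\<dots> \<le> e * (a + a)" using s e a by (intro mult_mono) auto
    finally have "a\<^sup>2 - s\<^sup>2 \<le> 2 * e * a" by simp
    moreover have "s\<^sup>2 \<le> a\<^sup>2" using s by (intro power_mono) auto
    ultimately show ?thesis by simp
  qed
  have k2: "1 \<le> k\<^sup>2" "k \<le> k\<^sup>2" using k mult_mono[of 1 k 1 k] mult_mono[of 1 k k k] by (auto simp:
      power2_eq_square)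
  have k0: "0 \<le> k" using k by simp
  note b = sech_derivs_bounds[OF k0, of x, folded a_def]
  have ea: "0 \<le> e * a\<^sup>2" using e by simp
  show "\<bar>cut_sech k e x - cut_sech k 0 x\<bar> \<le> 12 * k\<^sup>2 * e * (sech k x)\<^sup>2"
  proof -
    have "a ^ 3 - s ^ 3 = (a - s) * (a\<^sup>2 + a * s + s\<^sup>2)" by (simp add: power2_eq_square power3_eq_cube
        algebra_simps)
    also have "\<dots> \<le> e * (a\<^sup>2 + a * a + a\<^sup>2)"
      using s e a by (intro mult_mono add_mono power_mono) auto
    also have "\<dots> = 3 * (e * a\<^sup>2)" by (simp add: power2_eq_square)
    also have "\<dots> \<le> 12 * k\<^sup>2 * (e * a\<^sup>2)" using k2 ea by (intro mult_right_mono) auto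
    finally have "a ^ 3 - s ^ 3 \<le> 12 * k\<^sup>2 * e * a\<^sup>2" by (simp add: mult.assoc)
    moreover have "s ^ 3 \<le> a ^ 3" using s by (intro power_mono) auto
    ultimately show ?thesis unfolding cut_sech_def a_def[symmetric] m0 s_def[symmetric] by simp
  qed
  show "\<bar>cut_sech1 k e x - cut_sech1 k 0 x\<bar> \<le> 12 * k\<^sup>2 * e * (sech k x)\<^sup>2"
  proof -
    have "\<bar>cut_sech1 k e x - cut_sech1 k 0 x\<bar> = 3 * (\<bar>s\<^sup>2 - a\<^sup>2\<bar> * \<bar>sech1 k x\<bar>)"
      unfolding cut_sech1_def a_def[symmetric] m0 s_def[symmetric]
      by (simp add: abs_mult mult.assoc flip: left_diff_distrib right_diff_distrib)
    also have "\<dots> \<le> 3 * ((2 * e * a) * (k * a))"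
      using d2 b(1) e a by (intro mult_left_mono mult_mono) auto
    also have "\<dots> = 6 * k * (e * a\<^sup>2)" by (simp add: power2_eq_square)
    also have "\<dots> \<le> 12 * k\<^sup>2 * (e * a\<^sup>2)" using k2 k0 ea by (intro mult_right_mono) auto
    finally show ?thesis by (simp add: a_def mult.assoc)
  qed
  show "\<bar>cut_sech2 k e x - cut_sech2 k 0 x\<bar> \<le> 12 * k\<^sup>2 * e * (sech k x)\<^sup>2"
  proof -
    have eq: "cut_sech2 k e x - cut_sech2 k 0 x = 6 * ((s - a) * (sech1 k x)\<^sup>2) + 3 * ((s\<^sup>2 - a\<^sup>2) *
        sech2 k x)"
      unfolding cut_sech2_def a_def[symmetric] m0 s_def[symmetric] by (simp add: algebra_simps)
    have "\<bar>(s - a) * (sech1 k x)\<^sup>2\<bar> \<le> e * (k\<^sup>2 * a\<^sup>2)"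
      unfolding abs_mult using s e b(3) by (intro mult_mono) auto
    moreover have "\<bar>(s\<^sup>2 - a\<^sup>2) * sech2 k x\<bar> \<le> (2 * e * a) * (k\<^sup>2 * a)"
      unfolding abs_mult using d2 b(2) e a by (intro mult_mono) auto
    moreover have "(2 * e * a) * (k\<^sup>2 * a) = 2 * (e * (k\<^sup>2 * a\<^sup>2))" by (simp add: power2_eq_square)
    ultimately have "\<bar>cut_sech2 k e x - cut_sech2 k 0 x\<bar> \<le> 12 * (e * (k\<^sup>2 * a\<^sup>2))" unfolding eq by linarith
    then show ?thesis by (simp add: a_def mult_ac)
  qed
qed

lemma cut_sech_sizes:
  assumes k: "k \<ge> 1" and e: "e \<ge> 0"
  shows "\<bar>cut_sech k e x\<bar> \<le> 12 * k\<^sup>2 * (sech k x)\<^sup>2" "\<bar>cut_sech1 k e x\<bar> \<le> 12 * k\<^sup>2 * (sech k x)\<^sup>2"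
    "\<bar>cut_sech2 k e x\<bar> \<le> 12 * k\<^sup>2 * (sech k x)\<^sup>2"
    and "\<bar>cut_sech1 k 0 x\<bar> \<le> 9 * k\<^sup>2 * cut_sech k 0 x" "\<bar>cut_sech2 k 0 x\<bar> \<le> 9 * k\<^sup>2 * cut_sech k 0 x"
proof -
  define a where "a = sech k x"
  have a: "0 < a" "a \<le> 1" using sech_bounds[of k x] by (auto simp: a_def)
  have m0: "max 0 (a - 0) = a" using a by simp
  have k2: "1 \<le> k\<^sup>2" "k \<le> k\<^sup>2" using k mult_mono[of 1 k 1 k] mult_mono[of 1 k k k] by (auto simp:
      power2_eq_square)
  have k0: "0 \<le> k" using k by simp
  note b = sech_derivs_bounds[OF k0, of x, folded a_def]
  have a3: "a ^ 3 \<le> a\<^sup>2" using a by (intro power_decreasing) auto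
  have gen: "\<bar>cut_sech k e x\<bar> \<le> cut_sech k 0 x \<and> \<bar>cut_sech1 k e x\<bar> \<le> 9 * k\<^sup>2 * a ^ 3 \<and> \<bar>cut_sech2 k e x\<bar>
      \<le> 9 * k\<^sup>2 * a ^ 3"
    if e: "e \<ge> 0" for e
  proof -
    define s where "s = max 0 (a - e)"
    have s: "0 \<le> s" "s \<le> a" using a e by (auto simp: s_def)
    have s2: "s\<^sup>2 \<le> a\<^sup>2" using s by (intro power_mono) auto
    have 1: "\<bar>cut_sech k e x\<bar> \<le> cut_sech k 0 x"
      unfolding cut_sech_def a_def[symmetric] m0 s_def[symmetric] using s by (auto intro!: power_mono)
    have "\<bar>cut_sech1 k e x\<bar> = 3 * (s\<^sup>2 * \<bar>sech1 k x\<bar>)"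
      unfolding cut_sech1_def a_def[symmetric] s_def[symmetric] by (simp add: abs_mult)
    also have "\<dots> \<le> 3 * (a\<^sup>2 * (k * a))" using s2 b(1) by (intro mult_left_mono mult_mono) auto
    also have "\<dots> = 3 * k * a ^ 3" by (simp add: power2_eq_square power3_eq_cube)
    also have "\<dots> \<le> 9 * k\<^sup>2 * a ^ 3" using k2 k0 a by (intro mult_right_mono) auto
    finally have 2: "\<bar>cut_sech1 k e x\<bar> \<le> 9 * k\<^sup>2 * a ^ 3" .
    have "\<bar>s * (sech1 k x)\<^sup>2\<bar> \<le> a * (k\<^sup>2 * a\<^sup>2 - k\<^sup>2 * a ^ 4)"
    proof -
      have "(sech1 k x)\<^sup>2 = k\<^sup>2 * a\<^sup>2 - k\<^sup>2 * a ^ 4" unfolding sech1_square a_def by (simp add: algebra_simps)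
      then show ?thesis using s
        by (metis abs_mult abs_of_nonneg mult_right_mono zero_le_power2)
    qed
    moreover have "s\<^sup>2 * sech2 k x \<le> a\<^sup>2 * (k\<^sup>2 * a)" "- (s\<^sup>2 * sech2 k x) \<le> a\<^sup>2 * (k\<^sup>2 * a)"
    proof -
      have "\<bar>s\<^sup>2 * sech2 k x\<bar> \<le> a\<^sup>2 * (k\<^sup>2 * a)"
        unfolding abs_mult using s2 b(2) by (intro mult_mono) auto
      then show "s\<^sup>2 * sech2 k x \<le> a\<^sup>2 * (k\<^sup>2 * a)" "- (s\<^sup>2 * sech2 k x) \<le> a\<^sup>2 * (k\<^sup>2 * a)" by (simp_all
          add: abs_le_iff)
    qed
    moreover have "a\<^sup>2 * (k\<^sup>2 * a) = k\<^sup>2 * a ^ 3" "a * (k\<^sup>2 * a\<^sup>2 - k\<^sup>2 * a ^ 4) = k\<^sup>2 * a ^ 3 - k\<^sup>2 * a ^ 5"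
      by (simp_all add: power2_eq_square power3_eq_cube power4_eq_xxxx eval_nat_numeral algebra_simps)
    moreover have "0 \<le> k\<^sup>2 * a ^ 5" "0 \<le> k\<^sup>2 * a ^ 3" using a by auto
    ultimately have "\<bar>6 * (s * (sech1 k x)\<^sup>2) + 3 * (s\<^sup>2 * sech2 k x)\<bar> \<le> 9 * (k\<^sup>2 * a ^ 3)" by linarith
    then have 3: "\<bar>cut_sech2 k e x\<bar> \<le> 9 * k\<^sup>2 * a ^ 3"
      unfolding cut_sech2_def a_def[symmetric] s_def[symmetric] by (simp add: mult.assoc)
    show ?thesis using 1 2 3 by simp
  qed
  have t0: "cut_sech k 0 x = a ^ 3" unfolding cut_sech_def a_def[symmetric] m0 by simp
  have "9 * k\<^sup>2 * a ^ 3 \<le> 12 * k\<^sup>2 * a\<^sup>2" using a3 a by (intro mult_mono) auto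
  moreover have "1 * a ^ 3 \<le> 12 * k\<^sup>2 * a\<^sup>2" using a3 a k2 by (intro mult_mono) auto
  ultimately show "\<bar>cut_sech k e x\<bar> \<le> 12 * k\<^sup>2 * (sech k x)\<^sup>2" "\<bar>cut_sech1 k e x\<bar> \<le> 12 * k\<^sup>2 * (sech k x)\<^sup>2"
    "\<bar>cut_sech2 k e x\<bar> \<le> 12 * k\<^sup>2 * (sech k x)\<^sup>2"
    using gen[OF e] unfolding t0 a_def[symmetric] by linarith+
  show "\<bar>cut_sech1 k 0 x\<bar> \<le> 9 * k\<^sup>2 * cut_sech k 0 x" "\<bar>cut_sech2 k 0 x\<bar> \<le> 9 * k\<^sup>2 * cut_sech k 0 x"
    using gen[of 0] t0 by simp_all
qed

lemma cut_sech_cont: "continuous_on S (cut_sech k e)" "continuous_on S (cut_sech1 k e)" "continuous_on S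
    (cut_sech2 k e)"
proof -
  have c1: "continuous_on S (sech1 k)"
    by (rule continuous_on_subset[of UNIV])
       (auto intro!: continuous_at_imp_continuous_on DERIV_isCont[OF sech_deriv(2)])
  show "continuous_on S (cut_sech k e)" "continuous_on S (cut_sech1 k e)" "continuous_on S (cut_sech2 k e)"
    unfolding cut_sech_def cut_sech1_def cut_sech2_def sech2_def
    by (intro continuous_intros sech_cont c1)+
qed

text \<open>
  The truncation errors are of size \<open>e\<close> times the square of \<open>sech k\<close>. For \<open>k \<ge> 2 * k0\<close> they are
  dominated by the cube of \<open>sech k0\<close>, for which the convolution is known to converge.
\<close>

lemma sech_square_le:
  assumes "k0 \<ge> 0" "k \<ge> 2 * k0"
  shows "(sech k x)\<^sup>2 \<le> cut_sech k0 0 x"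
proof -
  have c1: "1 \<le> cosh (k0 * x)" by (rule cosh_real_ge_1)
  have "cosh (2 * (k0 * x)) = 2 * (cosh (k0 * x))\<^sup>2 - 1" by (simp add: cosh_double sinh_square_eq)
  moreover have "1 \<le> (cosh (k0 * x))\<^sup>2" using c1 by (simp add: one_le_power)
  ultimately have "(cosh (k0 * x))\<^sup>2 \<le> cosh (2 * k0 * x)" by (simp add: mult.assoc)
  then have "((cosh (k0 * x))\<^sup>2)\<^sup>2 \<le> (cosh (2 * k0 * x))\<^sup>2" by (rule power_mono) simp
  moreover have "(cosh (k0 * x)) ^ 3 \<le> (cosh (k0 * x)) ^ 4" using c1 by (intro power_increasing) auto
  ultimately have c: "cosh (k0 * x) ^ 3 \<le> (cosh (2 * k0 * x))\<^sup>2" by (simp flip: power_mult)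
  have "(sech k x)\<^sup>2 \<le> (sech (2 * k0) x)\<^sup>2"
    using assms sech_bounds by (intro power_mono sech_antimono) (auto intro: less_imp_le)
  also have "\<dots> \<le> sech k0 x ^ 3"
    using c cosh_real_pos[of "k0 * x"] by (simp add: sech_def power_divide frac_le)
  also have "\<dots> = cut_sech k0 0 x" using sech_bounds[of k0 x] by (simp add: cut_sech_def)
  finally show ?thesis .
qed

lemma cut_sech0_shift:
  assumes "k \<ge> 0"
  shows "cut_sech k 0 (a - x) \<le> exp (3 * k * \<bar>x\<bar>) * cut_sech k 0 a"
proof -
  have cosh_shift: "cosh (u + v) \<le> exp \<bar>v\<bar> * cosh u" for u v :: real
  proof -
    have "exp (u + v) \<le> exp (u + \<bar>v\<bar>)" "exp (- (u + v)) \<le> exp (- u + \<bar>v\<bar>)" by auto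
    moreover have "exp \<bar>v\<bar> * (exp u + exp (- u)) = exp (u + \<bar>v\<bar>) + exp (- u + \<bar>v\<bar>)"
      unfolding distrib_left exp_add[symmetric] by (simp add: add.commute)
    ultimately have "exp (u + v) + exp (- (u + v)) \<le> exp \<bar>v\<bar> * (exp u + exp (- u))"
      by linarith
    then show ?thesis by (simp add: cosh_def)
  qed
  have "cosh (k * a) \<le> exp (k * \<bar>x\<bar>) * cosh (k * (a - x))"
    using cosh_shift[of "k * (a - x)" "k * x"] assms by (simp add: algebra_simps abs_mult)
  then have "sech k (a - x) \<le> exp (k * \<bar>x\<bar>) * sech k a"
    using cosh_real_pos[of "k * a"] cosh_real_pos[of "k * (a - x)"] by (simp add: sech_def field_simps)
  then have "sech k (a - x) ^ 3 \<le> (exp (k * \<bar>x\<bar>) * sech k a) ^ 3"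
    using sech_bounds[of k "a - x"] by (intro power_mono) auto
  also have "\<dots> = exp (3 * k * \<bar>x\<bar>) * sech k a ^ 3"
    by (simp add: power_mult_distrib mult.assoc flip: exp_of_nat_mult)
  finally show ?thesis using sech_bounds[of k a] sech_bounds[of k "a - x"] by (simp add: cut_sech_def)
qed

lemma conv_dominated:
  assumes u: "cont3 u" "\<And>x y z. 0 \<le> u x y z"
    and i: "integrable lborel (\<lambda>w. u (fst w) (snd w) z * (h (fst w - x) * l (snd w - y)))"
    and c: "continuous_on UNIV f" "continuous_on UNIV g"
    and le: "\<And>a b. \<bar>f a * g b\<bar> \<le> c * (h a * l b)"
  shows "integrable lborel (\<lambda>w. u (fst w) (snd w) z * (f (fst w - x) * g (snd w - y)))"
    and "\<bar>conv u f g x y z\<bar> \<le> c * conv u h l x y z"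
proof -
  have ic: "integrable lborel (\<lambda>w. c * (u (fst w) (snd w) z * (h (fst w - x) * l (snd w - y))))"
    using i by (rule integrable_mult_right)
  have b: "norm (u (fst w) (snd w) z * (f (fst w - x) * g (snd w - y)))
      \<le> c * (u (fst w) (snd w) z * (h (fst w - x) * l (snd w - y)))" for w
    using mult_left_mono[OF le[of "fst w - x" "snd w - y"] u(2)[of "fst w" "snd w" z]] u(2)[of "fst w"
        "snd w" z]
    by (simp add: abs_mult mult_ac)
  have "continuous_on UNIV (\<lambda>w. u (fst w) (snd w) z * (f (fst w - x) * g (snd w - y)))"
    by (rule conv_integrand_cont[OF u(1) c]) (intro continuous_intros)+
  then have meas: "(\<lambda>w. u (fst w) (snd w) z * (f (fst w - x) * g (snd w - y))) \<in> borel_measurable lborel"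
    by (auto intro: borel_measurable_continuous_onI)
  show int: "integrable lborel (\<lambda>w. u (fst w) (snd w) z * (f (fst w - x) * g (snd w - y)))"
  proof (rule Bochner_Integration.integrable_bound[OF ic meas], rule AE_I2)
    fix w show "norm (u (fst w) (snd w) z * (f (fst w - x) * g (snd w - y)))
       \<le> norm (c * (u (fst w) (snd w) z * (h (fst w - x) * l (snd w - y))))"
      using b[of w] unfolding real_norm_def by linarith
  qed
  have "norm (conv u f g x y z) \<le> (\<integral>w. c * (u (fst w) (snd w) z * (h (fst w - x) * l (snd w - y))) \<partial>lborel)"
    unfolding conv_def by (rule Bochner_Integration.integral_norm_bound_integral[OF int ic]) (rule b)
  then show "\<bar>conv u f g x y z\<bar> \<le> c * conv u h l x y z" by (simp add: conv_def)
qed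

text \<open>
  As $k\to\infty$ the kernels concentrate at the origin. Relative to the kernel with the parameter
  \<open>k1\<close>, they decay like $e^{-3(k-k1)d}$ outside of a square of side $2d$ around the origin, but are
  at least $e^{-3kd/2}$ on the square that is four times smaller.
\<close>

lemma vanishing_of_all_means:
  fixes v :: "real \<times> real \<Rightarrow> real"
  assumes vc: "continuous_on UNIV v" and k1: "k1 \<ge> 1"
    and i: "\<And>k. k \<ge> k1 \<Longrightarrow> integrable lborel (\<lambda>w. v w * (cut_sech k 0 (fst w) * cut_sech k 0 (snd w)))"
    and z: "\<And>k. k \<ge> k1 \<Longrightarrow> (\<integral>w. v w * (cut_sech k 0 (fst w) * cut_sech k 0 (snd w)) \<partial>lborel) = 0"
  shows "v 0 \<le> 0"
proof (rule ccontr)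
  assume "\<not> v 0 \<le> 0"
  then have v0: "v 0 > 0" by simp
  have "isCont v 0" using vc by (metis continuous_on_eq_continuous_at open_UNIV UNIV_I)
  then obtain r where r: "r > 0" "\<And>w. dist w 0 < r \<Longrightarrow> dist (v w) (v 0) < v 0 / 2"
    using v0 unfolding continuous_at_eps_delta by (metis half_gt_zero)
  define d where "d = r / 4"
  have d: "d > 0" using r by (simp add: d_def)
  have near: "v w \<ge> v 0 / 2" if "\<bar>fst w\<bar> \<le> d" "\<bar>snd w\<bar> \<le> d" for w
  proof -
    have "norm w \<le> norm (fst w) + norm (snd w)" by (metis norm_Pair_le prod.collapse)
    also have "\<dots> \<le> r / 4 + r / 4" using that by (simp add: d_def)
    also have "\<dots> < r" using r by simp
    finally have "dist (v w) (v 0) < v 0 / 2" by (intro r) simp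
    then show ?thesis unfolding dist_real_def abs_less_iff by linarith
  qed
  have se: "exp (- (k * \<bar>x\<bar>)) \<le> sech k x" "sech k x \<le> 2 * exp (- (k * \<bar>x\<bar>))" if "k \<ge> 0" for k x
  proof -
    have e: "k * \<bar>x\<bar> = \<bar>k * x\<bar>" using that by (simp add: abs_mult)
    have "cosh \<bar>k * x\<bar> \<le> exp \<bar>k * x\<bar>" unfolding cosh_def using exp_le_cancel_iff[of "- \<bar>k * x\<bar>" "\<bar>k *
        x\<bar>"] by simp
    moreover have "exp \<bar>k * x\<bar> / 2 \<le> cosh \<bar>k * x\<bar>" unfolding cosh_def by simp
    ultimately show "exp (- (k * \<bar>x\<bar>)) \<le> sech k x" "sech k x \<le> 2 * exp (- (k * \<bar>x\<bar>))"
      unfolding sech_def e exp_minus cosh_real_abs using cosh_real_pos[of "k * x"]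
      by (auto simp: field_simps)
  qed
  have t3: "cut_sech k 0 x = sech k x ^ 3" for k x using sech_bounds[of k x] by (simp add: cut_sech_def)
  have te: "exp (- (3 * k * \<bar>x\<bar>)) \<le> cut_sech k 0 x" "cut_sech k 0 x \<le> 8 * exp (- (3 * k * \<bar>x\<bar>))" if "k \<ge>
      0" for k x
  proof -
    have "exp (- (3 * k * \<bar>x\<bar>)) = exp (- (k * \<bar>x\<bar>)) ^ 3" by (simp flip: exp_of_nat_mult)
    moreover have "exp (- (k * \<bar>x\<bar>)) ^ 3 \<le> sech k x ^ 3" using se[OF that, of x] by (intro power_mono) auto
    moreover have "sech k x ^ 3 \<le> (2 * exp (- (k * \<bar>x\<bar>))) ^ 3"
      using se[OF that, of x] sech_bounds[of k x] by (intro power_mono) auto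
    ultimately show "exp (- (3 * k * \<bar>x\<bar>)) \<le> cut_sech k 0 x" "cut_sech k 0 x \<le> 8 * exp (- (3 * k * \<bar>x\<bar>))"
      by (simp_all add: t3 power_mult_distrib)
  qed
  have tp: "0 < cut_sech k 0 x" for k x using sech_bounds[of k x] by (simp add: t3)
  let ?P = "\<lambda>w. cut_sech k1 0 (fst w) * cut_sech k1 0 (snd w)"
  define I where "I = (\<integral>w. \<bar>v w * ?P w\<bar> \<partial>lborel)"
  have I: "integrable lborel (\<lambda>w. \<bar>v w * ?P w\<bar>)" using i[of k1] by (intro integrable_abs) simp
  have I0: "I \<ge> 0" by (simp add: I_def)
  have ineq: "v 0 / 2 * d\<^sup>2 / 4 \<le> 64 * exp (3 * k1 * d) * I * exp (- (3 / 2 * k * d))" if k: "k \<ge> k1" for k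
  proof -
    have k0: "k \<ge> 0" "k1 \<ge> 0" using k k1 by auto
    define E where "E = 64 * exp (- (3 * (k - k1) * d))"
    let ?Q = "\<lambda>w. cut_sech k 0 (fst w) * cut_sech k 0 (snd w)"
    let ?B = "cbox (- (d / 4), - (d / 4)) (d / 4, d / 4) :: (real \<times> real) set"
    define c where "c = v 0 / 2 * exp (- (3 / 2 * k * d))"
    have c0: "c \<ge> 0" using v0 by (simp add: c_def)
    have pt: "c * indicator ?B w \<le> v w * ?Q w + E * \<bar>v w * ?P w\<bar>" for w
    proof (cases "\<bar>fst w\<bar> \<le> d \<and> \<bar>snd w\<bar> \<le> d")
      case True
      then have vw: "v w \<ge> v 0 / 2" using near by simp
      have rest: "0 \<le> E * \<bar>v w * ?P w\<bar>" by (simp add: E_def)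
      show ?thesis
      proof (cases "w \<in> ?B")
        case True
        then have b: "\<bar>fst w\<bar> \<le> d / 4" "\<bar>snd w\<bar> \<le> d / 4" by (cases w, auto simp: cbox_Pair_eq)+
        have "3 * k * \<bar>fst w\<bar> \<le> 3 * k * (d / 4)" "3 * k * \<bar>snd w\<bar> \<le> 3 * k * (d / 4)"
          using b k0 by (intro mult_left_mono; simp)+
        then have "exp (- (3 / 2 * k * d)) \<le> exp (- (3 * k * \<bar>fst w\<bar>)) * exp (- (3 * k * \<bar>snd w\<bar>))"
          unfolding exp_add[symmetric] exp_le_cancel_iff by linarith
        also have "\<dots> \<le> ?Q w" using te[OF k0(1)] tp by (intro mult_mono) (auto intro: less_imp_le)
        finally have "c \<le> v w * ?Q w" unfolding c_def using vw v0 by (intro mult_mono) auto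
        then show ?thesis using True rest by simp
      next
        case False
        have "0 \<le> v w * ?Q w" using vw v0 tp by (intro mult_nonneg_nonneg) (auto intro: less_imp_le)
        then show ?thesis using False rest by simp
      qed
    next
      case False
      then have far: "d \<le> \<bar>fst w\<bar> + \<bar>snd w\<bar>" by linarith
      have notB: "w \<notin> ?B" using False d by (cases w) (auto simp: cbox_Pair_eq)
      have "?Q w \<le> (8 * exp (- (3 * k * \<bar>fst w\<bar>))) * (8 * exp (- (3 * k * \<bar>snd w\<bar>)))"
        using te[OF k0(1)] tp by (intro mult_mono) (auto intro: less_imp_le)
      also have "\<dots> = 64 * exp (- (3 * (k - k1) * (\<bar>fst w\<bar> + \<bar>snd w\<bar>))) * (exp (- (3 * k1 * \<bar>fst w\<bar>)) *
          exp (- (3 * k1 * \<bar>snd w\<bar>)))"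
        by (simp add: algebra_simps flip: exp_add)
      also have "\<dots> \<le> E * ?P w"
      proof (rule mult_mono)
        have "3 * (k - k1) * d \<le> 3 * (k - k1) * (\<bar>fst w\<bar> + \<bar>snd w\<bar>)" using far k by (intro
            mult_left_mono) auto
        then show "64 * exp (- (3 * (k - k1) * (\<bar>fst w\<bar> + \<bar>snd w\<bar>))) \<le> E" by (simp add: E_def)
        show "exp (- (3 * k1 * \<bar>fst w\<bar>)) * exp (- (3 * k1 * \<bar>snd w\<bar>)) \<le> ?P w"
          using te[OF k0(2)] tp by (intro mult_mono) (auto intro: less_imp_le)
      qed (auto simp: E_def)
      finally have QE: "?Q w \<le> E * ?P w" .
      have "\<bar>v w * ?Q w\<bar> = \<bar>v w\<bar> * ?Q w" using tp[of k "fst w"] tp[of k "snd w"] by (simp add: abs_mult)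
      also have "\<dots> \<le> \<bar>v w\<bar> * (E * ?P w)" using QE by (rule mult_left_mono) simp
      also have "\<dots> = E * \<bar>v w * ?P w\<bar>" using tp[of k1 "fst w"] tp[of k1 "snd w"] by (simp add: abs_mult)
      finally have "- (v w * ?Q w) \<le> E * \<bar>v w * ?P w\<bar>" by linarith
      then show ?thesis using notB by simp
    qed
    have iB: "integrable lborel (\<lambda>w. c * indicator ?B w)"
      by (intro integrable_mult_right integrable_real_indicator) (use emeasure_lborel_cbox_finite in
          \<open>auto simp: infinity_ennreal_def\<close>)
    have "(\<integral>w. c * indicator ?B w \<partial>lborel) \<le> (\<integral>w. v w * ?Q w + E * \<bar>v w * ?P w\<bar> \<partial>lborel)"
      by (rule integral_mono[OF iB]) (use i[OF k] I pt in auto)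
    also have "\<dots> = E * I" using i[OF k] I z[OF k] by (simp add: I_def)
    also have "(\<integral>w. c * indicator ?B w \<partial>lborel) = c * (d / 2)\<^sup>2"
      using d by (simp add: content_Pair power2_eq_square)
    finally have "v 0 / 2 * (d / 2)\<^sup>2 * exp (- (3 / 2 * k * d)) \<le> 64 * exp (3 * k1 * d - 3 * k * d) * I"
      by (simp add: c_def E_def algebra_simps)
    then have "v 0 / 2 * (d / 2)\<^sup>2 * exp (- (3 / 2 * k * d)) * exp (3 / 2 * k * d)
        \<le> 64 * exp (3 * k1 * d - 3 * k * d) * I * exp (3 / 2 * k * d)" by (intro mult_right_mono) auto
    moreover have "exp (3 * k1 * d - 3 * k * d) * exp (3 / 2 * k * d) = exp (3 * k1 * d) * exp (- (3 / 2
        * k * d))"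
      by (simp flip: exp_add)
    ultimately show ?thesis
      by (simp add: power_divide mult_ac flip: exp_add)
  qed
  have "((\<lambda>k. 64 * exp (3 * k1 * d) * I * exp (- (3 / 2 * k * d))) \<longlongrightarrow> 64 * exp (3 * k1 * d) * I * 0) at_top"
  proof (intro tendsto_mult_left)
    have "LIM k at_top. 3 / 2 * d * k :> at_top"
      using d by (intro filterlim_tendsto_pos_mult_at_top[OF tendsto_const] filterlim_ident) auto
    then have "((\<lambda>k. exp (- (3 / 2 * d * k))) \<longlongrightarrow> 0) at_top"
      by (intro filterlim_compose[OF exp_at_bot] filterlim_uminus_at_bot_at_top[THEN filterlim_compose])
    then show "((\<lambda>k. exp (- (3 / 2 * k * d))) \<longlongrightarrow> 0) at_top" by (simp add: mult_ac)
  qed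
  then have ev: "\<forall>\<^sub>F k in at_top. 64 * exp (3 * k1 * d) * I * exp (- (3 / 2 * k * d)) < v 0 / 2 * d\<^sup>2 / 4"
    by (rule order_tendstoD) (use v0 d in simp)
  obtain k where "k \<ge> k1" "64 * exp (3 * k1 * d) * I * exp (- (3 / 2 * k * d)) < v 0 / 2 * d\<^sup>2 / 4"
    using eventually_happens'[OF _ eventually_conj[OF eventually_ge_at_top[of k1] ev]] by auto
  then show False using ineq[of k] by linarith
qed

section \<open>Vanishing of the mixed differences\<close>

lemma lborel_integrable_shift:
  fixes F :: "real \<times> real \<Rightarrow> real"
  assumes "integrable lborel F"
  shows "integrable lborel (\<lambda>w. F (c + w))"
proof -
  have "integrable (distr lborel borel ((+) c)) F" using assms by (simp add: lborel_distr_plus)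
  then show ?thesis
    by (rule integrable_distr[rotated]) simp
qed

context pos_eigenfunction
begin

context
  fixes k0 :: real
  assumes k0: "k0 \<ge> 2"
    and bound: "\<And>R. R \<ge> 0 \<Longrightarrow> \<exists>C. \<forall>z. \<bar>z\<bar> \<le> R \<longrightarrow>
     integrable lborel (\<lambda>w. u (fst w) (snd w) z * (cut_sech k0 0 (fst w) * cut_sech k0 0 (snd w))) \<and>
     conv u (cut_sech k0 0) (cut_sech k0 0) 0 0 z \<le> C"
begin

lemma base_integrable:
  "integrable lborel (\<lambda>w. u (fst w) (snd w) z * (cut_sech k0 0 (fst w - x) * cut_sech k0 0 (snd w - y)))"
  "conv u (cut_sech k0 0) (cut_sech k0 0) x y z
    \<le> exp (3 * k0 * \<bar>x\<bar>) * exp (3 * k0 * \<bar>y\<bar>) * conv u (cut_sech k0 0) (cut_sech k0 0) 0 0 z"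
proof -
  have i0: "integrable lborel (\<lambda>w. u (fst w) (snd w) z * (cut_sech k0 0 (fst w - 0) * cut_sech k0 0 (snd
      w - 0)))"
    using bound[of "\<bar>z\<bar>"] by auto
  have c: "continuous_on UNIV (\<lambda>a. cut_sech k0 0 (a - b))" for b
    by (rule continuous_on_compose2[OF cut_sech_cont(1)[of UNIV]]) (auto intro!: continuous_intros)
  have t: "0 \<le> cut_sech k0 0 a" for a by (rule cut_sech_bounds) simp
  have le: "\<bar>cut_sech k0 0 (a - x) * cut_sech k0 0 (b - y)\<bar>
      \<le> exp (3 * k0 * \<bar>x\<bar>) * exp (3 * k0 * \<bar>y\<bar>) * (cut_sech k0 0 a * cut_sech k0 0 b)" for a b
  proof -
    have "cut_sech k0 0 (a - x) * cut_sech k0 0 (b - y)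
       \<le> (exp (3 * k0 * \<bar>x\<bar>) * cut_sech k0 0 a) * (exp (3 * k0 * \<bar>y\<bar>) * cut_sech k0 0 b)"
      using k0 t by (intro mult_mono cut_sech0_shift) auto
    then show ?thesis using t[of "a - x"] t[of "b - y"] by (simp add: abs_mult mult_ac)
  qed
  show "integrable lborel (\<lambda>w. u (fst w) (snd w) z * (cut_sech k0 0 (fst w - x) * cut_sech k0 0 (snd w - y)))"
    using conv_dominated(1)[OF cont(1) nonneg i0 c c le] by simp
  have "conv u (\<lambda>a. cut_sech k0 0 (a - x)) (\<lambda>b. cut_sech k0 0 (b - y)) 0 0 z = conv u (cut_sech k0 0)
      (cut_sech k0 0) x y z"
    by (simp add: conv_def)
  then show "conv u (cut_sech k0 0) (cut_sech k0 0) x y z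
    \<le> exp (3 * k0 * \<bar>x\<bar>) * exp (3 * k0 * \<bar>y\<bar>) * conv u (cut_sech k0 0) (cut_sech k0 0) 0 0 z"
    using conv_dominated(2)[OF cont(1) nonneg i0 c c le] by simp
qed

lemma base_bound:
  "\<exists>B. \<forall>x y z. \<bar>x\<bar> \<le> R \<longrightarrow> \<bar>y\<bar> \<le> R \<longrightarrow> \<bar>z\<bar> \<le> R \<longrightarrow> conv u (cut_sech k0 0) (cut_sech k0 0) x y z \<le> B"
proof -
  obtain C where C: "\<And>z. \<bar>z\<bar> \<le> \<bar>R\<bar> \<Longrightarrow> conv u (cut_sech k0 0) (cut_sech k0 0) 0 0 z \<le> C"
    using bound[of "\<bar>R\<bar>"] by auto
  have "conv u (cut_sech k0 0) (cut_sech k0 0) x y z \<le> exp (3 * k0 * R) * exp (3 * k0 * R) * \<bar>C\<bar>"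
    if xyz: "\<bar>x\<bar> \<le> R" "\<bar>y\<bar> \<le> R" "\<bar>z\<bar> \<le> R" for x y z
  proof -
    note base_integrable(2)[of x y z]
    also have "exp (3 * k0 * \<bar>x\<bar>) * exp (3 * k0 * \<bar>y\<bar>) * conv u (cut_sech k0 0) (cut_sech k0 0) 0 0 z
       \<le> exp (3 * k0 * R) * exp (3 * k0 * R) * \<bar>C\<bar>"
    proof (rule mult_mono)
      show "exp (3 * k0 * \<bar>x\<bar>) * exp (3 * k0 * \<bar>y\<bar>) \<le> exp (3 * k0 * R) * exp (3 * k0 * R)"
        using k0 xyz by (intro mult_mono) auto
      show "conv u (cut_sech k0 0) (cut_sech k0 0) 0 0 z \<le> \<bar>C\<bar>" using C[of z] xyz by linarith
      show "0 \<le> conv u (cut_sech k0 0) (cut_sech k0 0) 0 0 z"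
        by (rule conv_nonneg) (auto intro: nonneg cut_sech_bounds)
    qed simp
    finally show ?thesis .
  qed
  then show ?thesis by blast
qed

lemma conv_loc_unif:
  fixes f g :: "real \<Rightarrow> real \<Rightarrow> real"
  assumes k: "k \<ge> 2 * k0"
    and fc: "\<And>e. continuous_on UNIV (f e)" and gc: "\<And>e. continuous_on UNIV (g e)"
    and M: "M \<ge> 0"
    and f: "\<And>e a. e \<ge> 0 \<Longrightarrow> \<bar>f e a\<bar> \<le> M * (sech k a)\<^sup>2" "\<And>e a. e \<ge> 0 \<Longrightarrow> \<bar>f e a - f 0 a\<bar> \<le> M * e * (sech k a)\<^sup>2"
    and g: "\<And>e a. e \<ge> 0 \<Longrightarrow> \<bar>g e a\<bar> \<le> M * (sech k a)\<^sup>2" "\<And>e a. e \<ge> 0 \<Longrightarrow> \<bar>g e a - g 0 a\<bar> \<le> M * e * (sech k a)\<^sup>2"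
  shows "loc_unif (\<lambda>n. conv u (f (1 / real (Suc n))) (g (1 / real (Suc n)))) (conv u (f 0) (g 0))"
proof -
  let ?\<phi> = "cut_sech k0 0"
  have sq: "0 \<le> (sech k a)\<^sup>2" "(sech k a)\<^sup>2 \<le> ?\<phi> a" "0 \<le> ?\<phi> a" for a
    using sech_square_le[of k0 k a] k k0 cut_sech_bounds[of 0 k0 a] by auto
  have prod: "(sech k a)\<^sup>2 * (sech k b)\<^sup>2 \<le> ?\<phi> a * ?\<phi> b" for a b
    using sq by (intro mult_mono) auto
  have int: "integrable lborel (\<lambda>w. u (fst w) (snd w) z * (f e (fst w - x) * g e (snd w - y)))" if e: "e
      \<ge> 0" for e x y z
  proof (rule conv_dominated(1)[OF cont(1) nonneg base_integrable(1) fc gc])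
    fix a b
    have "\<bar>f e a * g e b\<bar> \<le> (M * (sech k a)\<^sup>2) * (M * (sech k b)\<^sup>2)"
      unfolding abs_mult using f(1)[OF e] g(1)[OF e] M sq by (intro mult_mono) auto
    also have "\<dots> = M\<^sup>2 * ((sech k a)\<^sup>2 * (sech k b)\<^sup>2)" by (simp add: power2_eq_square)
    also have "\<dots> \<le> M\<^sup>2 * (?\<phi> a * ?\<phi> b)" using prod by (intro mult_left_mono) auto
    finally show "\<bar>f e a * g e b\<bar> \<le> M\<^sup>2 * (?\<phi> a * ?\<phi> b)" .
  qed
  have diff: "\<bar>conv u (f e) (g e) x y z - conv u (f 0) (g 0) x y z\<bar> \<le> 2 * M\<^sup>2 * e * conv u ?\<phi> ?\<phi> x y z"
      if e: "e \<ge> 0" for e x y z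
  proof -
    have pt: "\<bar>f e a * g e b - f 0 a * g 0 b\<bar> \<le> 2 * M\<^sup>2 * e * (?\<phi> a * ?\<phi> b)" for a b
    proof -
      have "\<bar>(f e a - f 0 a) * g e b\<bar> \<le> (M * e * (sech k a)\<^sup>2) * (M * (sech k b)\<^sup>2)"
        unfolding abs_mult using f(2)[OF e] g(1)[OF e] M sq e by (intro mult_mono) auto
      moreover have "\<bar>f 0 a * (g e b - g 0 b)\<bar> \<le> (M * (sech k a)\<^sup>2) * (M * e * (sech k b)\<^sup>2)"
        unfolding abs_mult using f(1)[of 0 a] g(2)[OF e] M sq e by (intro mult_mono) auto
      moreover have "f e a * g e b - f 0 a * g 0 b = (f e a - f 0 a) * g e b + f 0 a * (g e b - g 0 b)"
        by (simp add: algebra_simps)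
      ultimately have "\<bar>f e a * g e b - f 0 a * g 0 b\<bar>
         \<le> (M * e * (sech k a)\<^sup>2) * (M * (sech k b)\<^sup>2) + (M * (sech k a)\<^sup>2) * (M * e * (sech k b)\<^sup>2)"
        by linarith
      also have "\<dots> = 2 * M\<^sup>2 * e * ((sech k a)\<^sup>2 * (sech k b)\<^sup>2)" by (simp add: power2_eq_square)
      also have "\<dots> \<le> 2 * M\<^sup>2 * e * (?\<phi> a * ?\<phi> b)" using prod e by (intro mult_left_mono) auto
      finally show ?thesis .
    qed
    let ?W = "\<lambda>w. u (fst w) (snd w) z * (?\<phi> (fst w - x) * ?\<phi> (snd w - y))"
    let ?D = "\<lambda>w. u (fst w) (snd w) z * (f e (fst w - x) * g e (snd w - y))
        - u (fst w) (snd w) z * (f 0 (fst w - x) * g 0 (snd w - y))"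
    have "norm (\<integral>w. ?D w \<partial>lborel) \<le> (\<integral>w. 2 * M\<^sup>2 * e * ?W w \<partial>lborel)"
    proof (rule Bochner_Integration.integral_norm_bound_integral)
      show "integrable lborel ?D" by (intro Bochner_Integration.integrable_diff int e) simp
      show "integrable lborel (\<lambda>w. 2 * M\<^sup>2 * e * ?W w)" by (intro integrable_mult_right base_integrable)
      fix w
      have "norm (?D w) = u (fst w) (snd w) z * \<bar>f e (fst w - x) * g e (snd w - y) - f 0 (fst w - x) * g
          0 (snd w - y)\<bar>"
        using nonneg[of "fst w" "snd w" z] by (simp add: abs_mult flip: right_diff_distrib)
      also have "\<dots> \<le> u (fst w) (snd w) z * (2 * M\<^sup>2 * e * (?\<phi> (fst w - x) * ?\<phi> (snd w - y)))"
        by (intro mult_left_mono pt nonneg)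
      finally show "norm (?D w) \<le> 2 * M\<^sup>2 * e * ?W w" by (simp add: mult_ac)
    qed
    moreover have "(\<integral>w. ?D w \<partial>lborel) = conv u (f e) (g e) x y z - conv u (f 0) (g 0) x y z"
      unfolding conv_def by (intro Bochner_Integration.integral_diff int e) simp
    ultimately show ?thesis by (simp add: conv_def)
  qed
  show ?thesis
    unfolding loc_unif_def
  proof (intro allI impI)
    fix R e :: real assume e: "e > 0"
    obtain B where B: "\<And>x y z. \<bar>x\<bar> \<le> R \<Longrightarrow> \<bar>y\<bar> \<le> R \<Longrightarrow> \<bar>z\<bar> \<le> R \<Longrightarrow> conv u ?\<phi> ?\<phi> x y z \<le> B"
      using base_bound by blast
    obtain N where N: "2 * M\<^sup>2 * \<bar>B\<bar> / e < real N" using reals_Archimedean2 by blast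
    show "\<exists>N. \<forall>n\<ge>N. \<forall>x y z. \<bar>x\<bar> \<le> R \<longrightarrow> \<bar>y\<bar> \<le> R \<longrightarrow> \<bar>z\<bar> \<le> R \<longrightarrow>
       \<bar>conv u (f (1 / real (Suc n))) (g (1 / real (Suc n))) x y z - conv u (f 0) (g 0) x y z\<bar> \<le> e"
    proof (intro exI[of _ N] allI impI)
      fix n x y z assume *: "N \<le> n" "\<bar>x\<bar> \<le> R" "\<bar>y\<bar> \<le> R" "\<bar>z\<bar> \<le> R"
      have "\<bar>conv u (f (1 / real (Suc n))) (g (1 / real (Suc n))) x y z - conv u (f 0) (g 0) x y z\<bar>
         \<le> 2 * M\<^sup>2 * (1 / real (Suc n)) * conv u ?\<phi> ?\<phi> x y z" by (rule diff) simp
      also have "\<dots> \<le> 2 * M\<^sup>2 * (1 / real (Suc n)) * \<bar>B\<bar>"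
        using B[OF *(2-4)] by (intro mult_left_mono) auto
      also have "\<dots> = 2 * M\<^sup>2 * \<bar>B\<bar> / real (Suc n)" by simp
      also have "\<dots> \<le> e"
      proof -
        have "2 * M\<^sup>2 * \<bar>B\<bar> / e \<le> real (Suc n)" using N *(1) by linarith
        then show ?thesis using e by (simp add: field_simps)
      qed
      finally show "\<bar>conv u (f (1 / real (Suc n))) (g (1 / real (Suc n))) x y z - conv u (f 0) (g 0) x y
          z\<bar> \<le> e" .
    qed
  qed
qed

text \<open>
  The relations \<open>cut_sech_sizes(4,5)\<close> between the kernel and its derivatives become the bounds on the
  logarithmic derivatives that \<open>mixed_difference_zero\<close> needs.
\<close>

lemma smoothed_mixed_difference:
  assumes k: "k \<ge> 2 * k0"
  shows "integrable lborel (\<lambda>w. u (fst w) (snd w) z * (cut_sech k 0 (fst w - x) * cut_sech k 0 (snd w - y)))"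
    and "conv u (cut_sech k 0) (cut_sech k 0) (x + s) (y + t) z - conv u (cut_sech k 0) (cut_sech k 0) x
        (y + t) z
      - (conv u (cut_sech k 0) (cut_sech k 0) (x + s) y z - conv u (cut_sech k 0) (cut_sech k 0) x y z) = 0"
proof -
  let ?T = "cut_sech k 0"
  have k1: "k \<ge> 1" using k k0 by simp
  have kpos: "k > 0" using k1 by simp
  have t0: "0 \<le> ?T a" for a by (rule cut_sech_bounds) simp
  have int: "integrable lborel (\<lambda>w. u (fst w) (snd w) z * (?T (fst w - x) * ?T (snd w - y)))" for x y z
  proof (rule conv_dominated(1)[OF cont(1) nonneg base_integrable(1) cut_sech_cont(1) cut_sech_cont(1)])
    fix a b
    have "?T a \<le> cut_sech k0 0 a" for a
    proof -
      have "?T a \<le> sech k a ^ 3" by (rule cut_sech_bounds) simp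
      also have "\<dots> \<le> (sech k a)\<^sup>2" using sech_bounds[of k a] by (intro power_decreasing) auto
      also have "\<dots> \<le> cut_sech k0 0 a" using k k0 by (intro sech_square_le) auto
      finally show ?thesis .
    qed
    then have "?T a * ?T b \<le> cut_sech k0 0 a * cut_sech k0 0 b"
      using t0 cut_sech_bounds(1)[of 0 k0] by (intro mult_mono) auto
    then show "\<bar>?T a * ?T b\<bar> \<le> 1 * (cut_sech k0 0 a * cut_sech k0 0 b)" using t0 by simp
  qed
  then show "integrable lborel (\<lambda>w. u (fst w) (snd w) z * (?T (fst w - x) * ?T (snd w - y)))" .
  define M where "M = 12 * k\<^sup>2"
  have M: "M \<ge> 0" by (simp add: M_def)
  note sz = cut_sech_sizes(1,2,3)[OF k1, folded M_def] and df = cut_sech_diff_bounds[OF k1, folded M_def]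
  have df1: "\<bar>- cut_sech1 k e a - - cut_sech1 k 0 a\<bar> \<le> M * e * (sech k a)\<^sup>2" if "e \<ge> 0" for e a
    using df(2)[OF that, of a] by (simp add: abs_minus_commute)
  have sz1: "\<bar>- cut_sech1 k e a\<bar> \<le> M * (sech k a)\<^sup>2" if "e \<ge> 0" for e a using sz(2)[OF that, of a] by simp
  have c1: "continuous_on UNIV (\<lambda>x. - cut_sech1 k e x)" for e by (intro continuous_on_minus cut_sech_cont)
  let ?e = "\<lambda>n. 1 / real (Suc n)"
  have "\<exists>Uz0 Uzz0. eigenfunction p q m (conv u ?T ?T) (conv u (\<lambda>x. - cut_sech1 k 0 x) ?T) (conv u
      (cut_sech2 k 0) ?T)
      (conv u ?T (\<lambda>x. - cut_sech1 k 0 x)) (conv u ?T (cut_sech2 k 0)) Uz0 Uzz0"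
  proof (rule eigenfunction_limit)
    fix n
    show "eigenfunction p q m (conv u (cut_sech k (?e n)) (cut_sech k (?e n))) (conv u (\<lambda>x. - cut_sech1
        k (?e n) x) (cut_sech k (?e n)))
      (conv u (cut_sech2 k (?e n)) (cut_sech k (?e n))) (conv u (cut_sech k (?e n)) (\<lambda>x. - cut_sech1 k
          (?e n) x))
      (conv u (cut_sech k (?e n)) (cut_sech2 k (?e n))) (conv uz (cut_sech k (?e n)) (cut_sech k (?e
          n))) (conv uzz (cut_sech k (?e n)) (cut_sech k (?e n)))"
      by (rule eigenfunction_conv[OF eigenfunction_axioms]) (rule cut_sech_kernel[OF kpos _ order_refl],
          simp)+
  next
    show "loc_unif (\<lambda>n. conv u (cut_sech k (?e n)) (cut_sech k (?e n))) (conv u ?T ?T)"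
      by (rule conv_loc_unif[where f = "\<lambda>e. cut_sech k e" and g = "\<lambda>e. cut_sech k e", OF k
          cut_sech_cont(1) cut_sech_cont(1) M sz(1) df(1) sz(1) df(1)])
    show "loc_unif (\<lambda>n. conv u (\<lambda>x. - cut_sech1 k (?e n) x) (cut_sech k (?e n))) (conv u (\<lambda>x. -
        cut_sech1 k 0 x) ?T)"
      by (rule conv_loc_unif[where f = "\<lambda>e x. - cut_sech1 k e x" and g = "\<lambda>e. cut_sech k e", OF k c1
          cut_sech_cont(1) M sz1 df1 sz(1) df(1)])
    show "loc_unif (\<lambda>n. conv u (cut_sech2 k (?e n)) (cut_sech k (?e n))) (conv u (cut_sech2 k 0) ?T)"
      by (rule conv_loc_unif[where f = "\<lambda>e. cut_sech2 k e" and g = "\<lambda>e. cut_sech k e", OF k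
          cut_sech_cont(3) cut_sech_cont(1) M sz(3) df(3) sz(1) df(1)])
    show "loc_unif (\<lambda>n. conv u (cut_sech k (?e n)) (\<lambda>x. - cut_sech1 k (?e n) x)) (conv u ?T (\<lambda>x. -
        cut_sech1 k 0 x))"
      by (rule conv_loc_unif[where f = "\<lambda>e. cut_sech k e" and g = "\<lambda>e x. - cut_sech1 k e x", OF k
          cut_sech_cont(1) c1 M sz(1) df(1) sz1 df1])
    show "loc_unif (\<lambda>n. conv u (cut_sech k (?e n)) (cut_sech2 k (?e n))) (conv u ?T (cut_sech2 k 0))"
      by (rule conv_loc_unif[where f = "\<lambda>e. cut_sech k e" and g = "\<lambda>e. cut_sech2 k e", OF k
          cut_sech_cont(1) cut_sech_cont(3) M sz(1) df(1) sz(3) df(3)])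
  qed
  then obtain Uz0 Uzz0 where E: "eigenfunction p q m (conv u ?T ?T) (conv u (\<lambda>x. - cut_sech1 k 0 x) ?T)
      (conv u (cut_sech2 k 0) ?T)
      (conv u ?T (\<lambda>x. - cut_sech1 k 0 x)) (conv u ?T (cut_sech2 k 0)) Uz0 Uzz0" by blast
  note rel = cut_sech_sizes(4,5)[OF k1 order_refl]
  have l: "\<bar>f a * ?T b\<bar> \<le> 9 * k\<^sup>2 * (?T a * ?T b)" "\<bar>?T b * f a\<bar> \<le> 9 * k\<^sup>2 * (?T b * ?T a)"
    if "\<bar>f a\<bar> \<le> 9 * k\<^sup>2 * ?T a" for f :: "real \<Rightarrow> real" and a b
    using mult_right_mono[OF that t0[of b]] t0[of b] by (simp_all add: abs_mult mult_ac)
  show "conv u ?T ?T (x + s) (y + t) z - conv u ?T ?T x (y + t) z - (conv u ?T ?T (x + s) y z - conv u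
      ?T ?T x y z) = 0"
  proof (rule mixed_difference_zero[OF E p q m, where K = "9 * k\<^sup>2"])
    show "0 \<le> conv u ?T ?T x y z" for x y z by (rule conv_nonneg) (auto intro: nonneg t0)
    show "0 \<le> 9 * k\<^sup>2" by simp
    show "\<bar>conv u (\<lambda>x. - cut_sech1 k 0 x) ?T x y z\<bar> \<le> 9 * k\<^sup>2 * conv u ?T ?T x y z" for x y z
    proof (rule conv_dominated(2)[OF cont(1) nonneg int c1 cut_sech_cont(1)])
      show "\<bar>(- cut_sech1 k 0 a) * ?T b\<bar> \<le> 9 * k\<^sup>2 * (?T a * ?T b)" for a b
        using l[of "cut_sech1 k 0" a b] rel[of a] by simp
    qed
    show "\<bar>conv u ?T (\<lambda>x. - cut_sech1 k 0 x) x y z\<bar> \<le> 9 * k\<^sup>2 * conv u ?T ?T x y z" for x y z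
    proof (rule conv_dominated(2)[OF cont(1) nonneg int cut_sech_cont(1) c1])
      show "\<bar>?T a * (- cut_sech1 k 0 b)\<bar> \<le> 9 * k\<^sup>2 * (?T a * ?T b)" for a b
        using l[of "cut_sech1 k 0" b a] rel[of b] by simp
    qed
    show "\<bar>conv u (cut_sech2 k 0) ?T x y z\<bar> \<le> 9 * k\<^sup>2 * conv u ?T ?T x y z" for x y z
    proof (rule conv_dominated(2)[OF cont(1) nonneg int cut_sech_cont(3) cut_sech_cont(1)])
      show "\<bar>cut_sech2 k 0 a * ?T b\<bar> \<le> 9 * k\<^sup>2 * (?T a * ?T b)" for a b
        using l[of "cut_sech2 k 0" a b] rel[of a] by simp
    qed
    show "\<bar>conv u ?T (cut_sech2 k 0) x y z\<bar> \<le> 9 * k\<^sup>2 * conv u ?T ?T x y z" for x y z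
    proof (rule conv_dominated(2)[OF cont(1) nonneg int cut_sech_cont(1) cut_sech_cont(3)])
      show "\<bar>?T a * cut_sech2 k 0 b\<bar> \<le> 9 * k\<^sup>2 * (?T a * ?T b)" for a b
        using l[of "cut_sech2 k 0" b a] rel[of b] by simp
    qed
  qed
qed

lemma mixed_difference_from_smoothed:
  "u (x + s) (y + t) z - u x (y + t) z - (u (x + s) y z - u x y z) = 0"
proof -
  define v where "v = (\<lambda>w. u (x + s + fst w) (y + t + snd w) z - u (x + fst w) (y + t + snd w) z
      - (u (x + s + fst w) (y + snd w) z - u (x + fst w) (y + snd w) z))"
  have vc: "continuous_on UNIV v"
    unfolding v_def by (intro continuous_intros cont3D[OF cont(1)])
  have piece: "integrable lborel (\<lambda>w. u (a + fst w) (b + snd w) z * (cut_sech k 0 (fst w) * cut_sech k 0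
      (snd w)))"
    "(\<integral>w. u (a + fst w) (b + snd w) z * (cut_sech k 0 (fst w) * cut_sech k 0 (snd w)) \<partial>lborel) = conv u
        (cut_sech k 0) (cut_sech k 0) a b z"
    if k: "k \<ge> 2 * k0" for a b k
  proof -
    let ?F = "\<lambda>w. u (fst w) (snd w) z * (cut_sech k 0 (fst w - a) * cut_sech k 0 (snd w - b))"
    have c: "continuous_on UNIV ?F"
      by (rule conv_integrand_cont[OF cont(1) cut_sech_cont(1) cut_sech_cont(1)]) (intro continuous_intros)+
    show "integrable lborel (\<lambda>w. u (a + fst w) (b + snd w) z * (cut_sech k 0 (fst w) * cut_sech k 0 (snd w)))"
      using lborel_integrable_shift[OF smoothed_mixed_difference(1)[OF k, of z a b], of "(a, b)"] by simp
    show "(\<integral>w. u (a + fst w) (b + snd w) z * (cut_sech k 0 (fst w) * cut_sech k 0 (snd w)) \<partial>lborel) =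
        conv u (cut_sech k 0) (cut_sech k 0) a b z"
      using lborel_integral_shift[OF c, of "(a, b)"] by (simp add: conv_def)
  qed
  have v: "integrable lborel (\<lambda>w. v w * (cut_sech k 0 (fst w) * cut_sech k 0 (snd w)))"
    "(\<integral>w. v w * (cut_sech k 0 (fst w) * cut_sech k 0 (snd w)) \<partial>lborel) = 0" if k: "k \<ge> 2 * k0" for k
  proof -
    note i = piece(1)[OF k] and e = piece(2)[OF k]
    show "integrable lborel (\<lambda>w. v w * (cut_sech k 0 (fst w) * cut_sech k 0 (snd w)))"
      unfolding v_def left_diff_distrib by (intro Bochner_Integration.integrable_diff i)
    show "(\<integral>w. v w * (cut_sech k 0 (fst w) * cut_sech k 0 (snd w)) \<partial>lborel) = 0"
      unfolding v_def left_diff_distrib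
      using smoothed_mixed_difference(2)[OF k, of x s y t z]
      by (simp add: i e Bochner_Integration.integral_diff Bochner_Integration.integrable_diff)
  qed
  have k1: "2 * k0 \<ge> 1" using k0 by simp
  have "v 0 \<le> 0" by (rule vanishing_of_all_means[OF vc k1 v])
  moreover have "- v 0 \<le> 0"
    by (rule vanishing_of_all_means[of "\<lambda>w. - v w", OF _ k1]) (use v vc in \<open>auto intro: continuous_on_minus\<close>)
  moreover have "v 0 = u (x + s) (y + t) z - u x (y + t) z - (u (x + s) y z - u x y z)"
    by (simp add: v_def)
  ultimately show ?thesis by linarith
qed

end

theorem mixed_difference_vanishes:
  "u (x + s) (y + t) z - u x (y + t) z - (u (x + s) y z - u x y z) = 0"
proof -
  obtain k where k: "k \<ge> 2" and b: "\<And>R. R \<ge> 0 \<Longrightarrow> \<exists>C. \<forall>z. \<bar>z\<bar> \<le> R \<longrightarrow>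
     integrable lborel (\<lambda>w. u (fst w) (snd w) z * (sech k (fst w) ^ 3 * sech k (snd w) ^ 3)) \<and>
     (\<integral>w. u (fst w) (snd w) z * (sech k (fst w) ^ 3 * sech k (snd w) ^ 3) \<partial>lborel) \<le> C"
    using sech_kernel_integrable by blast
  have t: "sech k a ^ 3 = cut_sech k 0 a" for a using sech_bounds[of k a] by (simp add: cut_sech_def)
  show ?thesis
    by (rule mixed_difference_from_smoothed[OF k]) (use b in \<open>simp add: t conv_def\<close>)
qed

end

section \<open>Nonnegative summands\<close>

text \<open>
  The equation for functions of two variables only. With \<open>r = p\<close> this concerns functions of $(x,z)$,
  with \<open>r = - q\<close> functions of $(y,z)$.
\<close>

locale strip_solution =
  fixes r m :: real and f fx fxx fz fzz :: "real \<Rightarrow> real \<Rightarrow> real"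
  assumes dx: "((\<lambda>t. f t z) has_real_derivative fx x z) (at x)"
    and dxx: "((\<lambda>t. fx t z) has_real_derivative fxx x z) (at x)"
    and dz: "((\<lambda>t. f x t) has_real_derivative fz x z) (at z)"
    and dzz: "((\<lambda>t. fz x t) has_real_derivative fzz x z) (at z)"
    and cont: "continuous_on UNIV (\<lambda>(x, z). f x z)"
    and pde: "exp (2 * r * z) * fxx x z + fzz x z = m * f x z"
begin

text \<open>
  A maximum principle of Phragmen--Lindeloef type. The barrier
  $\sqrt{1+x^2}+E(n^2-z^2)$ is a strict supersolution and grows in the unbounded direction.
\<close>

lemma nonneg_on_strip:
  assumes m: "m \<ge> 0" and top: "\<And>x. 0 \<le> f x n" and bot: "\<And>x. 0 \<le> f x (- n)"
    and bdd: "\<And>x z. \<bar>z\<bar> \<le> n \<Longrightarrow> - B \<le> f x z" and z0: "\<bar>z0\<bar> \<le> n"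
  shows "0 \<le> f x0 z0"
proof (rule ccontr)
  assume "\<not> 0 \<le> f x0 z0"
  then have neg: "f x0 z0 < 0" by simp
  define E where "E = exp (2 * \<bar>r\<bar> * n)"
  have E: "E > 0" by (simp add: E_def)
  define j where "j = (\<lambda>t::real. sqrt (1 + t\<^sup>2))"
  define j1 where "j1 = (\<lambda>t::real. t / sqrt (1 + t\<^sup>2))"
  define j2 where "j2 = (\<lambda>t::real. 1 / sqrt (1 + t\<^sup>2) ^ 3)"
  have jd: "(j has_real_derivative j1 t) (at t)" "(j1 has_real_derivative j2 t) (at t)" for t
    unfolding j_def j1_def j2_def using japanese_bracket_derivs[of t] by simp_all
  have jb: "0 \<le> j2 t" "j2 t \<le> 1" "\<bar>t\<bar> \<le> j t" "0 \<le> j t" for t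
    unfolding j_def j2_def using japanese_bracket_derivs[of t] by simp_all
  define b where "b = (\<lambda>x z. j x + E * (n\<^sup>2 - z\<^sup>2))"
  have zn: "z\<^sup>2 \<le> n\<^sup>2" if "\<bar>z\<bar> \<le> n" for z using that by (metis abs_ge_zero abs_le_square_iff
      abs_of_nonneg order_trans)
  have b0: "\<bar>x\<bar> \<le> b x z" if "\<bar>z\<bar> \<le> n" for x z
    using jb(3)[of x] zn[OF that] E by (simp add: b_def add_increasing2)
  define e where "e = - f x0 z0 / (2 * (b x0 z0 + 1))"
  have b1: "b x0 z0 + 1 > 0" using b0[OF z0, of x0] by linarith
  have e: "e > 0" unfolding e_def using neg b1 by (intro divide_pos_pos) auto
  define F where "F = (\<lambda>x z. f x z + e * b x z)"
  have F0: "F x0 z0 < 0"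
  proof -
    have "e * b x0 z0 \<le> e * (b x0 z0 + 1)" using e by simp
    also have "\<dots> = - f x0 z0 / 2" using b1 by (simp add: e_def field_simps)
    finally show ?thesis using neg by (simp add: F_def)
  qed
  define X where "X = max \<bar>x0\<bar> (\<bar>B\<bar> / e)"
  have X: "\<bar>x0\<bar> \<le> X" "\<bar>B\<bar> \<le> e * X"
  proof -
    have "\<bar>B\<bar> / e \<le> X" by (simp add: X_def)
    then show "\<bar>B\<bar> \<le> e * X" using e by (simp add: pos_divide_le_eq mult.commute)
  qed (simp add: X_def)
  define box where "box = cbox (- X, - n) (X, n)"
  have box: "(x, z) \<in> box \<longleftrightarrow> \<bar>x\<bar> \<le> X \<and> \<bar>z\<bar> \<le> n" for x z
    unfolding box_def by (auto simp: cbox_Pair_iff)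
  have contF: "continuous_on box (\<lambda>v. F (fst v) (snd v))"
    unfolding F_def b_def j_def
    by (intro continuous_intros continuous_on_subset[OF cont[unfolded case_prod_beta']]) simp
  have "(x0, z0) \<in> box" using X z0 by (simp add: box)
  then have "box \<noteq> {}" by blast
  moreover have "compact box" by (simp add: box_def)
  ultimately obtain v where v: "v \<in> box" "\<forall>w\<in>box. F (fst v) (snd v) \<le> F (fst w) (snd w)"
    using continuous_attains_inf[OF _ _ contF] by blast
  obtain x z where xz: "v = (x, z)" by (cases v)
  have inb: "\<bar>x\<bar> \<le> X" "\<bar>z\<bar> \<le> n" using v(1) by (auto simp: xz box)
  have mn: "F x z \<le> F x' z'" if "\<bar>x'\<bar> \<le> X" "\<bar>z'\<bar> \<le> n" for x' z'
    using bspec[OF v(2), of "(x', z')"] that by (simp add: xz box)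
  have Fneg: "F x z < 0" using mn[OF X(1) z0] F0 by simp
  have zint: "\<bar>z\<bar> < n"
  proof -
    have "0 \<le> e * b x z" using b0[OF inb(2), of x] e by (intro mult_nonneg_nonneg) auto
    then have "f x z < 0" using Fneg by (simp add: F_def)
    then have "z \<noteq> n \<and> z \<noteq> - n" using top[of x] bot[of x] by auto
    then show ?thesis using inb by linarith
  qed
  have xint: "\<bar>x\<bar> < X"
  proof (rule ccontr)
    assume "\<not> \<bar>x\<bar> < X"
    then have "X \<le> b x z" using inb b0[OF inb(2), of x] by simp
    then have "e * X \<le> e * b x z" using e by simp
    then have "0 \<le> F x z" using X(2) bdd[OF inb(2), of x] by (simp add: F_def)
    then show False using Fneg by simp
  qed
  define d where "d = min (X - \<bar>x\<bar>) (n - \<bar>z\<bar>)"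
  have d: "d > 0" using xint zint by (simp add: d_def)
  have xx: "- (fxx x z + e * j2 x) \<le> 0"
  proof (rule second_derivative_local_max[OF d, where f = "\<lambda>t. - F t z" and ?f1.0 = "\<lambda>t. - (fx t z + e *
      j1 t)"])
    fix t
    show "((\<lambda>t. - F t z) has_real_derivative - (fx t z + e * j1 t)) (at t)"
      unfolding F_def b_def by (auto intro!: derivative_eq_intros dx jd)
    show "((\<lambda>t. - (fx t z + e * j1 t)) has_real_derivative - (fxx x z + e * j2 x)) (at x)"
      by (auto intro!: derivative_eq_intros dxx jd)
    assume "\<bar>t - x\<bar> < d"
    then show "- F t z \<le> - F x z" using mn[of t z] inb by (auto simp: d_def)
  qed
  have zz: "- (fzz x z - e * E * 2) \<le> 0"
  proof (rule second_derivative_local_max[OF d, where f = "\<lambda>t. - F x t" and ?f1.0 = "\<lambda>t. - (fz x t - e *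
      E * 2 * t)"])
    fix t
    show "((\<lambda>t. - F x t) has_real_derivative - (fz x t - e * E * 2 * t)) (at t)"
      unfolding F_def b_def by (auto intro!: derivative_eq_intros dz)
    show "((\<lambda>t. - (fz x t - e * E * 2 * t)) has_real_derivative - (fzz x z - e * E * 2)) (at z)"
      by (auto intro!: derivative_eq_intros dzz)
    assume "\<bar>t - z\<bar> < d"
    then show "- F x t \<le> - F x z" using mn[of x t] inb by (auto simp: d_def)
  qed
  have rz: "exp (2 * r * z) \<le> E"
  proof -
    have "\<bar>r * z\<bar> \<le> \<bar>r\<bar> * n" unfolding abs_mult using inb by (intro mult_left_mono) auto
    then have "r * z \<le> \<bar>r\<bar> * n" by linarith
    then show ?thesis by (simp add: E_def)
  qed
  have "0 \<le> exp (2 * r * z) * (fxx x z + e * j2 x) + (fzz x z - e * E * 2)"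
  proof (rule add_nonneg_nonneg)
    show "0 \<le> exp (2 * r * z) * (fxx x z + e * j2 x)" using xx by (intro mult_nonneg_nonneg[OF
        exp_ge_zero]) linarith
    show "0 \<le> fzz x z - e * E * 2" using zz by linarith
  qed
  also have "\<dots> = m * f x z + e * (exp (2 * r * z) * j2 x) - e * E * 2"
    using pde[of z x] by (simp add: algebra_simps)
  also have "\<dots> \<le> 0 + e * (E * 1) - e * E * 2"
  proof -
    have "f x z \<le> F x z" using b0[OF inb(2), of x] e by (simp add: F_def)
    then have "m * f x z \<le> 0" using m Fneg by (simp add: mult_nonneg_nonpos)
    moreover have "e * (exp (2 * r * z) * j2 x) \<le> e * (E * 1)"
      using rz jb[of x] e E by (intro mult_left_mono mult_mono) auto
    ultimately show ?thesis by linarith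
  qed
  also have "\<dots> < 0" using e E by simp
  finally show False by simp
qed

lemma bounded_below_if_nonneg_sum:
  assumes "\<And>x y z. 0 \<le> f x z + g y z" and g: "continuous_on UNIV (g (0::real))"
  shows "\<exists>B. \<forall>x z. \<bar>z\<bar> \<le> n \<longrightarrow> - B \<le> f x z"
proof -
  have "compact (g 0 ` {-n..n})"
    by (intro compact_continuous_image continuous_on_subset[OF g]) auto
  then obtain B where B: "\<And>z. \<bar>z\<bar> \<le> n \<Longrightarrow> \<bar>g 0 z\<bar> \<le> B"
    by (fastforce dest!: compact_imp_bounded simp: bounded_iff abs_le_iff)
  have "- B \<le> f x z" if "\<bar>z\<bar> \<le> n" for x z
    using assms(1)[of x z 0] B[OF that] by linarith
  then show ?thesis by blast
qed

lemma add_vertical: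
  assumes k: "\<And>z. (k has_real_derivative k1 z) (at z)" "\<And>z. (k1 has_real_derivative m * k z) (at z)"
  shows "strip_solution r m (\<lambda>x z. f x z + k z) fx fxx (\<lambda>x z. fz x z + k1 z) (\<lambda>x z. fzz x z + m * k z)"
proof
  fix x z
  show "((\<lambda>t. f t z + k z) has_real_derivative fx x z) (at x)"
    using DERIV_add[OF dx DERIV_const] by simp
  show "((\<lambda>t. f x t + k t) has_real_derivative fz x z + k1 z) (at z)" by (rule DERIV_add[OF dz k(1)])
  show "((\<lambda>t. fz x t + k1 t) has_real_derivative fzz x z + m * k z) (at z)" by (rule DERIV_add[OF dzz k(2)])
  show "exp (2 * r * z) * fxx x z + (fzz x z + m * k z) = m * (f x z + k z)"
    using pde[of z x] by (simp add: algebra_simps)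
next
  have "continuous_on UNIV k" using k(1) by (auto intro!: continuous_at_imp_continuous_on DERIV_isCont)
  then have "continuous_on UNIV (\<lambda>v::real \<times> real. k (snd v))"
    by (rule continuous_on_compose2) (auto intro: continuous_intros)
  then show "continuous_on UNIV (\<lambda>(x, z). f x z + k z)"
    using cont unfolding case_prod_beta' by (intro continuous_on_add)
qed (rule dxx)

end

text \<open>
  The functions are $\cosh(\mu z)$ and $\sinh(\mu z)/\mu$ with $\mu^2=m$, and $1$ and $z$ if $m=0$.
\<close>

lemma hyperbolic_system:
  fixes m :: real
  assumes "m \<ge> 0"
  shows "\<exists>c c1 s s1 :: real \<Rightarrow> real.
    (\<forall>z. (c has_real_derivative c1 z) (at z)) \<and> (\<forall>z. (c1 has_real_derivative m * c z) (at z)) \<and>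
    (\<forall>z. (s has_real_derivative s1 z) (at z)) \<and> (\<forall>z. (s1 has_real_derivative m * s z) (at z)) \<and>
    (\<forall>z. c z * s1 z - c1 z * s z = 1) \<and> (\<forall>z. c (- z) = c z) \<and> (\<forall>z. s (- z) = - s z) \<and>
    (\<forall>z. c z > 0) \<and> (\<forall>z>0. s z > 0) \<and> c 0 = 1"
proof (cases "m = 0")
  case True
  show ?thesis
    by (rule exI[of _ "\<lambda>_. 1"], rule exI[of _ "\<lambda>_. 0"], rule exI[of _ "\<lambda>z. z"], rule exI[of _ "\<lambda>_. 1"])
       (auto simp: True)
next
  case False
  define a where "a = sqrt m"
  have a: "a > 0" "m = a * a" using assms False by (auto simp: a_def)
  show ?thesis
  proof (rule exI[of _ "\<lambda>z. cosh (a * z)"], rule exI[of _ "\<lambda>z. a * sinh (a * z)"],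
      rule exI[of _ "\<lambda>z. sinh (a * z) / a"], rule exI[of _ "\<lambda>z. cosh (a * z)"], intro conjI allI impI)
    fix z
    show "((\<lambda>z. cosh (a * z)) has_real_derivative a * sinh (a * z)) (at z)"
      by (auto intro!: derivative_eq_intros)
    show "((\<lambda>z. a * sinh (a * z)) has_real_derivative m * cosh (a * z)) (at z)"
      by (auto intro!: derivative_eq_intros simp: a)
    show "((\<lambda>z. sinh (a * z) / a) has_real_derivative cosh (a * z)) (at z)"
      using a by (auto intro!: derivative_eq_intros)
    show "((\<lambda>z. cosh (a * z)) has_real_derivative m * (sinh (a * z) / a)) (at z)"
      using a by (auto intro!: derivative_eq_intros)
    have "cosh (a * z) * cosh (a * z) - a * sinh (a * z) * (sinh (a * z) / a) = (cosh (a * z))\<^sup>2 - (sinh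
        (a * z))\<^sup>2"
      using a by (simp add: power2_eq_square)
    then show "cosh (a * z) * cosh (a * z) - a * sinh (a * z) * (sinh (a * z) / a) = 1"
      by (simp add: cosh_square_eq)
  qed (use a in auto)
qed

text \<open>
  Variation of constants.
\<close>

lemma inhomogeneous_vertical_solution:
  fixes k :: "real \<Rightarrow> real"
  assumes m: "m \<ge> 0" and k: "continuous_on UNIV k"
  obtains y y1 where "\<And>z. (y has_real_derivative y1 z) (at z)" "\<And>z. (y1 has_real_derivative m * y z + k
      z) (at z)"
proof -
  obtain c c1 s s1 :: "real \<Rightarrow> real" where cs:
    "\<And>z. (c has_real_derivative c1 z) (at z)" "\<And>z. (c1 has_real_derivative m * c z) (at z)"
    "\<And>z. (s has_real_derivative s1 z) (at z)" "\<And>z. (s1 has_real_derivative m * s z) (at z)"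
    "\<And>z. c z * s1 z - c1 z * s z = 1"
    using hyperbolic_system[OF m] by blast
  have anti: "\<exists>P. \<forall>z. (P has_real_derivative g z) (at z)" if "continuous_on UNIV g" for g :: "real \<Rightarrow> real"
    using einterval_antiderivative[of "-\<infinity>" "\<infinity>" g] that
    by (simp add: continuous_on_eq_continuous_at has_real_derivative_iff_has_vector_derivative)
  have cc: "continuous_on UNIV c" "continuous_on UNIV s"
    using cs by (auto intro!: continuous_at_imp_continuous_on DERIV_isCont)
  obtain P where P: "\<And>z. (P has_real_derivative c z * k z) (at z)" using anti[OF continuous_on_mult[OF
      cc(1) k]] by blast
  obtain Q where Q: "\<And>z. (Q has_real_derivative s z * k z) (at z)" using anti[OF continuous_on_mult[OF
      cc(2) k]] by blast
  show ?thesis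
  proof (rule that[of "\<lambda>z. s z * P z - c z * Q z" "\<lambda>z. s1 z * P z - c1 z * Q z"])
    fix z
    show "((\<lambda>z. s z * P z - c z * Q z) has_real_derivative s1 z * P z - c1 z * Q z) (at z)"
      by (rule DERIV_cong[OF DERIV_diff[OF DERIV_mult[OF cs(3) P] DERIV_mult[OF cs(1) Q]]]) (simp add:
          algebra_simps)
    have "m * s z * P z + c z * k z * s1 z - (m * c z * Q z + s z * k z * c1 z)
       = m * (s z * P z - c z * Q z) + (c z * s1 z - c1 z * s z) * k z" by (simp add: algebra_simps)
    then show "((\<lambda>z. s1 z * P z - c1 z * Q z) has_real_derivative m * (s z * P z - c z * Q z) + k z) (at z)"
      by (intro DERIV_cong[OF DERIV_diff[OF DERIV_mult[OF cs(4) P] DERIV_mult[OF cs(2) Q]]]) (simp add: cs(5))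
  qed
qed

text \<open>
  Between \<open>- g\<close> and \<open>f\<close> there is room for a solution depending on \<open>z\<close> alone. On $|z|\le n$ the
  solution with the boundary values \<open>INF x. f x z\<close> at $z=\pm n$ fits in, because
  both differences are solutions on a strip that are nonnegative on its boundary. The bounds at $z=0$ and
  $z=1$ keep the two coefficients of these solutions bounded as $n$ grows.
\<close>

lemma vertical_sandwich:
  assumes F: "strip_solution r m f fx fxx fz fzz" and G: "strip_solution r' m g gx gxx gz gzz"
    and m: "m \<ge> 0" and sum: "\<And>x y z. 0 \<le> f x z + g y z"
  obtains k k1 where "\<And>z. (k has_real_derivative k1 z) (at z)" "\<And>z. (k1 has_real_derivative m * k z) (at z)"
    "\<And>x z. k z \<le> f x z" "\<And>y z. - g y z \<le> k z"
proof -
  interpret f: strip_solution r m f fx fxx fz fzz by fact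
  interpret g: strip_solution r' m g gx gxx gz gzz by fact
  obtain c c1 s s1 :: "real \<Rightarrow> real" where cs:
    "\<And>z. (c has_real_derivative c1 z) (at z)" "\<And>z. (c1 has_real_derivative m * c z) (at z)"
    "\<And>z. (s has_real_derivative s1 z) (at z)" "\<And>z. (s1 has_real_derivative m * s z) (at z)"
    "\<And>z. c (- z) = c z" "\<And>z. s (- z) = - s z" "\<And>z. c z > 0" "\<And>z. z > 0 \<Longrightarrow> s z > 0" "c 0 = 1"
    using hyperbolic_system[OF m] by blast
  have s0: "s 0 = 0" using cs(6)[of 0] by simp
  have comb: "((\<lambda>z. A * c z + B * s z) has_real_derivative A * c1 z + B * s1 z) (at z)"
    "((\<lambda>z. A * c1 z + B * s1 z) has_real_derivative m * (A * c z + B * s z)) (at z)" for A B z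
    by (auto intro!: derivative_eq_intros cs simp: algebra_simps)
  have comb_cont: "continuous_on UNIV (\<lambda>z. A * c z + B * s z)" for A B
    by (auto intro!: continuous_at_imp_continuous_on DERIV_isCont[OF comb(1)])
  have gc: "continuous_on UNIV (g 0)" "continuous_on UNIV (f 0)"
    using g.dz f.dz by (auto intro!: continuous_at_imp_continuous_on DERIV_isCont)
  define \<mu> where "\<mu> = (\<lambda>z. INF x. f x z)"
  have bdd: "bdd_below (range (\<lambda>x. f x z))" for z
  proof (rule bdd_belowI2)
    show "- g 0 z \<le> f x z" for x using sum[of x z 0] by linarith
  qed
  have \<mu>f: "\<mu> z \<le> f x z" for x z unfolding \<mu>_def by (rule cINF_lower[OF bdd]) simp
  have \<mu>g: "- g y z \<le> \<mu> z" for y z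
    unfolding \<mu>_def
  proof (rule cINF_greatest)
    show "- g y z \<le> f x z" for x using sum[of x z y] by linarith
  qed simp
  \<comment> \<open>Since c is even and s is odd, these coefficients give the prescribed values at both ends of the strip.\<close>
  define A where "A = (\<lambda>n. (\<mu> (real (Suc n)) + \<mu> (- real (Suc n))) / (2 * c (real (Suc n))))"
  define B where "B = (\<lambda>n. (\<mu> (real (Suc n)) - \<mu> (- real (Suc n))) / (2 * s (real (Suc n))))"
  define \<kappa> where "\<kappa> = (\<lambda>n z. A n * c z + B n * s z)"
  have \<kappa>: "\<kappa> n (real (Suc n)) = \<mu> (real (Suc n))" "\<kappa> n (- real (Suc n)) = \<mu> (- real (Suc n))" for n
    using cs(7)[of "real (Suc n)"] cs(8)[of "real (Suc n)"]
    unfolding \<kappa>_def A_def B_def cs(5,6) by (simp_all add: field_simps)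
  have up: "\<kappa> n z \<le> f x z" if z: "\<bar>z\<bar> \<le> real (Suc n)" for n x z
  proof -
    interpret d: strip_solution r m "\<lambda>x z. f x z + ((- A n) * c z + (- B n) * s z)" fx fxx
      "\<lambda>x z. fz x z + ((- A n) * c1 z + (- B n) * s1 z)" "\<lambda>x z. fzz x z + m * ((- A n) * c z + (- B n) * s z)"
      by (rule f.add_vertical[OF comb])
    have eq: "f x z + ((- A n) * c z + (- B n) * s z) = f x z - \<kappa> n z" for x z by (simp add: \<kappa>_def)
    have cg: "continuous_on UNIV (\<lambda>z. g 0 z + \<kappa> n z)"
      unfolding \<kappa>_def by (intro continuous_on_add gc comb_cont)
    have sm: "0 \<le> (f x z + ((- A n) * c z + (- B n) * s z)) + (g y z + \<kappa> n z)" for x y z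
      using sum[of x z y] unfolding eq by simp
    obtain C where C: "\<And>x z. \<bar>z\<bar> \<le> real (Suc n) \<Longrightarrow> - C \<le> f x z + ((- A n) * c z + (- B n) * s z)"
      using d.bounded_below_if_nonneg_sum[where g = "\<lambda>y z. g y z + \<kappa> n z", OF sm cg] by blast
    have "0 \<le> f x z + ((- A n) * c z + (- B n) * s z)"
      by (rule d.nonneg_on_strip[OF m _ _ C z]) (use \<mu>f in \<open>auto simp only: eq \<kappa> diff_ge_0_iff_ge\<close>)
    then show ?thesis unfolding eq by simp
  qed
  have low: "- g y z \<le> \<kappa> n z" if z: "\<bar>z\<bar> \<le> real (Suc n)" for n y z
  proof -
    interpret d: strip_solution r' m "\<lambda>x z. g x z + (A n * c z + B n * s z)" gx gxx
      "\<lambda>x z. gz x z + (A n * c1 z + B n * s1 z)" "\<lambda>x z. gzz x z + m * (A n * c z + B n * s z)"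
      by (rule g.add_vertical[OF comb])
    have eq: "g x z + (A n * c z + B n * s z) = g x z + \<kappa> n z" for x z by (simp add: \<kappa>_def)
    have cg: "continuous_on UNIV (\<lambda>z. f 0 z - \<kappa> n z)"
      unfolding \<kappa>_def by (intro continuous_on_diff gc comb_cont)
    have sm: "0 \<le> (g x z + (A n * c z + B n * s z)) + (f y z - \<kappa> n z)" for x y z
      using sum[of y z x] unfolding eq by simp
    obtain C where C: "\<And>x z. \<bar>z\<bar> \<le> real (Suc n) \<Longrightarrow> - C \<le> g x z + (A n * c z + B n * s z)"
      using d.bounded_below_if_nonneg_sum[where g = "\<lambda>y z. f y z - \<kappa> n z", OF sm cg] by blast
    have ge: "0 \<le> g x z + \<mu> z" for x z using \<mu>g[of x z] by linarith
    have "0 \<le> g y z + (A n * c z + B n * s z)"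
      by (rule d.nonneg_on_strip[OF m _ _ C z]) (use ge in \<open>auto simp only: eq \<kappa>\<close>)
    then show ?thesis unfolding eq by simp
  qed
  define S where "S = (\<lambda>n. (A n, B n))"
  have "bounded (range S)"
  proof -
    define a where "a = \<bar>g 0 0\<bar> + \<bar>f 0 0\<bar>"
    define b where "b = (\<bar>g 0 1\<bar> + \<bar>f 0 1\<bar> + a * c 1) / s 1"
    have A: "\<bar>A n\<bar> \<le> a" for n
      using up[of 0 n 0] low[of 0 n 0] by (auto simp: \<kappa>_def cs(9) s0 a_def)
    have B: "\<bar>B n\<bar> \<le> b" for n
    proof -
      have "\<bar>A n * c 1\<bar> \<le> a * c 1" using A[of n] cs(7)[of 1] by (simp add: abs_mult)
      moreover have "A n * c 1 + B n * s 1 \<le> f 0 1" "- g 0 1 \<le> A n * c 1 + B n * s 1"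
        using up[of 1 n 0] low[of 1 n 0] by (auto simp: \<kappa>_def)
      ultimately have "\<bar>B n * s 1\<bar> \<le> \<bar>g 0 1\<bar> + \<bar>f 0 1\<bar> + a * c 1" by linarith
      then show ?thesis using cs(8)[of 1] by (simp add: b_def abs_mult pos_le_divide_eq)
    qed
    have "norm (S n) \<le> a + b" for n
    proof -
      have "norm (S n) \<le> norm (A n) + norm (B n)" unfolding S_def by (rule norm_Pair_le)
      then show ?thesis using A[of n] B[of n] by simp
    qed
    then show ?thesis by (auto simp: bounded_iff)
  qed
  then obtain l \<rho> where \<rho>: "strict_mono \<rho>" "(S \<circ> \<rho>) \<longlonglongrightarrow> l"
    using bounded_imp_convergent_subsequence by blast
  have lim: "(\<lambda>n. \<kappa> (\<rho> n) z) \<longlonglongrightarrow> fst l * c z + snd l * s z" for z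
  proof -
    have "(\<lambda>n. fst ((S \<circ> \<rho>) n) * c z + snd ((S \<circ> \<rho>) n) * s z) \<longlonglongrightarrow> fst l * c z + snd l * s z"
      by (intro tendsto_intros \<rho>)
    then show ?thesis by (simp add: S_def \<kappa>_def)
  qed
  have ev: "\<forall>\<^sub>F n in sequentially. \<bar>z\<bar> \<le> real (Suc (\<rho> n))" for z
  proof -
    obtain N :: nat where N: "\<bar>z\<bar> \<le> real N" using real_arch_simple by blast
    have "\<bar>z\<bar> \<le> real (Suc (\<rho> n))" if "n \<ge> N" for n
      using N seq_suble[OF \<rho>(1), of n] that by linarith
    then show ?thesis by (auto simp: eventually_sequentially)
  qed
  show ?thesis
  proof (rule that[OF comb])
    fix x z
    show "fst l * c z + snd l * s z \<le> f x z"
      by (rule tendsto_upperbound[OF lim]) (use ev[of z] up in \<open>auto elim: eventually_mono\<close>)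
    show "- g x z \<le> fst l * c z + snd l * s z"
      by (rule tendsto_lowerbound[OF lim]) (use ev[of z] low in \<open>auto elim: eventually_mono\<close>)
  qed
qed

section \<open>Twice continuously differentiable functions and the decomposition\<close>

text \<open>
  The Frechet derivatives are only used through derivatives along lines, which are continuous in the
  base point.
\<close>

lemma C2_directional:
  fixes f :: "'a::real_normed_vector \<Rightarrow> real"
  assumes "C2 f"
  shows "\<exists>D1 D2 :: 'a \<Rightarrow> 'a \<Rightarrow> real.
    (\<forall>e. continuous_on UNIV (\<lambda>v. D1 v e)) \<and> (\<forall>e. continuous_on UNIV (\<lambda>v. D2 v e)) \<and>
    (\<forall>e v t. ((\<lambda>t. f (v + t *\<^sub>R e)) has_real_derivative D1 (v + t *\<^sub>R e) e) (at t)) \<and>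
    (\<forall>e v t. ((\<lambda>t. D1 (v + t *\<^sub>R e) e) has_real_derivative D2 (v + t *\<^sub>R e) e) (at t))"
proof -
  obtain f' :: "'a \<Rightarrow> 'a \<Rightarrow>\<^sub>L real" and f'' :: "'a \<Rightarrow> 'a \<Rightarrow>\<^sub>L 'a \<Rightarrow>\<^sub>L real" where
    d1: "\<And>u. (f has_derivative blinfun_apply (f' u)) (at u)" and
    d2: "\<And>u. (f' has_derivative blinfun_apply (f'' u)) (at u)" and
    c: "continuous_on UNIV f''"
    using assms unfolding C2_def by blast
  have c1: "continuous_on UNIV f'"
    by (intro continuous_at_imp_continuous_on ballI has_derivative_continuous[OF d2])
  have line: "((\<lambda>t. v + t *\<^sub>R e) has_derivative (\<lambda>h. h *\<^sub>R e)) (at t)" for v e :: 'a and t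
    by (auto intro!: derivative_eq_intros)
  show ?thesis
  proof (rule exI[of _ "\<lambda>v e. f' v e"], rule exI[of _ "\<lambda>v e. f'' v e e"], intro conjI allI)
    fix e
    show "continuous_on UNIV (\<lambda>v. f' v e)" by (intro continuous_intros c1)
    show "continuous_on UNIV (\<lambda>v. f'' v e e)" by (intro continuous_intros c)
    fix v t
    have "((\<lambda>t. f (v + t *\<^sub>R e)) has_derivative (\<lambda>h. f' (v + t *\<^sub>R e) (h *\<^sub>R e))) (at t)"
      by (rule has_derivative_compose[OF line d1])
    then show "((\<lambda>t. f (v + t *\<^sub>R e)) has_real_derivative f' (v + t *\<^sub>R e) e) (at t)"
      by (simp add: has_field_derivative_def blinfun.scaleR_right mult_commute_abs)
    have "((\<lambda>t. f' (v + t *\<^sub>R e)) has_derivative (\<lambda>h. f'' (v + t *\<^sub>R e) (h *\<^sub>R e))) (at t)"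
      by (rule has_derivative_compose[OF line d2])
    then have "((\<lambda>t. f' (v + t *\<^sub>R e) e) has_derivative (\<lambda>h. f'' (v + t *\<^sub>R e) (h *\<^sub>R e) e)) (at t)"
      by (rule bounded_linear.has_derivative[OF blinfun.bounded_linear_left])
    then show "((\<lambda>t. f' (v + t *\<^sub>R e) e) has_real_derivative f'' (v + t *\<^sub>R e) e e) (at t)"
      by (simp add: has_field_derivative_def blinfun.scaleR_right blinfun.scaleR_left mult_commute_abs)
  qed
qed

lemma C2_compose_linear:
  assumes f: "C2 f" and L: "bounded_linear L"
  shows "C2 (\<lambda>v. f (L v))"
proof -
  obtain f' f'' where
    d1: "\<And>u. (f has_derivative blinfun_apply (f' u)) (at u)" and
    d2: "\<And>u. (f' has_derivative blinfun_apply (f'' u)) (at u)" and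
    c: "continuous_on UNIV f''"
    using f unfolding C2_def by blast
  define l where "l = Blinfun L"
  have l: "blinfun_apply l = L" unfolding l_def by (rule bounded_linear_Blinfun_apply[OF L])
  have dL: "(L has_derivative L) (at v)" for v by (rule bounded_linear_imp_has_derivative[OF L])
  have cL: "continuous_on UNIV L" by (rule linear_continuous_on[OF L])
  define pre where "pre = Blinfun (\<lambda>g :: 'a \<Rightarrow>\<^sub>L real. g o\<^sub>L l)"
  have bl: "bounded_linear (\<lambda>g :: 'a \<Rightarrow>\<^sub>L real. g o\<^sub>L l)"
    by (rule bounded_bilinear.bounded_linear_left[OF bounded_bilinear_blinfun_compose])
  have pre: "blinfun_apply pre = (\<lambda>g. g o\<^sub>L l)" unfolding pre_def by (rule
      bounded_linear_Blinfun_apply[OF bl])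
  show ?thesis
    unfolding C2_def
  proof (intro exI[of _ "\<lambda>v. f' (L v) o\<^sub>L l"] exI[of _ "\<lambda>v. pre o\<^sub>L (f'' (L v) o\<^sub>L l)"] conjI allI)
    fix v
    show "((\<lambda>v. f (L v)) has_derivative blinfun_apply (f' (L v) o\<^sub>L l)) (at v)"
      using has_derivative_compose[OF dL d1] by (simp add: l blinfun_compose.rep_eq comp_def)
    have "((\<lambda>v. f' (L v)) has_derivative (\<lambda>h. f'' (L v) (L h))) (at v)"
      by (rule has_derivative_compose[OF dL d2])
    from bounded_linear.has_derivative[OF bl this]
    show "((\<lambda>v. f' (L v) o\<^sub>L l) has_derivative blinfun_apply (pre o\<^sub>L (f'' (L v) o\<^sub>L l))) (at v)"
      by (simp add: l pre blinfun_compose.rep_eq comp_def)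
  next
    show "continuous_on UNIV (\<lambda>v. pre o\<^sub>L (f'' (L v) o\<^sub>L l))"
      by (intro bounded_bilinear.continuous_on[OF bounded_bilinear_blinfun_compose] continuous_on_const
          continuous_on_compose2[OF c cL]) simp
  qed
qed

lemma C2_diff:
  assumes "C2 f" "C2 g"
  shows "C2 (\<lambda>v. f v - g v)"
proof -
  obtain f' f'' where f: "\<And>u. (f has_derivative blinfun_apply (f' u)) (at u)"
    "\<And>u. (f' has_derivative blinfun_apply (f'' u)) (at u)" "continuous_on UNIV f''"
    using assms(1) unfolding C2_def by blast
  obtain g' g'' where g: "\<And>u. (g has_derivative blinfun_apply (g' u)) (at u)"
    "\<And>u. (g' has_derivative blinfun_apply (g'' u)) (at u)" "continuous_on UNIV g''"
    using assms(2) unfolding C2_def by blast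
  show ?thesis
    unfolding C2_def
  proof (intro exI[of _ "\<lambda>v. f' v - g' v"] exI[of _ "\<lambda>v. f'' v - g'' v"] conjI allI)
    fix v
    show "((\<lambda>v. f v - g v) has_derivative blinfun_apply (f' v - g' v)) (at v)"
      using has_derivative_diff[OF f(1) g(1)] by (simp add: minus_blinfun.rep_eq)
    show "((\<lambda>v. f' v - g' v) has_derivative blinfun_apply (f'' v - g'' v)) (at v)"
      using has_derivative_diff[OF f(2) g(2)] by (simp add: minus_blinfun.rep_eq)
  qed (intro continuous_on_diff f g)
qed

lemma C2_real:
  fixes f f1 f2 :: "real \<Rightarrow> real"
  assumes "\<And>x. (f has_real_derivative f1 x) (at x)" "\<And>x. (f1 has_real_derivative f2 x) (at x)"
    "continuous_on UNIV f2"
  shows "C2 f"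
  unfolding C2_def
proof (intro exI[of _ "\<lambda>x. blinfun_scaleR_left (f1 x)"]
    exI[of _ "\<lambda>x. blinfun_scaleR_left (blinfun_scaleR_left (f2 x))"] conjI allI)
  fix x
  show "(f has_derivative blinfun_apply (blinfun_scaleR_left (f1 x))) (at x)"
    using assms(1)[of x] by (simp add: has_field_derivative_def mult_commute_abs)
  have "(f1 has_derivative (\<lambda>h. h * f2 x)) (at x)"
    using assms(2)[of x] by (simp add: has_field_derivative_def mult_commute_abs)
  from bounded_linear.has_derivative[OF bounded_linear_blinfun_scaleR_left this]
  have "((\<lambda>x. blinfun_scaleR_left (f1 x) :: real \<Rightarrow>\<^sub>L real) has_derivative (\<lambda>h. blinfun_scaleR_left (h *
      f2 x))) (at x)" .
  moreover have "(\<lambda>h. blinfun_scaleR_left (h * f2 x) :: real \<Rightarrow>\<^sub>L real)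
      = blinfun_apply (blinfun_scaleR_left (blinfun_scaleR_left (f2 x)))"
    by (intro ext blinfun_eqI) (simp add: blinfun.scaleR_left)
  ultimately show "((\<lambda>x. blinfun_scaleR_left (f1 x) :: real \<Rightarrow>\<^sub>L real) has_derivative
      blinfun_apply (blinfun_scaleR_left (blinfun_scaleR_left (f2 x)))) (at x)" by simp
next
  show "continuous_on UNIV (\<lambda>x. blinfun_scaleR_left (blinfun_scaleR_left (f2 x)) :: real \<Rightarrow>\<^sub>L real \<Rightarrow>\<^sub>L real)"
    by (intro bounded_linear.continuous_on[OF bounded_linear_blinfun_scaleR_left] assms(3))
qed

lemma second_deriv_eq:
  fixes f f1 f2 :: "real \<Rightarrow> real"
  assumes "\<And>x. (f has_real_derivative f1 x) (at x)" "\<And>x. (f1 has_real_derivative f2 x) (at x)"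
  shows "deriv f x = f1 x" "(deriv ^^ 2) f x = f2 x"
proof -
  have "deriv f = f1" using assms(1) by (intro ext DERIV_imp_deriv)
  then show "deriv f x = f1 x" "(deriv ^^ 2) f x = f2 x"
    using DERIV_imp_deriv[OF assms(2)] by (simp_all add: numeral_2_eq_2)
qed

text \<open>
  The factor \<open>exp (a * z)\<close> removes the first order term of the operator and shifts the eigenvalue by
  $a^2/2$.
\<close>

lemma conjugated_L_Sol:
  assumes C2: "C2 h" and eq: "\<And>v. L_Sol p q a h v = lam * h v"
  shows "\<exists>ux uxx uy uyy uz uzz. eigenfunction p q (2 * lam + a\<^sup>2) (\<lambda>x y z. exp (a * z) * h (x, y, z)) ux
      uxx uy uyy uz uzz"
proof -
  obtain D1 D2 :: "real \<times> real \<times> real \<Rightarrow> real \<times> real \<times> real \<Rightarrow> real" where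
    D: "\<And>e. continuous_on UNIV (\<lambda>v. D1 v e)" "\<And>e. continuous_on UNIV (\<lambda>v. D2 v e)"
      "\<And>e v t. ((\<lambda>t. h (v + t *\<^sub>R e)) has_real_derivative D1 (v + t *\<^sub>R e) e) (at t)"
      "\<And>e v t. ((\<lambda>t. D1 (v + t *\<^sub>R e) e) has_real_derivative D2 (v + t *\<^sub>R e) e) (at t)"
    using C2_directional[OF C2] by blast
  define e1 e2 e3 :: "real \<times> real \<times> real" where "e1 = (1, 0, 0)" and "e2 = (0, 1, 0)" and "e3 = (0, 0, 1)"
  have dx: "((\<lambda>t. h (t, y, z)) has_real_derivative D1 (x, y, z) e1) (at x)"
    "((\<lambda>t. D1 (t, y, z) e1) has_real_derivative D2 (x, y, z) e1) (at x)" for x y z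
    using D(3)[of "(0, y, z)" e1 x] D(4)[of "(0, y, z)" e1 x] by (simp_all add: e1_def)
  have dy: "((\<lambda>t. h (x, t, z)) has_real_derivative D1 (x, y, z) e2) (at y)"
    "((\<lambda>t. D1 (x, t, z) e2) has_real_derivative D2 (x, y, z) e2) (at y)" for x y z
    using D(3)[of "(x, 0, z)" e2 y] D(4)[of "(x, 0, z)" e2 y] by (simp_all add: e2_def)
  have dz: "((\<lambda>t. h (x, y, t)) has_real_derivative D1 (x, y, z) e3) (at z)"
    "((\<lambda>t. D1 (x, y, t) e3) has_real_derivative D2 (x, y, z) e3) (at z)" for x y z
    using D(3)[of "(x, y, 0)" e3 z] D(4)[of "(x, y, 0)" e3 z] by (simp_all add: e3_def)
  obtain h' where h': "\<And>v. (h has_derivative blinfun_apply (h' v)) (at v)"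
    using C2 unfolding C2_def by blast
  have hc: "continuous_on UNIV h"
    by (intro continuous_at_imp_continuous_on ballI has_derivative_continuous[OF h'])
  let ?E = "\<lambda>z. exp (a * z)"
  have E: "(?E has_real_derivative a * ?E z) (at z)" for z by (auto intro!: derivative_eq_intros)
  have "eigenfunction p q (2 * lam + a\<^sup>2) (\<lambda>x y z. ?E z * h (x, y, z))
     (\<lambda>x y z. ?E z * D1 (x, y, z) e1) (\<lambda>x y z. ?E z * D2 (x, y, z) e1)
     (\<lambda>x y z. ?E z * D1 (x, y, z) e2) (\<lambda>x y z. ?E z * D2 (x, y, z) e2)
     (\<lambda>x y z. ?E z * (a * h (x, y, z) + D1 (x, y, z) e3))
     (\<lambda>x y z. ?E z * (a\<^sup>2 * h (x, y, z) + 2 * a * D1 (x, y, z) e3 + D2 (x, y, z) e3))"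
  proof
    fix x y z
    show "((\<lambda>t. ?E z * h (t, y, z)) has_real_derivative ?E z * D1 (x, y, z) e1) (at x)" by (rule
        DERIV_cmult[OF dx(1)])
    show "((\<lambda>t. ?E z * D1 (t, y, z) e1) has_real_derivative ?E z * D2 (x, y, z) e1) (at x)" by (rule
        DERIV_cmult[OF dx(2)])
    show "((\<lambda>t. ?E z * h (x, t, z)) has_real_derivative ?E z * D1 (x, y, z) e2) (at y)" by (rule
        DERIV_cmult[OF dy(1)])
    show "((\<lambda>t. ?E z * D1 (x, t, z) e2) has_real_derivative ?E z * D2 (x, y, z) e2) (at y)" by (rule
        DERIV_cmult[OF dy(2)])
    show "((\<lambda>t. ?E t * h (x, y, t)) has_real_derivative ?E z * (a * h (x, y, z) + D1 (x, y, z) e3)) (at z)"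
      by (rule DERIV_cong[OF DERIV_mult[OF E dz(1)]]) (simp add: algebra_simps)
    show "((\<lambda>t. ?E t * (a * h (x, y, t) + D1 (x, y, t) e3)) has_real_derivative
        ?E z * (a\<^sup>2 * h (x, y, z) + 2 * a * D1 (x, y, z) e3 + D2 (x, y, z) e3)) (at z)"
      by (rule DERIV_cong[OF DERIV_mult[OF E DERIV_add[OF DERIV_cmult[OF dz(1)] dz(2)]]])
         (simp add: algebra_simps power2_eq_square)
    have "1 / 2 * (exp (2 * p * z) * D2 (x, y, z) e1 + exp (- 2 * q * z) * D2 (x, y, z) e2 + D2 (x, y, z) e3)
        + a * D1 (x, y, z) e3 = lam * h (x, y, z)"
      using eq[of "(x, y, z)"] unfolding L_Sol_def
      by (simp add: second_deriv_eq(2)[OF dx(1) dx(2)] second_deriv_eq(2)[OF dy(1) dy(2)]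
          second_deriv_eq(2)[OF dz(1) dz(2)] second_deriv_eq(1)[OF dz(1) dz(2)])
    then have "exp (2 * p * z) * D2 (x, y, z) e1 + exp (- 2 * q * z) * D2 (x, y, z) e2 + D2 (x, y, z) e3
        + 2 * a * D1 (x, y, z) e3 = 2 * lam * h (x, y, z)" by argo
    then have "?E z * (exp (2 * p * z) * D2 (x, y, z) e1 + exp (- 2 * q * z) * D2 (x, y, z) e2 + D2 (x,
        y, z) e3
        + 2 * a * D1 (x, y, z) e3 + a\<^sup>2 * h (x, y, z)) = ?E z * ((2 * lam + a\<^sup>2) * h (x, y, z))"
      by (simp add: algebra_simps)
    then show "exp (2 * p * z) * (?E z * D2 (x, y, z) e1) + exp (- 2 * q * z) * (?E z * D2 (x, y, z) e2)
       + ?E z * (a\<^sup>2 * h (x, y, z) + 2 * a * D1 (x, y, z) e3 + D2 (x, y, z) e3)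
      = (2 * lam + a\<^sup>2) * (?E z * h (x, y, z))" by (simp add: algebra_simps)
  next
    have c: "continuous_on UNIV (\<lambda>v::real \<times> real \<times> real. exp (a * snd (snd v)))" by (intro continuous_intros)
    show "cont3 (\<lambda>x y z. ?E z * h (x, y, z))" "cont3 (\<lambda>x y z. ?E z * D1 (x, y, z) e1)"
      "cont3 (\<lambda>x y z. ?E z * D2 (x, y, z) e1)" "cont3 (\<lambda>x y z. ?E z * D1 (x, y, z) e2)"
      "cont3 (\<lambda>x y z. ?E z * D2 (x, y, z) e2)"
      "cont3 (\<lambda>x y z. ?E z * (a * h (x, y, z) + D1 (x, y, z) e3))"
      "cont3 (\<lambda>x y z. ?E z * (a\<^sup>2 * h (x, y, z) + 2 * a * D1 (x, y, z) e3 + D2 (x, y, z) e3))"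
      unfolding case_prod_beta' prod.collapse
      by (intro continuous_on_mult continuous_on_add continuous_on_const hc D(1) D(2) c)+
  qed
  then show ?thesis by blast
qed

text \<open>
  The inverse conjugation in two variables; only the square of \<open>b\<close> enters the equation on the strip,
  so the drifts \<open>a\<close> and \<open>- a\<close> lead to the same value of \<open>m\<close>.
\<close>

lemma strip_solution_L_Hyp:
  assumes S: "strip_solution r (2 * lam + b\<^sup>2) f fx fxx fz fzz"
    and h: "\<And>x z. h (x, z) = exp (- (b * z)) * f x z"
  shows "L_Hyp r b h v = lam * h v"
proof -
  interpret strip_solution r "2 * lam + b\<^sup>2" f fx fxx fz fzz by fact
  obtain x z where v: "v = (x, z)" by (cases v)
  let ?E = "\<lambda>z. exp (- (b * z))"
  have E: "(?E has_real_derivative - b * ?E z) (at z)" for z by (auto intro!: derivative_eq_intros)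
  have x1: "((\<lambda>t. h (t, z)) has_real_derivative ?E z * fx x z) (at x)"
    and x2: "((\<lambda>t. ?E z * fx t z) has_real_derivative ?E z * fxx x z) (at x)" for x z
    unfolding h by (rule DERIV_cmult[OF dx], rule DERIV_cmult[OF dxx])
  have z1: "((\<lambda>t. h (x, t)) has_real_derivative ?E z * (fz x z - b * f x z)) (at z)" for x z
    unfolding h by (rule DERIV_cong[OF DERIV_mult[OF E dz]]) (simp add: algebra_simps)
  have z2: "((\<lambda>t. ?E t * (fz x t - b * f x t)) has_real_derivative
      ?E z * (fzz x z - 2 * b * fz x z + b\<^sup>2 * f x z)) (at z)" for x z
    by (rule DERIV_cong[OF DERIV_mult[OF E DERIV_diff[OF dzz DERIV_cmult[OF dz]]]])
       (simp add: algebra_simps power2_eq_square)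
  have "L_Hyp r b h (x, z) = 1 / 2 * (exp (2 * r * z) * (?E z * fxx x z)
      + ?E z * (fzz x z - 2 * b * fz x z + b\<^sup>2 * f x z)) + b * (?E z * (fz x z - b * f x z))"
    unfolding L_Hyp_def
    by (simp add: second_deriv_eq(2)[OF x1 x2] second_deriv_eq(2)[OF z1 z2] second_deriv_eq(1)[OF z1 z2])
  also have "\<dots> = ?E z * (1 / 2 * (exp (2 * r * z) * fxx x z + fzz x z) - b\<^sup>2 / 2 * f x z)"
    by (simp add: algebra_simps power2_eq_square)
  also have "\<dots> = lam * h (x, z)"
    unfolding pde h by (simp add: algebra_simps)
  finally show ?thesis by (simp add: v)
qed

theorem corollary6p3:
  fixes p q a lam :: real and h :: "real \<times> real \<times> real \<Rightarrow> real"
  assumes "p > 0" and "q > 0"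
    and "lam \<ge> - (a\<^sup>2 / 2)"
    and "h \<in> H_plus (L_Sol p q a) lam"
  shows "\<exists>h1 \<in> H_plus (L_Hyp p a) lam. \<exists>h2 \<in> H_plus (L_Hyp q (- a)) lam.
           \<forall>x y z. h (x, y, z) = h1 (x, z) + h2 (y, - z)"
proof -
  define m where "m = 2 * lam + a\<^sup>2"
  have m: "m \<ge> 0" using assms(3) by (simp add: m_def)
  have h: "C2 h" "\<And>v. 0 \<le> h v" "\<And>v. L_Sol p q a h v = lam * h v"
    using assms(4) by (auto simp: H_plus_def)
  define u where "u = (\<lambda>x y z. exp (a * z) * h (x, y, z))"
  obtain ux uxx uy uyy uz uzz where E: "eigenfunction p q m u ux uxx uy uyy uz uzz"
    using conjugated_L_Sol[OF h(1,3)] unfolding u_def m_def by blast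
  interpret u: pos_eigenfunction p q m u ux uxx uy uyy uz uzz
    by (intro pos_eigenfunction.intro pos_eigenfunction_axioms.intro E assms m) (simp add: u_def h)
  have split: "u x y z = u x 0 z + u 0 y z - u 0 0 z" for x y z
    using u.mixed_difference_vanishes[of 0 x 0 y z] by simp
  have uxx_indep: "uxx x y z = uxx x 0 z" for x y z
  proof -
    have "((\<lambda>t. u t 0 z + u 0 y z - u 0 0 z) has_real_derivative ux x 0 z) (at x)" for x
      by (auto intro!: derivative_eq_intros u.dx)
    moreover have "(\<lambda>t. u t y z) = (\<lambda>t. u t 0 z + u 0 y z - u 0 0 z)" by (intro ext split)
    ultimately have "((\<lambda>t. u t y z) has_real_derivative ux x 0 z) (at x)" for x by (simp only:)
    then have "(\<lambda>t. ux t y z) = (\<lambda>t. ux t 0 z)" by (intro ext DERIV_unique[OF u.dx])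
    then show ?thesis using DERIV_unique[OF u.dxx[of y z x]] u.dxx[of 0 z x] by simp
  qed
  have uyy_indep: "uyy x y z = uyy 0 y z" for x y z
  proof -
    have "((\<lambda>t. u x 0 z + u 0 t z - u 0 0 z) has_real_derivative uy 0 y z) (at y)" for y
      by (auto intro!: derivative_eq_intros u.dy)
    moreover have "(\<lambda>t. u x t z) = (\<lambda>t. u x 0 z + u 0 t z - u 0 0 z)" by (intro ext split)
    ultimately have "((\<lambda>t. u x t z) has_real_derivative uy 0 y z) (at y)" for y by (simp only:)
    then have "(\<lambda>t. uy x t z) = (\<lambda>t. uy 0 t z)" by (intro ext DERIV_unique[OF u.dy])
    then show ?thesis using DERIV_unique[OF u.dyy[of x z y]] u.dyy[of 0 z y] by simp
  qed
  \<comment> \<open>The restriction of u to y = 0 misses the equation by a function of z alone, which c0 corrects.\<close>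
  define k where "k = (\<lambda>z. - exp (- 2 * q * z) * uyy 0 0 z)"
  have kc: "continuous_on UNIV k"
    unfolding k_def by (intro continuous_intros cont3D[OF u.cont(5)])
  obtain c0 c1 where c0: "\<And>z. (c0 has_real_derivative c1 z) (at z)" "\<And>z. (c1 has_real_derivative m * c0
      z + k z) (at z)"
    using inhomogeneous_vertical_solution[OF m kc] by metis
  have c0c: "continuous_on UNIV c0" using c0(1) by (auto intro!: continuous_at_imp_continuous_on DERIV_isCont)
  have c0v: "continuous_on UNIV (\<lambda>v::real \<times> real. c0 (snd v))"
    by (rule continuous_on_compose2[OF c0c]) (auto intro: continuous_intros)
  have F: "strip_solution p m (\<lambda>x z. u x 0 z - c0 z) (\<lambda>x z. ux x 0 z) (\<lambda>x z. uxx x 0 z)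
      (\<lambda>x z. uz x 0 z - c1 z) (\<lambda>x z. uzz x 0 z - (m * c0 z + k z))"
  proof
    fix x z
    show "((\<lambda>t. u t 0 z - c0 z) has_real_derivative ux x 0 z) (at x)"
      using DERIV_diff[OF u.dx DERIV_const] by simp
    show "((\<lambda>t. u x 0 t - c0 t) has_real_derivative uz x 0 z - c1 z) (at z)" by (rule DERIV_diff[OF u.dz
        c0(1)])
    show "((\<lambda>t. uz x 0 t - c1 t) has_real_derivative uzz x 0 z - (m * c0 z + k z)) (at z)" by (rule
        DERIV_diff[OF u.dzz c0(2)])
    show "exp (2 * p * z) * uxx x 0 z + (uzz x 0 z - (m * c0 z + k z)) = m * (u x 0 z - c0 z)"
      using u.pde[of z x 0] uyy_indep[of x 0 z] by (simp add: k_def algebra_simps)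
  next
    show "continuous_on UNIV (\<lambda>(x, z). u x 0 z - c0 z)"
      unfolding case_prod_beta' by (intro continuous_intros cont3D[OF u.cont(1)] c0v)
  qed (rule u.dxx)
  have G: "strip_solution (- q) m (\<lambda>y z. u 0 y z - u 0 0 z + c0 z) (\<lambda>y z. uy 0 y z) (\<lambda>y z. uyy 0 y z)
      (\<lambda>y z. uz 0 y z - uz 0 0 z + c1 z) (\<lambda>y z. uzz 0 y z - uzz 0 0 z + (m * c0 z + k z))"
  proof
    fix x z
    show "((\<lambda>t. u 0 t z - u 0 0 z + c0 z) has_real_derivative uy 0 x z) (at x)"
      by (auto intro!: derivative_eq_intros u.dy)
    show "((\<lambda>t. u 0 x t - u 0 0 t + c0 t) has_real_derivative uz 0 x z - uz 0 0 z + c1 z) (at z)"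
      by (rule DERIV_add[OF DERIV_diff[OF u.dz u.dz] c0(1)])
    show "((\<lambda>t. uz 0 x t - uz 0 0 t + c1 t) has_real_derivative uzz 0 x z - uzz 0 0 z + (m * c0 z + k
        z)) (at z)"
      by (rule DERIV_add[OF DERIV_diff[OF u.dzz u.dzz] c0(2)])
    show "exp (2 * - q * z) * uyy 0 x z + (uzz 0 x z - uzz 0 0 z + (m * c0 z + k z)) = m * (u 0 x z - u
        0 0 z + c0 z)"
      using u.pde[of z 0 x] u.pde[of z 0 0] uxx_indep[of 0 x z] by (simp add: k_def algebra_simps)
  next
    show "continuous_on UNIV (\<lambda>(y, z). u 0 y z - u 0 0 z + c0 z)"
      unfolding case_prod_beta' by (intro continuous_intros cont3D[OF u.cont(1)] c0v)
  qed (rule u.dyy)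
  have sum: "0 \<le> (u x 0 z - c0 z) + (u 0 y z - u 0 0 z + c0 z)" for x y z
    using u.nonneg[of x y z] split[of x y z] by simp
  obtain d0 d1 where d0: "\<And>z. (d0 has_real_derivative d1 z) (at z)" "\<And>z. (d1 has_real_derivative m * d0
      z) (at z)"
    and up: "\<And>x z. d0 z \<le> u x 0 z - c0 z" and low: "\<And>y z. - (u 0 y z - u 0 0 z + c0 z) \<le> d0 z"
    using vertical_sandwich[OF F G m sum] by metis
  have nd: "((\<lambda>z. - d0 z) has_real_derivative - d1 z) (at z)" "((\<lambda>z. - d1 z) has_real_derivative m * -
      d0 z) (at z)" for z
    using DERIV_minus[OF d0(1)] DERIV_minus[OF d0(2)] by auto
  note F' = strip_solution.add_vertical[OF F nd]
  interpret G': strip_solution "- q" m "\<lambda>y z. (u 0 y z - u 0 0 z + c0 z) + d0 z" "\<lambda>y z. uy 0 y z" "\<lambda>y z.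
      uyy 0 y z"
      "\<lambda>y z. (uz 0 y z - uz 0 0 z + c1 z) + d1 z" "\<lambda>y z. uzz 0 y z - uzz 0 0 z + (m * c0 z + k z) + m * d0 z"
    by (rule strip_solution.add_vertical[OF G d0])
  define e where "e = (\<lambda>z. c0 z + d0 z)"
  define \<xi> where "\<xi> = (\<lambda>z. exp (- (a * z)) * e z)"
  have ed: "(e has_real_derivative c1 z + d1 z) (at z)"
    "((\<lambda>z. c1 z + d1 z) has_real_derivative m * e z + k z) (at z)" for z
    unfolding e_def by (rule DERIV_add[OF c0(1) d0(1)], rule DERIV_cong[OF DERIV_add[OF c0(2) d0(2)]])
        (simp add: algebra_simps)
  have C\<xi>: "C2 \<xi>"
  proof (rule C2_real)
    have X: "((\<lambda>z. exp (- (a * z))) has_real_derivative - a * exp (- (a * z))) (at z)" for z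
      by (auto intro!: derivative_eq_intros)
    show "(\<xi> has_real_derivative exp (- (a * z)) * ((c1 z + d1 z) - a * e z)) (at z)" for z
      unfolding \<xi>_def by (rule DERIV_cong[OF DERIV_mult[OF X ed(1)]]) (simp add: algebra_simps)
    show "((\<lambda>z. exp (- (a * z)) * ((c1 z + d1 z) - a * e z)) has_real_derivative
        exp (- (a * z)) * ((m * e z + k z) - a * (c1 z + d1 z) - a * ((c1 z + d1 z) - a * e z))) (at z)" for z
      by (rule DERIV_cong[OF DERIV_mult[OF X DERIV_diff[OF ed(2) DERIV_cmult[OF ed(1)]]]]) (simp add:
          algebra_simps)
    have ec: "continuous_on UNIV e" "continuous_on UNIV (\<lambda>z. c1 z + d1 z)"
      using ed by (auto intro!: continuous_at_imp_continuous_on DERIV_isCont)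
    have "continuous_on UNIV (\<lambda>z. exp (- (a * z)))" by (intro continuous_intros)
    then show "continuous_on UNIV (\<lambda>z. exp (- (a * z)) * ((m * e z + k z) - a * (c1 z + d1 z) - a * ((c1
        z + d1 z) - a * e z)))"
      by (intro ec kc continuous_on_mult continuous_on_diff continuous_on_add continuous_on_const)
  qed
  define h1 where "h1 = (\<lambda>v. h (fst v, 0, snd v) - \<xi> (snd v))"
  define h2 where "h2 = (\<lambda>v. (h (0, fst v, - snd v) - h (0, 0, - snd v)) - - \<xi> (- snd v))"
  have ee: "exp (- (a * z)) * (exp (a * z) * b) = b" for z b by (simp add: exp_minus field_simps)
  have h1e: "h1 (x, z) = exp (- (a * z)) * ((u x 0 z - c0 z) + - d0 z)" for x z
  proof -
    have "exp (- (a * z)) * ((u x 0 z - c0 z) + - d0 z) = exp (- (a * z)) * u x 0 z - \<xi> z"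
      by (simp add: \<xi>_def e_def algebra_simps)
    then show ?thesis by (simp add: h1_def u_def ee)
  qed
  have h2e: "h2 (y, w) = exp (- (- a * w)) * ((u 0 y (- w) - u 0 0 (- w) + c0 (- w)) + d0 (- w))" for y w
  proof -
    have "exp (- (a * (- w))) * ((u 0 y (- w) - u 0 0 (- w) + c0 (- w)) + d0 (- w))
       = exp (- (a * (- w))) * u 0 y (- w) - exp (- (a * (- w))) * u 0 0 (- w) + \<xi> (- w)"
      by (simp only: \<xi>_def e_def) (simp add: algebra_simps)
    also have "\<dots> = h2 (y, w)" unfolding u_def ee by (simp add: h2_def)
    finally show ?thesis by simp
  qed
  have "h1 \<in> H_plus (L_Hyp p a) lam"
    unfolding H_plus_def
  proof (intro CollectI conjI allI)
    have l: "bounded_linear (\<lambda>v::real \<times> real. (fst v, 0::real, snd v))" "bounded_linear (snd :: real \<times>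
        real \<Rightarrow> real)"
      by (intro bounded_linear_Pair bounded_linear_fst bounded_linear_snd bounded_linear_zero)+
    show "C2 h1"
      unfolding h1_def by (rule C2_diff[OF C2_compose_linear[OF h(1) l(1)] C2_compose_linear[OF C\<xi> l(2)]])
    fix v :: "real \<times> real"
    show "0 \<le> h1 v" using up[of "snd v" "fst v"] h1e[of "fst v" "snd v"] by simp
    show "L_Hyp p a h1 v = lam * h1 v" by (rule strip_solution_L_Hyp[OF F'[unfolded m_def] h1e])
  qed
  moreover have "h2 \<in> H_plus (L_Hyp q (- a)) lam"
    unfolding H_plus_def
  proof (intro CollectI conjI allI)
    have l: "bounded_linear (\<lambda>v::real \<times> real. (0::real, fst v, - snd v))"
      "bounded_linear (\<lambda>v::real \<times> real. (0::real, 0::real, - snd v))"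
      "bounded_linear (\<lambda>v::real \<times> real. - snd v)"
      by (intro bounded_linear_Pair bounded_linear_fst bounded_linear_snd bounded_linear_zero
          bounded_linear_minus)+
    have "C2 (\<lambda>z. 0 - \<xi> z)" by (rule C2_diff[OF C2_real[of "\<lambda>_. 0" "\<lambda>_. 0" "\<lambda>_. 0"] C\<xi>]) auto
    then have "C2 (\<lambda>z. - \<xi> z)" by simp
    then show "C2 h2"
      unfolding h2_def
      by (intro C2_diff C2_compose_linear[OF h(1) l(1)] C2_compose_linear[OF h(1) l(2)]
          C2_compose_linear[OF _ l(3)])
    fix v :: "real \<times> real"
    show "0 \<le> h2 v"
      using low[of "fst v" "- snd v"] h2e[of "fst v" "snd v"] by (simp add: zero_le_mult_iff)
    have S: "strip_solution q (2 * lam + (- a)\<^sup>2) (\<lambda>y w. (u 0 y (- w) - u 0 0 (- w) + c0 (- w)) + d0 (- w))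
        (\<lambda>y w. uy 0 y (- w)) (\<lambda>y w. uyy 0 y (- w))
        (\<lambda>y w. - ((uz 0 y (- w) - uz 0 0 (- w) + c1 (- w)) + d1 (- w)))
        (\<lambda>y w. uzz 0 y (- w) - uzz 0 0 (- w) + (m * c0 (- w) + k (- w)) + m * d0 (- w))"
    proof
      fix y w
      have mn: "(uminus has_real_derivative - 1) (at w)" by (auto intro!: derivative_eq_intros)
      show "((\<lambda>t. u 0 t (- w) - u 0 0 (- w) + c0 (- w) + d0 (- w)) has_real_derivative uy 0 y (- w)) (at y)"
        by (rule G'.dx)
      show "((\<lambda>t. uy 0 t (- w)) has_real_derivative uyy 0 y (- w)) (at y)" by (rule G'.dxx)
      show "((\<lambda>t. u 0 y (- t) - u 0 0 (- t) + c0 (- t) + d0 (- t)) has_real_derivative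
          - ((uz 0 y (- w) - uz 0 0 (- w) + c1 (- w)) + d1 (- w))) (at w)"
        using DERIV_chain2[OF G'.dz mn] by simp
      show "((\<lambda>t. - ((uz 0 y (- t) - uz 0 0 (- t) + c1 (- t)) + d1 (- t))) has_real_derivative
          uzz 0 y (- w) - uzz 0 0 (- w) + (m * c0 (- w) + k (- w)) + m * d0 (- w)) (at w)"
        by (rule DERIV_cong[OF DERIV_minus[OF DERIV_chain2[OF G'.dzz[of y] mn]]]) simp
      show "exp (2 * q * w) * uyy 0 y (- w) + (uzz 0 y (- w) - uzz 0 0 (- w) + (m * c0 (- w) + k (- w))
          + m * d0 (- w))
        = (2 * lam + (- a)\<^sup>2) * (u 0 y (- w) - u 0 0 (- w) + c0 (- w) + d0 (- w))"
        using G'.pde[of "- w" y] by (simp add: m_def)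
    next
      show "continuous_on UNIV (\<lambda>(y, w). u 0 y (- w) - u 0 0 (- w) + c0 (- w) + d0 (- w))"
      proof -
        have "continuous_on UNIV (\<lambda>v::real \<times> real. (fst v, - snd v))" by (intro continuous_intros)
        from continuous_on_compose2[OF G'.cont this] show ?thesis by (simp add: case_prod_beta')
      qed
    qed
    show "L_Hyp q (- a) h2 v = lam * h2 v" by (rule strip_solution_L_Hyp[OF S h2e])
  qed
  moreover have "\<forall>x y z. h (x, y, z) = h1 (x, z) + h2 (y, - z)"
  proof (intro allI)
    fix x y z
    have "exp (- (a * z)) * u x y z = exp (- (a * z)) * u x 0 z + (exp (- (a * z)) * u 0 y z - exp (- (a
        * z)) * u 0 0 z)"
      by (subst split) (simp add: algebra_simps)
    then have "h (x, y, z) = h (x, 0, z) + (h (0, y, z) - h (0, 0, z))" unfolding u_def ee .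
    then show "h (x, y, z) = h1 (x, z) + h2 (y, - z)" by (simp add: h1_def h2_def)
  qed
  ultimately show ?thesis by blast
qed

end
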